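(* Let $d \geq 1$ and $1/(d+1) < \alpha < 1/d$. Then with high probability a complex $\widetilde Z \sim \widetilde Z(2n, n^{-\alpha})$, with its free involution $\iota\colon \widetilde Z \to \widetilde Z$, satisfies: for every continuous map $f\colon |\widetilde Z| \to \mathbb{R}^{d+1}$ there is a point $x \in |\widetilde Z|$ with $f(x) = f(\iota(x))$.
   Context: For a flag complex $K$ on vertex set $V$ (i.e., the clique complex of its 1-skeleton), the separated deleted join of $K$ is the simplicial complex on vertex set $V \times \{-1,+1\}$ whose faces are the sets $(\sigma \times \{-1\}) \cup (\tau \times \{+1\})$ where $\sigma, \tau$ are faces of $K$ (possibly empty) with $\sigma \cap \tau = \emptyset$ and no vertex of $\sigma$ is joined by an edge of $K$ to any vertex of $\tau$. It carries the simplicial involution $\iota$ given by $\iota(v,-1) = (v,+1)$, $\iota(v,+1) = (v,-1)$, which is fixed-point free on the geometric realization. For a finite simple graph $G$, let $\overline G$ denote its flag (clique) complex and $\widetilde Z(G)$ the separated deleted join of $\overline G$. $\widetilde Z(2n,p)$ denotes the distribution of $\widetilde Z(G)$ for $G \sim G(n,p)$, the Erdős–Rényi random graph on $[n]$ with each edge independently present with probability $p$. "With high probability" means with probability tending to $1$ as $n\to\infty$. *)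

theory Defs
  imports "HOL-Analysis.Analysis"
begin

text \<open>Graphs on vertex set [n] = {0..<n} are given by their edge sets: sets of
  2-element subsets of {0..<n}.\<close>

definition edge_slots :: "nat \<Rightarrow> nat set set" where
  "edge_slots n = {e. \<exists>u v. e = {u, v} \<and> u \<noteq> v \<and> u < n \<and> v < n}"

definition gnp_prob :: "nat \<Rightarrow> real \<Rightarrow> (nat set set \<Rightarrow> bool) \<Rightarrow> real" where
  "gnp_prob n p P =
     (\<Sum>E\<in>Pow (edge_slots n).
        (if P E then p ^ card E * (1 - p) ^ (card (edge_slots n) - card E) else 0))"

text \<open>Flag (clique) complex of the graph with edge set E on [n]; faces include the empty set.\<close>
definition flag_complex :: "nat \<Rightarrow> nat set set \<Rightarrow> nat set set" where
  "flag_complex n E = {\<sigma>. \<sigma> \<subseteq> {0..<n} \<and> (\<forall>u\<in>\<sigma>. \<forall>v\<in>\<sigma>. u \<noteq> v \<longrightarrow> {u, v} \<in> E)}"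

definition sep_deleted_join :: "'a set set \<Rightarrow> ('a \<times> int) set set" where
  "sep_deleted_join K =
     {(\<sigma> \<times> {-1}) \<union> (\<tau> \<times> {1}) | \<sigma> \<tau>. \<sigma> \<in> K \<and> \<tau> \<in> K \<and> \<sigma> \<inter> \<tau> = {} \<and>
        \<not> (\<exists>u\<in>\<sigma>. \<exists>v\<in>\<tau>. u \<noteq> v \<and> {u, v} \<in> K)}"

text \<open>Geometric realization of a simplicial complex K on the finite vertex set V:
  points are the barycentric coordinate functions supported on a face; topology is
  the subspace topology of the (product) topology on the function space.\<close>
definition geom_real :: "'a set \<Rightarrow> 'a set set \<Rightarrow> ('a \<Rightarrow> real) set" where
  "geom_real V K = {x. (\<forall>v. 0 \<le> x v) \<and> (\<forall>v. v \<notin> V \<longrightarrow> x v = 0) \<and>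
                        sum x V = 1 \<and> {v. x v \<noteq> 0} \<in> K}"

definition swap_inv :: "('a \<times> int \<Rightarrow> real) \<Rightarrow> ('a \<times> int \<Rightarrow> real)" where
  "swap_inv x = (\<lambda>(v, s). x (v, - s))"

definition Ztilde_real :: "nat \<Rightarrow> nat set set \<Rightarrow> (nat \<times> int \<Rightarrow> real) set" where
  "Ztilde_real n E = geom_real ({0..<n} \<times> {-1, 1}) (sep_deleted_join (flag_complex n E))"

end

theory Submission
  imports Defs "HOL-Library.Z2" "HOL-Homology.Homology" "HOL-Real_Asymp.Real_Asymp"
begin

text \<open>
  The complex is the flag complex of a graph on the signed vertices: \<open>(x, s)\<close> and \<open>(y, s)\<close> are
  adjacent if \<open>xy\<close> is an edge, and \<open>(x, s)\<close> and \<open>(y, - s)\<close> if \<open>x \<noteq> y\<close> and \<open>xy\<close> is not an edge.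
  With high probability any \<open>d\<close> vertices have a common neighbour that avoids the neighbourhoods of
  boundedly many other vertices, and such common neighbourhoods of fewer than \<open>d\<close> vertices are
  connected. Since one of the two signs occurs at most \<open>d\<close> times in a set of \<open>2 * d + 1\<close> signed
  vertices, every such set without antipodal pairs has a common neighbour, and the common
  neighbourhood of at most \<open>2 * d\<close> signed vertices is connected. By Meshulam's argument on
  domination, cycles modulo two of dimension at most \<open>d\<close> then bound. Hence there are chains
  \<open>c 0, \<dots>, c (d + 1)\<close>, starting from a vertex, such that the boundary of \<open>c (k + 1)\<close> is the sum
  of \<open>c k\<close> and its antipode.

  A map \<open>f\<close> without coincidence labels each point by the index and the sign of the largest
  coordinate of \<open>f x - f (\<iota> x)\<close>. Counting, modulo two and in a fine subdivision, the simplices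
  whose labels alternate in sign (Fan's lemma) yields cochains dual to the chains above: the count
  is 1 on \<open>c 0\<close> plus its antipode and is carried along to \<open>c (d + 1)\<close>, where it vanishes because
  there are only \<open>d + 1\<close> indices.
\<close>

text \<open>The size \<open>2 * d + 1\<close> is the limit of domination. A set of
  \<open>2 * d + 2\<close> signed vertices may contain \<open>d + 1\<close> of each sign, and a
  common neighbour of either sign would be joined to \<open>d + 1\<close> given vertices of the
  graph; the expected number of such vertices is about
  \<open>n powr (1 - \<alpha> * (d + 1))\<close>, which tends to 0. Domination alone would need
  \<open>2 * d + 2\<close> to fill cycles of dimension \<open>d\<close>: inserting an edge uses up
  two vertices for each dimension, and a path of length two between two points of a common
  neighbourhood uses up two more. Connectivity of common neighbourhoods is therefore proved
  separately and serves as the start of the induction. Coefficients modulo two remove orientations,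
  and a chain with invariant boundary becomes a cycle when its antipode is added. The fine
  subdivision is the iterated singular subdivision: it commutes with boundaries and with the
  involution, so identities for small simplices can be summed to identities for whole faces.\<close>

text \<open>These rules turn the field operations on bits into bitwise ones and sums of truth values into
  cardinalities.\<close>

declare add_bit_eq_xor [simp del] mult_bit_eq_and [simp del] sum_of_bool_eq [simp del]

section \<open>Chains modulo two in flag complexes\<close>

lemma bit_double [simp]: "(a::bit) + a = 0"
  by (cases a) auto

lemma bit_add_eq_0: "(a::bit) + b = 0 \<longleftrightarrow> a = b"
  by (cases a; cases b) auto

lemma bit_add_cancel [simp]: "(a::bit) + (a + b) = b"
  by (cases a; cases b) auto

definition cliques :: "('a \<Rightarrow> 'a \<Rightarrow> bool) \<Rightarrow> 'a set \<Rightarrow> 'a set set" where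
  "cliques R U = {\<sigma>. \<sigma> \<subseteq> U \<and> (\<forall>x\<in>\<sigma>. \<forall>y\<in>\<sigma>. x \<noteq> y \<longrightarrow> R x y)}"

text \<open>A chain with coefficients in the two-element field is its coefficient function on
  vertex sets; chains are graded by the number of vertices, that is, by dimension plus one.\<close>

definition bd :: "'a set \<Rightarrow> ('a set \<Rightarrow> bit) \<Rightarrow> 'a set \<Rightarrow> bit" where
  "bd V c \<tau> = (\<Sum>v\<in>V - \<tau>. c (insert v \<tau>))"

definition chain_in :: "nat \<Rightarrow> 'a set set \<Rightarrow> ('a set \<Rightarrow> bit) \<Rightarrow> bool" where
  "chain_in n F c \<longleftrightarrow> (\<forall>\<sigma>. c \<sigma> \<noteq> 0 \<longrightarrow> \<sigma> \<in> F \<and> finite \<sigma> \<and> card \<sigma> = n)"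

text \<open>The empty set is a face, so \<open>bd\<close> at \<open>{}\<close> is the augmentation
  and this is vanishing in reduced homology: for \<open>n = 1\<close> the cycles are the vertex sets
  of even size.\<close>

definition bounds :: "'a set \<Rightarrow> nat \<Rightarrow> 'a set set \<Rightarrow> ('a set \<Rightarrow> bit) \<Rightarrow> bool" where
  "bounds V n F z \<longleftrightarrow> (\<exists>w. chain_in (Suc n) F w \<and> bd V w = z)"

definition cone_chain :: "'a \<Rightarrow> ('a set \<Rightarrow> bit) \<Rightarrow> 'a set \<Rightarrow> bit" where
  "cone_chain x t \<sigma> = (if x \<in> \<sigma> then t (\<sigma> - {x}) else 0)"

text \<open>With \<open>cone_chain\<close> as the join with \<open>x\<close>, a chain splits as
  \<open>x * link_chain x z + del_chain x z\<close>. The case \<open>x \<in> \<tau>\<close> is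
  excluded because \<open>z (insert x \<tau>)\<close> would then return \<open>z \<tau>\<close>
  itself.\<close>

definition link_chain :: "'a \<Rightarrow> ('a set \<Rightarrow> bit) \<Rightarrow> 'a set \<Rightarrow> bit" where
  "link_chain x z \<tau> = (if x \<in> \<tau> then 0 else z (insert x \<tau>))"

definition del_chain :: "'a \<Rightarrow> ('a set \<Rightarrow> bit) \<Rightarrow> 'a set \<Rightarrow> bit" where
  "del_chain x z \<tau> = (if x \<in> \<tau> then 0 else z \<tau>)"

lemma chain_inD:
  assumes "chain_in n F c" "c \<sigma> = 1"
  shows "\<sigma> \<in> F" "finite \<sigma>" "card \<sigma> = n"
  using assms by (auto simp: chain_in_def)

lemma chain_in_eq_0: "chain_in n F c \<Longrightarrow> \<sigma> \<notin> F \<Longrightarrow> c \<sigma> = 0"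
  unfolding chain_in_def by blast

lemma chain_inI:
  "(\<And>\<sigma>. c \<sigma> = 1 \<Longrightarrow> \<sigma> \<in> F \<and> finite \<sigma> \<and> card \<sigma> = n) \<Longrightarrow> chain_in n F c"
  by (auto simp: chain_in_def)

lemma chain_in_add:
  "chain_in n F a \<Longrightarrow> chain_in n F b \<Longrightarrow> chain_in n F (\<lambda>\<sigma>. a \<sigma> + b \<sigma>)"
  unfolding chain_in_def by (metis add_0)

lemma chain_in_mono: "chain_in n F a \<Longrightarrow> F \<subseteq> G \<Longrightarrow> chain_in n G a"
  unfolding chain_in_def by blast

lemma cliques_mono: "U \<subseteq> W \<Longrightarrow> cliques R U \<subseteq> cliques R W"
  by (auto simp: cliques_def)

lemma cliques_subset: "\<sigma> \<in> cliques R U \<Longrightarrow> \<tau> \<subseteq> \<sigma> \<Longrightarrow> \<tau> \<in> cliques R U"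
  unfolding cliques_def mem_Collect_eq by (meson order_trans subsetD)

lemma bd_add: "bd V (\<lambda>\<sigma>. a \<sigma> + b \<sigma>) = (\<lambda>\<sigma>. bd V a \<sigma> + bd V b \<sigma>)"
  by (simp add: bd_def sum.distrib fun_eq_iff)

text \<open>Dropping the apex from \<open>x * s\<close> leaves \<open>s\<close>, dropping another
  vertex leaves a cone over a face of \<open>s\<close>. The hypothesis on \<open>t\<close> keeps the
  apex out of the base.\<close>

lemma bd_cone:
  assumes "finite V" "x \<in> V" and t: "\<And>\<sigma>. x \<in> \<sigma> \<Longrightarrow> t \<sigma> = 0"
  shows "bd V (cone_chain x t) = (\<lambda>\<tau>. t \<tau> + cone_chain x (bd V t) \<tau>)"
proof
  fix \<tau>
  show "bd V (cone_chain x t) \<tau> = t \<tau> + cone_chain x (bd V t) \<tau>"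
  proof (cases "x \<in> \<tau>")
    case True
    have "bd V t (\<tau> - {x}) = (\<Sum>v\<in>insert x (V - \<tau>). t (insert v (\<tau> - {x})))"
      unfolding bd_def using True assms(2) by (intro sum.cong) auto
    also have "\<dots> = (\<Sum>v\<in>V - \<tau>. t (insert v (\<tau> - {x})))"
      using assms True by (subst sum.insert) auto
    also have "\<dots> = bd V (cone_chain x t) \<tau>"
      unfolding bd_def cone_chain_def using True by (intro sum.cong) (auto simp: insert_Diff_if)
    finally show ?thesis using True t by (simp add: cone_chain_def)
  next
    case False
    have "bd V (cone_chain x t) \<tau> = (\<Sum>v\<in>V - \<tau>. if v = x then t \<tau> else 0)"
      unfolding bd_def cone_chain_def using False by (intro sum.cong) auto
    also have "\<dots> = t \<tau>" using False assms by (simp add: sum.delta)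
    finally show ?thesis using False by (simp add: cone_chain_def)
  qed
qed

text \<open>In \<open>bd V z \<tau> = 0\<close> with \<open>x \<notin> \<tau>\<close> the term for
  \<open>v = x\<close> is the link coefficient, and the other terms form the boundary of the
  deletion.\<close>

lemma bd_del_chain:
  assumes "finite V" "x \<in> V" and z: "bd V z = (\<lambda>_. 0)"
  shows "bd V (del_chain x z) = link_chain x z"
proof
  fix \<tau>
  show "bd V (del_chain x z) \<tau> = link_chain x z \<tau>"
  proof (cases "x \<in> \<tau>")
    case True
    then show ?thesis by (simp add: bd_def del_chain_def link_chain_def)
  next
    case False
    have "0 = bd V z \<tau>" using z by simp
    also have "\<dots> = (\<Sum>v\<in>V - \<tau>. (if v = x then z (insert x \<tau>) else 0) + del_chain x z (insert v \<tau>))"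
      unfolding bd_def using False by (intro sum.cong) (auto simp: del_chain_def)
    also have "\<dots> = z (insert x \<tau>) + bd V (del_chain x z) \<tau>"
      using False assms by (simp add: sum.distrib sum.delta bd_def)
    finally show ?thesis using False by (simp add: link_chain_def) (metis bit_add_eq_0)
  qed
qed

lemma bd_link_chain:
  assumes "finite V" "x \<in> V" and z: "bd V z = (\<lambda>_. 0)"
  shows "bd V (link_chain x z) = (\<lambda>_. 0)"
proof
  fix \<tau>
  show "bd V (link_chain x z) \<tau> = 0"
  proof (cases "x \<in> \<tau>")
    case True
    then show ?thesis by (simp add: bd_def link_chain_def)
  next
    case False
    have "0 = bd V z (insert x \<tau>)" using z by simp
    also have "\<dots> = (\<Sum>v\<in>V - \<tau> - {x}. link_chain x z (insert v \<tau>))"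
      unfolding bd_def using False
      by (intro sum.cong) (auto simp: link_chain_def insert_commute)
    also have "\<dots> = bd V (link_chain x z) \<tau>"
      unfolding bd_def using assms(1) by (intro sum.mono_neutral_left) (auto simp: link_chain_def)
    finally show ?thesis by simp
  qed
qed

lemma cone_link_del: "cone_chain x (link_chain x z) \<sigma> + del_chain x z \<sigma> = z \<sigma>"
  by (auto simp: cone_chain_def link_chain_def del_chain_def insert_absorb)

lemma chain_in_cone:
  assumes t: "chain_in n (cliques R U) t" and x: "x \<in> W" "U \<subseteq> W" "x \<notin> U"
    and adj: "\<And>y. y \<in> U \<Longrightarrow> R x y \<and> R y x"
  shows "chain_in (Suc n) (cliques R W) (cone_chain x t)"
proof (rule chain_inI)
  fix \<sigma> assume "cone_chain x t \<sigma> = 1"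
  then have \<sigma>: "x \<in> \<sigma>" "t (\<sigma> - {x}) = 1" by (auto simp: cone_chain_def split: if_splits)
  note * = chain_inD[OF t \<sigma>(2)]
  have fin: "finite \<sigma>" using *(2) by simp
  then have "card \<sigma> = Suc n" using *(3) \<sigma>(1) by (metis card_Suc_Diff1)
  moreover have "\<sigma> \<in> cliques R W"
  proof -
    have sub: "\<sigma> - {x} \<subseteq> U" and pair: "\<And>a b. a \<in> \<sigma> - {x} \<Longrightarrow> b \<in> \<sigma> - {x} \<Longrightarrow> a \<noteq> b \<Longrightarrow> R a b"
      using *(1) unfolding cliques_def by auto
    have "R a b" if ab: "a \<in> \<sigma>" "b \<in> \<sigma>" "a \<noteq> b" for a b
    proof (cases "a = x \<or> b = x")
      case True
      then show ?thesis using adj[of a] adj[of b] sub ab by auto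
    qed (use pair ab in auto)
    moreover have "\<sigma> \<subseteq> W" using sub x by auto
    ultimately show ?thesis unfolding cliques_def by auto
  qed
  ultimately show "\<sigma> \<in> cliques R W \<and> finite \<sigma> \<and> card \<sigma> = Suc n" using fin by simp
qed

lemma chain_in_del:
  assumes "chain_in n (cliques R U) z"
  shows "chain_in n (cliques R (U - {x})) (del_chain x z)"
  using assms unfolding chain_in_def cliques_def del_chain_def by auto

text \<open>The cone over the part of \<open>z\<close> that avoids the apex is already a filling:
  its boundary is that part plus \<open>x * link_chain x z\<close>.\<close>

lemma bounds_cone_point:
  assumes V: "finite V" "U \<subseteq> V" and x: "x \<in> U"
    and adj: "\<And>y. y \<in> U - {x} \<Longrightarrow> R x y \<and> R y x"
    and z: "chain_in n (cliques R U) z" "bd V z = (\<lambda>_. 0)"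
  shows "bounds V n (cliques R U) z"
proof -
  have xV: "x \<in> V" using x V by auto
  let ?w = "cone_chain x (del_chain x z)"
  have "bd V ?w = (\<lambda>\<tau>. del_chain x z \<tau> + cone_chain x (bd V (del_chain x z)) \<tau>)"
    by (intro bd_cone V xV) (simp add: del_chain_def)
  also have "\<dots> = z"
    unfolding bd_del_chain[OF V(1) xV z(2)] using cone_link_del[of x z] by (simp add: add.commute)
  finally show ?thesis
    using chain_in_cone[OF chain_in_del[OF z(1)], of x U x] x adj unfolding bounds_def by blast
qed

text \<open>The set \<open>T\<close> guarantees that the dimension of the cross-polytope is large enough.\<close>

lemma bounds_cross_polytope:
  assumes V: "finite V" and inv: "\<And>x. neg (neg x) = x" "\<And>x. x \<in> V \<Longrightarrow> neg x \<noteq> x"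
    and R: "\<And>x. \<not> R x (neg x)"
  shows "U \<subseteq> V \<Longrightarrow> (\<And>x y. x \<in> U \<Longrightarrow> y \<in> U \<Longrightarrow> x \<noteq> y \<Longrightarrow> y \<noteq> neg x \<Longrightarrow> R x y) \<Longrightarrow>
    T \<subseteq> U \<Longrightarrow> (\<And>x. x \<in> T \<Longrightarrow> neg x \<notin> T) \<Longrightarrow> n < card T \<Longrightarrow>
    chain_in n (cliques R U) z \<Longrightarrow> bd V z = (\<lambda>_. 0) \<Longrightarrow> bounds V n (cliques R U) z"
proof (induction n arbitrary: U T z)
  case 0
  \<comment> \<open>A chain on the empty face is filled by the same multiple of a single vertex,
    which \<open>0 < card T\<close> provides.\<close>
  then obtain x where x: "x \<in> T" by fastforce
  then have xU: "x \<in> U" "x \<in> V" using 0 by auto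
  have z0: "z \<sigma> = 0" if "\<sigma> \<noteq> {}" for \<sigma>
    using chain_inD(2,3)[OF 0(6), of \<sigma>] that by (cases "z \<sigma>") auto
  have "bd V (cone_chain x z) = z"
    using bd_cone[OF V xU(2), of z] z0 0(7) by (auto simp: cone_chain_def fun_eq_iff)
  moreover have "chain_in (Suc 0) (cliques R U) (cone_chain x z)"
  proof (rule chain_inI)
    fix \<sigma> assume "cone_chain x z \<sigma> = 1"
    then have "\<sigma> = {x}" using z0[of "\<sigma> - {x}"] by (auto simp: cone_chain_def split: if_splits)
    then show "\<sigma> \<in> cliques R U \<and> finite \<sigma> \<and> card \<sigma> = Suc 0" using xU by (simp add: cliques_def)
  qed
  ultimately show ?case unfolding bounds_def by blast
next
  case (Suc m)
  note z = Suc.prems(6,7)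
  obtain x where xT: "x \<in> T" using Suc.prems(5) by fastforce
  then have x: "x \<in> U" "x \<in> V" using Suc.prems by auto
  \<comment> \<open>If \<open>neg x\<close> is missing, \<open>U\<close> is a cone with apex
    \<open>x\<close>; otherwise it is the suspension of \<open>U'\<close> with apices
    \<open>x\<close> and \<open>neg x\<close>.\<close>
  show ?case
  proof (cases "neg x \<in> U")
    case False
    show ?thesis
    proof (rule bounds_cone_point[OF V Suc.prems(1) x(1) _ z])
      fix y assume y: "y \<in> U - {x}"
      then have "y \<noteq> neg x" using False by auto
      moreover have "x \<noteq> neg y" using inv(1) calculation by metis
      ultimately show "R x y \<and> R y x" using Suc.prems(2) y x by blast
    qed
  next
    case True
    define U' where "U' = U - {x, neg x}"
    have l: "chain_in m (cliques R U') (link_chain x z)"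
    proof (rule chain_inI)
      fix \<sigma> assume "link_chain x z \<sigma> = 1"
      then have \<sigma>: "x \<notin> \<sigma>" "z (insert x \<sigma>) = 1" by (auto simp: link_chain_def split: if_splits)
      note * = chain_inD[OF z(1) \<sigma>(2)]
      have "neg x \<notin> \<sigma>" using *(1) R[of x] inv(2)[OF x(2)] unfolding cliques_def by fastforce
      then have "\<sigma> \<in> cliques R U'" using *(1) \<sigma>(1) unfolding cliques_def U'_def by auto
      then show "\<sigma> \<in> cliques R U' \<and> finite \<sigma> \<and> card \<sigma> = m" using * \<sigma>(1) by simp
    qed
    have "bounds V m (cliques R U') (link_chain x z)"
    proof (rule Suc.IH[OF _ _ _ _ _ l])
      show "U' \<subseteq> V" using Suc.prems(1) by (auto simp: U'_def)
      show "T - {x} \<subseteq> U'" using Suc.prems(3,4) xT by (auto simp: U'_def)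
      show "m < card (T - {x})"
        using Suc.prems(5) xT by (simp add: card_Diff_singleton less_diff_conv)
      show "bd V (link_chain x z) = (\<lambda>_. 0)" by (rule bd_link_chain[OF V x(2) z(2)])
    qed (use Suc.prems(2,4) in \<open>auto simp: U'_def\<close>)
    then obtain t where t: "chain_in (Suc m) (cliques R U') t" "bd V t = link_chain x z"
      unfolding bounds_def by blast
    have t0: "t \<sigma> = 0" if "x \<in> \<sigma>" for \<sigma>
      using that by (intro chain_in_eq_0[OF t(1)]) (auto simp: cliques_def U'_def)
    \<comment> \<open>The link is the boundary of the deletion and also of \<open>t\<close>, so
      their sum is a cycle. It avoids \<open>x\<close>, hence lies in a cone with apex
      \<open>neg x\<close> and has a filling \<open>w\<close>; then \<open>x * t + w\<close> fills
      \<open>z\<close>.\<close>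
    let ?z = "\<lambda>\<sigma>. del_chain x z \<sigma> + t \<sigma>"
    have "bounds V (Suc m) (cliques R (U - {x})) ?z"
    proof (rule bounds_cone_point[OF V, of _ "neg x"])
      show "U - {x} \<subseteq> V" using Suc.prems(1) by auto
      show "neg x \<in> U - {x}" using True inv(2)[OF x(2)] by auto
      show "R (neg x) y \<and> R y (neg x)" if "y \<in> U - {x} - {neg x}" for y
      proof -
        have "neg y \<noteq> neg x" using that inv(1) by (metis DiffD1 DiffD2 insertI1)
        moreover have "y \<noteq> neg (neg x)" "y \<noteq> neg x" using that inv(1) by auto
        ultimately show ?thesis using Suc.prems(2) that True by (metis DiffD1)
      qed
      show "chain_in (Suc m) (cliques R (U - {x})) ?z"
        by (intro chain_in_add chain_in_del z chain_in_mono[OF t(1)] cliques_mono) (auto simp: U'_def)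
      show "bd V ?z = (\<lambda>_. 0)"
        unfolding bd_add bd_del_chain[OF V x(2) z(2)] t(2) by simp
    qed
    then obtain w where w: "chain_in (Suc (Suc m)) (cliques R (U - {x})) w" "bd V w = ?z"
      unfolding bounds_def by blast
    have "bd V (\<lambda>\<sigma>. cone_chain x t \<sigma> + w \<sigma>) = z"
    proof -
      have "bd V (cone_chain x t) \<sigma> + (del_chain x z \<sigma> + t \<sigma>) = z \<sigma>" for \<sigma>
      proof -
        have "bd V (cone_chain x t) \<sigma> = t \<sigma> + cone_chain x (link_chain x z) \<sigma>"
          using bd_cone[of V x t, OF V x(2)] t0 t(2) by simp
        then show ?thesis using cone_link_del[of x z \<sigma>] by (simp add: ac_simps)
      qed
      then show ?thesis unfolding bd_add w(2) by auto
    qed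
    moreover have "chain_in (Suc (Suc m)) (cliques R U) (\<lambda>\<sigma>. cone_chain x t \<sigma> + w \<sigma>)"
    proof (intro chain_in_add chain_in_mono[OF w(1)] chain_in_cone[OF t(1)])
      show "R x y \<and> R y x" if "y \<in> U'" for y
        using that Suc.prems(2)[of x y] Suc.prems(2)[of y x] x inv(1) unfolding U'_def by (metis Diff_iff insertCI)
    qed (use x in \<open>auto simp: U'_def cliques_def\<close>)
    ultimately show ?thesis unfolding bounds_def by blast
  qed
qed


section \<open>Filling cycles in common neighbourhoods\<close>

definition antipode_free :: "('a \<Rightarrow> 'a) \<Rightarrow> 'a set \<Rightarrow> bool" where
  "antipode_free neg S \<longleftrightarrow> (\<forall>x\<in>S. neg x \<notin> S)"

definition common_nbrs :: "'a set \<Rightarrow> ('a \<Rightarrow> 'a \<Rightarrow> bool) \<Rightarrow> 'a set \<Rightarrow> 'a set" where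
  "common_nbrs V R S = {v \<in> V. \<forall>s\<in>S. R v s}"

text \<open>Antipodal points are never adjacent, so the largest such relation has a cross-polytope
  as clique complex; the edge insertions in \<open>bounds_common_nbrs\<close> move towards
  it.\<close>

definition antipodal_graph :: "'a set \<Rightarrow> ('a \<Rightarrow> 'a) \<Rightarrow> ('a \<Rightarrow> 'a \<Rightarrow> bool) \<Rightarrow> bool" where
  "antipodal_graph V neg R \<longleftrightarrow>
     (\<forall>x y. R x y \<longrightarrow> x \<in> V \<and> y \<in> V \<and> x \<noteq> y \<and> y \<noteq> neg x \<and> R y x)"

text \<open>Domination is restricted to antipode-free sets because in the signed graph a common
  neighbour of \<open>(x, 1)\<close> and \<open>(x, -1)\<close> would be both joined and not joined
  to \<open>x\<close>. \<open>connected\<close> is phrased by cuts since it is applied to the set of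
  vertices homologous to a fixed one.\<close>

locale dominated_graph =
  fixes V :: "'a set" and neg :: "'a \<Rightarrow> 'a" and R :: "'a \<Rightarrow> 'a \<Rightarrow> bool" and e :: nat
  assumes fin: "finite V" and neg_neg: "neg (neg x) = x" and neg_ne: "x \<in> V \<Longrightarrow> neg x \<noteq> x"
    and graph: "antipodal_graph V neg R"
    and dominated: "\<And>S. S \<subseteq> V \<Longrightarrow> antipode_free neg S \<Longrightarrow> card S \<le> e \<Longrightarrow> common_nbrs V R S \<noteq> {}"
    and connected: "\<And>S T. S \<subseteq> V \<Longrightarrow> antipode_free neg S \<Longrightarrow> card S < e \<Longrightarrow>
      T \<subseteq> common_nbrs V R S \<Longrightarrow> T \<noteq> {} \<Longrightarrow> T \<noteq> common_nbrs V R S \<Longrightarrow>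
      \<exists>x\<in>T. \<exists>y\<in>common_nbrs V R S - T. R x y"
begin

lemma antipode_free_Un:
  assumes "antipodal_graph V neg R'" "antipode_free neg S" "T \<subseteq> common_nbrs V R' S" "antipode_free neg T"
  shows "antipode_free neg (S \<union> T)"
proof -
  have "neg x \<notin> T \<and> neg t \<notin> S" if "x \<in> S" "t \<in> T" for x t
  proof -
    have "R' t s" if "s \<in> S" "t \<in> T" for s t using that assms(3) by (auto simp: common_nbrs_def)
    then show ?thesis using that assms(1) unfolding antipodal_graph_def by (metis neg_neg)
  qed
  then show ?thesis using assms(2,4) unfolding antipode_free_def by blast
qed

lemma antipode_free_single: "x \<in> V \<Longrightarrow> antipode_free neg {x}"
  using neg_ne by (auto simp: antipode_free_def)

text \<open>Chosen greedily: each new vertex is a common neighbour of \<open>S\<close> and of those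
  chosen before, which excludes antipodes. This supplies the set \<open>T\<close> for
  \<open>bounds_cross_polytope\<close>.\<close>

lemma common_nbrs_antipode_free_subset:
  assumes "S \<subseteq> V" "antipode_free neg S" "card S + m \<le> e"
  shows "\<exists>T. T \<subseteq> common_nbrs V R S \<and> finite T \<and> card T = m \<and> antipode_free neg T"
  using assms(3)
proof (induction m)
  case 0
  then show ?case by (intro exI[of _ "{}"]) (simp add: antipode_free_def)
next
  case (Suc m)
  then obtain T where T: "T \<subseteq> common_nbrs V R S" "finite T" "card T = m" "antipode_free neg T"
    by auto
  have "finite S" using assms(1) fin finite_subset by auto
  have "card (S \<union> T) \<le> e" using card_Un_le[of S T] T(3) Suc.prems by linarith
  moreover have "S \<union> T \<subseteq> V" using assms(1) T(1) by (auto simp: common_nbrs_def)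
  ultimately obtain v where v: "v \<in> common_nbrs V R (S \<union> T)"
    using dominated antipode_free_Un[OF graph assms(2) T(1,4)] by blast
  have "v \<notin> T" using v graph unfolding common_nbrs_def antipodal_graph_def by blast
  moreover have "antipode_free neg (T \<union> {v})"
    by (rule antipode_free_Un[OF graph T(4) _ antipode_free_single])
      (use v in \<open>auto simp: common_nbrs_def\<close>)
  ultimately show ?case
    using T v by (intro exI[of _ "T \<union> {v}"]) (auto simp: common_nbrs_def)
qed

text \<open>\<open>connected\<close> speaks of \<open>R\<close> only, whereas \<open>R'\<close> may
  enlarge the common neighbourhood. Each additional vertex \<open>x\<close> still has an
  \<open>R\<close>-neighbour in the old one because \<open>S \<union> {x}\<close> is dominated;
  \<open>card S < e\<close> leaves room for it.\<close>

lemma bounds_0: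
  assumes R': "antipodal_graph V neg R'" "R \<le> R'" and S: "S \<subseteq> V" "antipode_free neg S" "card S < e"
    and z: "chain_in 1 (cliques R' (common_nbrs V R' S)) z" "bd V z = (\<lambda>_. 0)"
  shows "bounds V 1 (cliques R' (common_nbrs V R' S)) z"
proof -
  let ?U = "common_nbrs V R' S" and ?N = "common_nbrs V R S"
  have NU: "?N \<subseteq> ?U" using R'(2) by (auto simp: common_nbrs_def)
  have UV: "?U \<subseteq> V" by (auto simp: common_nbrs_def)
  have sym: "R' x y \<Longrightarrow> R' y x" for x y using R'(1) by (auto simp: antipodal_graph_def)
  let ?d = "\<lambda>x \<sigma>. of_bool (\<sigma> = {x}) :: bit"
  obtain y0 where y0: "y0 \<in> ?N" using dominated[OF S(1,2)] S(3) by auto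
  \<comment> \<open>\<open>P x\<close> says that \<open>x\<close> and \<open>y0\<close> are
    homologous; \<open>step\<close> prolongs a connecting chain by one edge.\<close>
  define P where "P x \<longleftrightarrow> bounds V 1 (cliques R' ?U) (\<lambda>\<sigma>. ?d x \<sigma> + ?d y0 \<sigma>)" for x
  have step: "P y" if xy: "P x" "x \<in> ?U" "y \<in> ?U" "R' x y" for x y
  proof -
    obtain w where w: "chain_in 2 (cliques R' ?U) w" "bd V w = (\<lambda>\<sigma>. ?d x \<sigma> + ?d y0 \<sigma>)"
      using xy(1) unfolding P_def bounds_def by (auto simp: numeral_2_eq_2)
    have ne: "x \<noteq> y" using xy(4) R'(1) by (auto simp: antipodal_graph_def)
    let ?e = "cone_chain x (?d y)"
    have "bd V ?e = (\<lambda>\<sigma>. ?d y \<sigma> + cone_chain x (bd V (?d y)) \<sigma>)"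
      using ne UV xy(2) by (intro bd_cone fin) auto
    moreover have "bd V (?d y) = (\<lambda>\<sigma>. of_bool (\<sigma> = {}))"
    proof
      fix \<tau>
      have "insert v \<tau> = {y} \<longleftrightarrow> \<tau> = {} \<and> v = y" if "v \<in> V - \<tau>" for v using that by auto
      then have "bd V (?d y) \<tau> = (\<Sum>v\<in>V - \<tau>. if v = y then of_bool (\<tau> = {}) else 0)"
        unfolding bd_def by (intro sum.cong) auto
      also have "\<dots> = of_bool (\<tau> = {})"
        using fin UV xy(3) by (subst sum.delta) (auto split: if_splits)
      finally show "bd V (?d y) \<tau> = of_bool (\<tau> = {})" .
    qed
    moreover have "cone_chain x (\<lambda>\<sigma>. of_bool (\<sigma> = {})) = ?d x"
      by (auto simp: cone_chain_def fun_eq_iff)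
    ultimately have e: "bd V ?e = (\<lambda>\<sigma>. ?d y \<sigma> + ?d x \<sigma>)" by simp
    have "chain_in 2 (cliques R' ?U) ?e"
    proof (rule chain_inI)
      fix \<sigma> assume "?e \<sigma> = 1"
      then have "\<sigma> = {x, y}" by (auto simp: cone_chain_def split: if_splits)
      then show "\<sigma> \<in> cliques R' ?U \<and> finite \<sigma> \<and> card \<sigma> = 2"
        using xy ne sym by (auto simp: cliques_def)
    qed
    then have "chain_in (Suc 1) (cliques R' ?U) (\<lambda>\<sigma>. ?e \<sigma> + w \<sigma>)"
      using w(1) by (simp add: numeral_2_eq_2 chain_in_add)
    moreover have "bd V (\<lambda>\<sigma>. ?e \<sigma> + w \<sigma>) = (\<lambda>\<sigma>. ?d y \<sigma> + ?d y0 \<sigma>)"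
      unfolding bd_add e w(2) by (simp add: add.assoc)
    ultimately show ?thesis unfolding P_def bounds_def by blast
  qed
  have Py0: "P y0"
    unfolding P_def bounds_def by (intro exI[of _ "\<lambda>_. 0"]) (auto simp: chain_in_def bd_def)
  have PN: "P x" if "x \<in> ?N" for x
  proof (rule ccontr)
    assume "\<not> P x"
    then have "{u \<in> ?N. P u} \<noteq> ?N" using that by blast
    moreover have "{u \<in> ?N. P u} \<noteq> {}" using Py0 y0 by blast
    ultimately obtain u v where "u \<in> ?N" "P u" "v \<in> ?N" "\<not> P v" "R u v"
      using connected[OF S, of "{u \<in> ?N. P u}"] by blast
    then show False using step[of u v] NU R'(2) by (auto simp: le_fun_def subset_iff)
  qed
  have PU: "P x" if x: "x \<in> ?U" for x
  proof -
    have "antipode_free neg (S \<union> {x})"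
      using x UV by (intro antipode_free_Un[OF R'(1) S(2)] antipode_free_single) auto
    moreover have "card (S \<union> {x}) \<le> e"
      using card_Un_le[of S "{x}"] S(3) by simp
    ultimately obtain v where v: "v \<in> common_nbrs V R (S \<union> {x})"
      using dominated[of "S \<union> {x}"] S(1) x UV by blast
    then have "v \<in> ?N" "R v x" by (auto simp: common_nbrs_def)
    then show ?thesis using step[of v x] PN[of v] NU R'(2) x by (auto simp: le_fun_def subset_iff)
  qed
  have "\<forall>x\<in>?U. \<exists>w. chain_in 2 (cliques R' ?U) w \<and> bd V w = (\<lambda>\<sigma>. ?d x \<sigma> + ?d y0 \<sigma>)"
    using PU unfolding P_def bounds_def numeral_2_eq_2 One_nat_def by blast
  from bchoice[OF this] obtain w where w: "\<And>x. x \<in> ?U \<Longrightarrow> chain_in 2 (cliques R' ?U) (w x)"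
      "\<And>x. x \<in> ?U \<Longrightarrow> bd V (w x) = (\<lambda>\<sigma>. ?d x \<sigma> + ?d y0 \<sigma>)"
    by blast
  \<comment> \<open>The chains connecting the vertices of \<open>z\<close> to \<open>y0\<close> add
    up to a filling of \<open>z\<close> up to a multiple of \<open>{y0}\<close>.\<close>
  define W where "W \<sigma> = (\<Sum>x\<in>?U. z {x} * w x \<sigma>)" for \<sigma>
  have finU: "finite ?U" using UV fin finite_subset by blast
  have z1: "\<exists>x\<in>?U. \<sigma> = {x}" if "z \<sigma> = 1" for \<sigma>
    using chain_inD[OF z(1) that] by (auto simp: cliques_def card_1_singleton_iff)
  have "chain_in 2 (cliques R' ?U) W"
  proof (rule chain_inI)
    fix \<sigma> assume "W \<sigma> = 1"
    then obtain x where "x \<in> ?U" "z {x} * w x \<sigma> \<noteq> 0"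
      unfolding W_def by (metis (no_types, lifting) sum.not_neutral_contains_not_neutral zero_neq_one)
    then show "\<sigma> \<in> cliques R' ?U \<and> finite \<sigma> \<and> card \<sigma> = 2"
      using w(1)[of x] unfolding chain_in_def by auto
  qed
  moreover have "bd V W = z"
  proof
    fix \<tau>
    have "bd V W \<tau> = (\<Sum>x\<in>?U. z {x} * bd V (w x) \<tau>)"
      unfolding bd_def W_def by (subst sum.swap) (simp add: sum_distrib_left)
    also have "\<dots> = (\<Sum>x\<in>?U. z {x} * (?d x \<tau> + ?d y0 \<tau>))"
      by (intro sum.cong refl) (simp add: w(2))
    also have "\<dots> = (\<Sum>x\<in>?U. z {x} * ?d x \<tau>) + (\<Sum>x\<in>?U. z {x}) * ?d y0 \<tau>"
      by (simp add: distrib_left sum.distrib sum_distrib_right)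
    \<comment> \<open>That multiple is the augmentation of \<open>z\<close>, which vanishes because
      \<open>z\<close> is also a cycle at the empty face.\<close>
    also have "(\<Sum>x\<in>?U. z {x}) = bd V z {}"
      unfolding bd_def
    proof (intro sum.mono_neutral_left ballI)
      fix i assume "i \<in> V - {} - ?U"
      then have "\<not> (\<exists>x\<in>?U. {i} = {x})" by simp
      then show "z {i} = 0" using z1[of "{i}"] by (cases "z {i}") auto
    qed (use UV fin in auto)
    also have "(\<Sum>x\<in>?U. z {x} * ?d x \<tau>) = z \<tau>"
    proof (cases "z \<tau> = 0")
      case True
      then show ?thesis by (intro trans[OF sum.neutral]) auto
    next
      case False
      then obtain x where x: "x \<in> ?U" "\<tau> = {x}" using z1 by auto
      have "(\<Sum>y\<in>?U. z {y} * ?d y \<tau>) = (\<Sum>y\<in>?U. if y = x then z {x} else 0)"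
        using x by (intro sum.cong) auto
      then show ?thesis using x finU by simp
    qed
    finally show "bd V W \<tau> = z \<tau>" using z(2) by simp
  qed
  ultimately show ?thesis unfolding bounds_def by (auto simp: numeral_2_eq_2)
qed


text \<open>The non-adjacent pairs \<open>x, y\<close> are turned into edges one at a time. A filling \<open>w\<close> in the
  larger graph uses the new edge on \<open>[x, y] * u\<close> with \<open>u\<close> a cycle in the common neighbourhood; if
  \<open>t\<close> fills \<open>u\<close> there, then \<open>x * t + y * t\<close> replaces that part.\<close>

lemma bounds_common_nbrs:
  "antipodal_graph V neg R' \<Longrightarrow> R \<le> R' \<Longrightarrow> S \<subseteq> V \<Longrightarrow> antipode_free neg S \<Longrightarrow>
    card S + 2 * k < e \<Longrightarrow> chain_in (Suc k) (cliques R' (common_nbrs V R' S)) z \<Longrightarrow>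
    bd V z = (\<lambda>_. 0) \<Longrightarrow> bounds V (Suc k) (cliques R' (common_nbrs V R' S)) z"
proof (induction k arbitrary: R' S z)
  case 0
  then show ?case using bounds_0[of R' S z] by simp
next
  case (Suc k)
  note IH = Suc.IH
  show ?case using Suc.prems
  \<comment> \<open>Inner induction over the non-adjacent pairs: inserting an edge leaves fewer of
    them, and it ends when all non-antipodal pairs in the common neighbourhood are adjacent.\<close>
  proof (induction "card {p \<in> V \<times> V. \<not> R' (fst p) (snd p)}" arbitrary: R' rule: less_induct)
    case less
    note R' = less.prems(1,2) and S = less.prems(3-5) and z = less.prems(6,7)
    let ?U = "common_nbrs V R' S"
    have UV: "?U \<subseteq> V" by (auto simp: common_nbrs_def)
    have sym: "R' a b \<Longrightarrow> R' b a" for a b using R'(1) by (auto simp: antipodal_graph_def)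
    show ?case
    proof (cases "\<forall>x\<in>?U. \<forall>y\<in>?U. x \<noteq> y \<longrightarrow> y \<noteq> neg x \<longrightarrow> R' x y")
      case True
      \<comment> \<open>\<open>2 * k + 3\<close> is what \<open>card S + 2 * Suc k < e\<close>
        leaves for domination, and it exceeds the grade \<open>Suc (Suc k)\<close> of
        \<open>z\<close>.\<close>
      obtain T where T: "T \<subseteq> common_nbrs V R S" "card T = 2 * k + 3" "antipode_free neg T"
        using common_nbrs_antipode_free_subset[OF S(1,2), of "2 * k + 3"] S(3) by auto
      show ?thesis
      proof (rule bounds_cross_polytope[OF fin neg_neg neg_ne _ UV _ _ _ _ z])
        show "\<not> R' x (neg x)" for x using R'(1) by (auto simp: antipodal_graph_def)
        show "T \<subseteq> ?U" using T(1) R'(2) by (auto simp: common_nbrs_def)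
        show "neg x \<notin> T" if "x \<in> T" for x using that T(3) by (auto simp: antipode_free_def)
      qed (use True T in auto)
    next
      case False
      then obtain x y where xy: "x \<in> ?U" "y \<in> ?U" "x \<noteq> y" "y \<noteq> neg x" "\<not> R' x y" by blast
      have xyV: "x \<in> V" "y \<in> V" using xy UV by auto
      have nyx: "x \<noteq> neg y" using xy(4) neg_neg by metis
      define R2 where "R2 a b \<longleftrightarrow> R' a b \<or> a = x \<and> b = y \<or> a = y \<and> b = x" for a b
      have g2: "antipodal_graph V neg R2"
        using R'(1) xy xyV nyx unfolding antipodal_graph_def R2_def by metis
      have "R \<le> R2" using R'(2) by (auto simp: R2_def le_fun_def)
      \<comment> \<open>Membership in the common neighbourhood of \<open>S\<close> tests only pairs
        with a member of \<open>S\<close>, so the new edge does not change it.\<close>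
      have notS: "x \<notin> S" "y \<notin> S" using xy R'(1) by (auto simp: common_nbrs_def antipodal_graph_def)
      then have U2: "common_nbrs V R2 S = ?U" by (auto simp: common_nbrs_def R2_def)
      have cl: "cliques R' ?U \<subseteq> cliques R2 ?U" by (auto simp: cliques_def R2_def)
      have card: "card {p \<in> V \<times> V. \<not> R2 (fst p) (snd p)} < card {p \<in> V \<times> V. \<not> R' (fst p) (snd p)}"
      proof (rule psubset_card_mono)
        have "(x, y) \<in> {p \<in> V \<times> V. \<not> R' (fst p) (snd p)} - {p \<in> V \<times> V. \<not> R2 (fst p) (snd p)}"
          using xyV xy(5) by (simp add: R2_def)
        moreover have "{p \<in> V \<times> V. \<not> R2 (fst p) (snd p)} \<subseteq> {p \<in> V \<times> V. \<not> R' (fst p) (snd p)}"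
          unfolding R2_def by blast
        ultimately show "{p \<in> V \<times> V. \<not> R2 (fst p) (snd p)} \<subset> {p \<in> V \<times> V. \<not> R' (fst p) (snd p)}"
          by blast
      qed (use fin in auto)
      have "bounds V (Suc (Suc k)) (cliques R2 (common_nbrs V R2 S)) z"
        by (rule less.hyps[OF card g2 \<open>R \<le> R2\<close> S _ z(2)])
          (use chain_in_mono[OF z(1) cl] in \<open>simp add: U2\<close>)
      then obtain w where w: "chain_in (Suc (Suc (Suc k))) (cliques R2 ?U) w" "bd V w = z"
        unfolding U2 bounds_def by blast
      define u where "u \<tau> = (if x \<in> \<tau> \<or> y \<in> \<tau> then 0 else w (insert x (insert y \<tau>)))" for \<tau>
      \<comment> \<open>Passing to the link of the edge raises \<open>card S\<close> by two and
        lowers the dimension by one; hence the factor 2 in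
        \<open>card S + 2 * k < e\<close>.\<close>
      let ?S' = "S \<union> {x, y}"
      let ?U' = "common_nbrs V R' ?S'"
      have u: "chain_in (Suc k) (cliques R' ?U') u"
      proof (rule chain_inI)
        fix \<tau> assume "u \<tau> = 1"
        then have \<tau>: "x \<notin> \<tau>" "y \<notin> \<tau>" "w (insert x (insert y \<tau>)) = 1"
          by (auto simp: u_def split: if_splits)
        note * = chain_inD[OF w(1) \<tau>(3)]
        have sub: "\<tau> \<subseteq> ?U" and pair: "\<And>a b. a \<in> insert x (insert y \<tau>) \<Longrightarrow> b \<in> insert x (insert y \<tau>) \<Longrightarrow> a \<noteq> b \<Longrightarrow> R2 a b"
          using *(1) unfolding cliques_def by auto
        have "R' a b" if "a \<in> \<tau>" "b \<in> insert x (insert y \<tau>)" "a \<noteq> b" for a b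
          using pair[of a b] that \<tau> by (auto simp: R2_def)
        then have "\<tau> \<subseteq> ?U'" "\<tau> \<in> cliques R' ?U'"
          using sub \<tau>(1,2) unfolding cliques_def common_nbrs_def by blast+
        then show "\<tau> \<in> cliques R' ?U' \<and> finite \<tau> \<and> card \<tau> = Suc k"
          using * \<tau> xy(3) by simp
      qed
      \<comment> \<open>\<open>z\<close> vanishes on simplices containing both \<open>x\<close> and
        \<open>y\<close>, which are not \<open>R'\<close>-adjacent; so the link of the edge in
        \<open>w\<close> is a cycle.\<close>
      have u0: "bd V u = (\<lambda>_. 0)"
      proof
        fix \<tau>
        show "bd V u \<tau> = 0"
        proof (cases "x \<in> \<tau> \<or> y \<in> \<tau>")
          case True
          then show ?thesis by (auto simp: bd_def u_def)
        next
          case False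
          have "insert x (insert y \<tau>) \<notin> cliques R' ?U" using xy by (auto simp: cliques_def)
          then have "0 = bd V w (insert x (insert y \<tau>))"
            unfolding w(2) using chain_in_eq_0[OF z(1)] by simp
          also have "\<dots> = (\<Sum>v\<in>V - \<tau> - {x, y}. u (insert v \<tau>))"
            unfolding bd_def using False by (intro sum.cong) (auto simp: u_def insert_commute)
          also have "\<dots> = bd V u \<tau>"
            unfolding bd_def using fin by (intro sum.mono_neutral_left) (auto simp: u_def)
          finally show ?thesis by simp
        qed
      qed
      have "bounds V (Suc k) (cliques R' ?U') u"
      proof (rule IH[OF R' _ _ _ u u0])
        show "?S' \<subseteq> V" using S(1) xyV by simp
        show "antipode_free neg ?S'"
          by (rule antipode_free_Un[OF R'(1) S(2)]) (use xy nyx xyV neg_ne in \<open>auto simp: antipode_free_def\<close>)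
        show "card ?S' + 2 * k < e"
          using card_Un_le[of S "{x, y}"] S(3) xy(3) by simp
      qed
      then obtain t where t: "chain_in (Suc (Suc k)) (cliques R' ?U') t" "bd V t = u"
        unfolding bounds_def by blast
      have notU': "x \<notin> ?U'" "y \<notin> ?U'" using R'(1) by (auto simp: common_nbrs_def antipodal_graph_def)
      have t0: "t \<sigma> = 0" if "x \<in> \<sigma> \<or> y \<in> \<sigma>" for \<sigma>
        using that notU' by (intro chain_in_eq_0[OF t(1)]) (auto simp: cliques_def)
      define w' where "w' \<sigma> = (if x \<in> \<sigma> \<and> y \<in> \<sigma> then 0 else w \<sigma>)" for \<sigma>
      have w_split: "w \<sigma> = w' \<sigma> + cone_chain x (cone_chain y u) \<sigma>" for \<sigma>
        using xy(3) by (auto simp: w'_def cone_chain_def u_def insert_absorb)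
      have uy: "cone_chain y u \<sigma> = 0" if "x \<in> \<sigma>" for \<sigma> using that xy(3) by (auto simp: cone_chain_def u_def)
      have "bd V (cone_chain y u) = (\<lambda>\<tau>. u \<tau> + cone_chain y (bd V u) \<tau>)"
        by (intro bd_cone fin xyV) (simp add: u_def)
      then have bdy: "bd V (cone_chain y u) = u" by (simp add: u0 cone_chain_def)
      have "bd V (cone_chain x (cone_chain y u)) = (\<lambda>\<tau>. cone_chain y u \<tau> + cone_chain x (bd V (cone_chain y u)) \<tau>)"
        by (intro bd_cone fin xyV uy)
      then have bdxy: "bd V (cone_chain x (cone_chain y u)) = (\<lambda>\<tau>. cone_chain y u \<tau> + cone_chain x u \<tau>)" by (simp add: bdy)
      have "bd V w = (\<lambda>\<sigma>. bd V w' \<sigma> + bd V (cone_chain x (cone_chain y u)) \<sigma>)"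
        unfolding bd_add[symmetric] w_split[symmetric] by simp
      then have z_eq: "z \<sigma> = bd V w' \<sigma> + (cone_chain y u \<sigma> + cone_chain x u \<sigma>)" for \<sigma>
        by (simp add: w(2) bdxy fun_eq_iff)
      have bdt: "bd V (cone_chain x t) = (\<lambda>\<tau>. t \<tau> + cone_chain x u \<tau>)" "bd V (cone_chain y t) = (\<lambda>\<tau>. t \<tau> + cone_chain y u \<tau>)"
        unfolding t(2)[symmetric] using t0 by (intro bd_cone fin xyV; simp)+
      have "bd V (\<lambda>\<sigma>. w' \<sigma> + (cone_chain x t \<sigma> + cone_chain y t \<sigma>)) = z"
      proof
        fix \<sigma>
        have "bd V (\<lambda>\<sigma>. w' \<sigma> + (cone_chain x t \<sigma> + cone_chain y t \<sigma>)) \<sigma>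
            = bd V w' \<sigma> + ((t \<sigma> + cone_chain x u \<sigma>) + (t \<sigma> + cone_chain y u \<sigma>))"
          by (simp add: bd_add bdt)
        also have "\<dots> = z \<sigma>" unfolding z_eq by (simp add: ac_simps)
        finally show "bd V (\<lambda>\<sigma>. w' \<sigma> + (cone_chain x t \<sigma> + cone_chain y t \<sigma>)) \<sigma> = z \<sigma>" .
      qed
      moreover have "chain_in (Suc (Suc (Suc k))) (cliques R' ?U) (\<lambda>\<sigma>. w' \<sigma> + (cone_chain x t \<sigma> + cone_chain y t \<sigma>))"
      proof (intro chain_in_add)
        show "chain_in (Suc (Suc (Suc k))) (cliques R' ?U) w'"
        proof (rule chain_inI)
          fix \<sigma> assume "w' \<sigma> = 1"
          then have \<sigma>: "w \<sigma> = 1" "\<not> (x \<in> \<sigma> \<and> y \<in> \<sigma>)" by (auto simp: w'_def split: if_splits)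
          note * = chain_inD[OF w(1) \<sigma>(1)]
          have "\<sigma> \<in> cliques R' ?U" using *(1) \<sigma>(2) by (auto simp: cliques_def R2_def)
          then show "\<sigma> \<in> cliques R' ?U \<and> finite \<sigma> \<and> card \<sigma> = Suc (Suc (Suc k))" using * by simp
        qed
        have "?U' \<subseteq> ?U" by (auto simp: common_nbrs_def)
        moreover have "R' x v \<and> R' v x" "R' y v \<and> R' v y" if "v \<in> ?U'" for v
          using that sym by (auto simp: common_nbrs_def)
        ultimately show "chain_in (Suc (Suc (Suc k))) (cliques R' ?U) (cone_chain x t)"
          "chain_in (Suc (Suc (Suc k))) (cliques R' ?U) (cone_chain y t)"
          using chain_in_cone[OF t(1)] xy notU' by blast+
      qed
      ultimately show ?thesis unfolding bounds_def by blast
    qed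
  qed
qed

text \<open>Modulo two, \<open>c k\<close> plus its antipode is a cycle as soon as the boundary of
  \<open>c k\<close> is invariant under \<open>neg\<close>. It bounds by
  \<open>bounds_common_nbrs\<close> with \<open>S = {}\<close>, where \<open>2 * k < e\<close> holds
  up to \<open>k = d\<close>; the boundary of the filling is again invariant.\<close>

lemma antipodal_chains_exist:
  assumes e: "2 * d < e" and v: "v \<in> V" and negV: "\<And>x. x \<in> V \<Longrightarrow> neg x \<in> V"
    and neg_R: "\<And>x y. R x y \<Longrightarrow> R (neg x) (neg y)"
  shows "\<exists>c. c 0 = (\<lambda>\<sigma>. of_bool (\<sigma> = {v})) \<and>
    (\<forall>k\<le>Suc d. chain_in (Suc k) (cliques R V) (c k)) \<and>
    (\<forall>k\<le>d. bd V (c (Suc k)) = (\<lambda>\<sigma>. c k \<sigma> + c k (neg ` \<sigma>)))"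
proof -
  have negI: "neg ` neg ` \<sigma> = \<sigma>" for \<sigma> by (simp add: image_image neg_neg)
  have inj: "inj neg" using neg_neg by (metis injI)
  have bd_neg: "bd V (\<lambda>\<sigma>. c (neg ` \<sigma>)) \<tau> = bd V c (neg ` \<tau>)" for c \<tau>
    unfolding bd_def
  proof (rule sum.reindex_bij_witness[of _ neg neg])
    fix a assume "a \<in> V - \<tau>"
    then show "neg a \<in> V - neg ` \<tau>" using negV neg_neg by (metis Diff_iff imageE)
  next
    fix b assume "b \<in> V - neg ` \<tau>"
    then show "neg b \<in> V - \<tau>" using negV neg_neg by (metis Diff_iff imageI)
  qed (auto simp: neg_neg)
  have cl_neg: "neg ` \<sigma> \<in> cliques R V" if "\<sigma> \<in> cliques R V" for \<sigma>
    using that negV neg_R unfolding cliques_def by fastforce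
  have ch_neg: "chain_in n (cliques R V) (\<lambda>\<sigma>. c (neg ` \<sigma>))" if c: "chain_in n (cliques R V) c" for n c
  proof (rule chain_inI)
    fix \<sigma> assume "c (neg ` \<sigma>) = 1"
    note * = chain_inD[OF c this]
    have "neg ` neg ` \<sigma> \<in> cliques R V" "finite (neg ` neg ` \<sigma>)" "card (neg ` neg ` \<sigma>) = n"
      using * cl_neg inj by (simp, simp, metis card_image inj_on_subset subset_UNIV)
    then show "\<sigma> \<in> cliques R V \<and> finite \<sigma> \<and> card \<sigma> = n" unfolding negI by simp
  qed
  define Q where "Q k c \<longleftrightarrow> chain_in (Suc k) (cliques R V) c \<and>
      bd V (\<lambda>\<sigma>. c \<sigma> + c (neg ` \<sigma>)) = (\<lambda>_. 0)" for k c
  have step: "\<exists>c'. Q (Suc k) c' \<and> bd V c' = (\<lambda>\<sigma>. c \<sigma> + c (neg ` \<sigma>))" if "k \<le> d" "Q k c" for k c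
  proof -
    have NV: "common_nbrs V R {} = V" by (simp add: common_nbrs_def)
    have "bounds V (Suc k) (cliques R (common_nbrs V R {})) (\<lambda>\<sigma>. c \<sigma> + c (neg ` \<sigma>))"
      using that e ch_neg unfolding Q_def
      by (intro bounds_common_nbrs graph) (auto simp: antipode_free_def NV intro!: chain_in_add)
    then obtain c' where c': "chain_in (Suc (Suc k)) (cliques R V) c'" "bd V c' = (\<lambda>\<sigma>. c \<sigma> + c (neg ` \<sigma>))"
      unfolding NV bounds_def by blast
    have "bd V (\<lambda>\<sigma>. c' \<sigma> + c' (neg ` \<sigma>)) = (\<lambda>_. 0)"
      unfolding bd_add bd_neg c'(2) by (simp add: negI ac_simps)
    then show ?thesis using c' unfolding Q_def by blast
  qed
  have Q0: "Q 0 (\<lambda>\<sigma>. of_bool (\<sigma> = {v}))"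
  proof -
    have "chain_in 1 (cliques R V) (\<lambda>\<sigma>. of_bool (\<sigma> = {v}))"
      by (rule chain_inI) (use v in \<open>auto simp: cliques_def\<close>)
    moreover have "bd V (\<lambda>\<sigma>. of_bool (\<sigma> = {v})) = (\<lambda>\<tau>. of_bool (\<tau> = {}))" if "v \<in> V" for v
    proof
      fix \<tau>
      have "insert u \<tau> = {v} \<longleftrightarrow> \<tau> = {} \<and> u = v" if "u \<in> V - \<tau>" for u using that by auto
      then have "bd V (\<lambda>\<sigma>. of_bool (\<sigma> = {v})) \<tau> = (\<Sum>u\<in>V - \<tau>. if u = v then of_bool (\<tau> = {}) else 0)"
        unfolding bd_def by (intro sum.cong) auto
      also have "\<dots> = of_bool (\<tau> = {})" using fin that by (subst sum.delta) (auto split: if_splits)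
      finally show "bd V (\<lambda>\<sigma>. of_bool (\<sigma> = {v})) \<tau> = of_bool (\<tau> = {})" .
    qed
    then have "bd V (\<lambda>\<sigma>. of_bool (\<sigma> = {v}) + of_bool (neg ` \<sigma> = {v})) = (\<lambda>_. 0)"
      unfolding bd_add using bd_neg[of "\<lambda>\<sigma>. of_bool (\<sigma> = {v})"] v by simp
    ultimately show ?thesis unfolding Q_def by simp
  qed
  \<comment> \<open>\<open>dependent_nat_choice\<close> chooses at every \<open>k\<close>, so the
    conditions are guarded and become void above the range.\<close>
  let ?P = "\<lambda>k c. (k \<le> Suc d \<longrightarrow> Q k c) \<and> (k = 0 \<longrightarrow> c = (\<lambda>\<sigma>. of_bool (\<sigma> = {v})))"
  let ?D = "\<lambda>k c c'. k \<le> d \<longrightarrow> bd V c' = (\<lambda>\<sigma>. c \<sigma> + c (neg ` \<sigma>))"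
  have "\<exists>c'. ?P (Suc k) c' \<and> ?D k c c'" if "?P k c" for k c
  proof (cases "k \<le> d")
    case True
    then show ?thesis using step[of k c] that by auto
  qed auto
  then obtain c where "\<And>k. ?P k (c k)" "\<And>k. ?D k (c k) (c (Suc k))"
    using dependent_nat_choice[of ?P ?D] Q0 by blast
  then show ?thesis unfolding Q_def by auto
qed

text \<open>The pairing of \<open>\<Phi> k\<close> with \<open>c k\<close> plus its antipode does
  not depend on \<open>k\<close>: this chain is the boundary of \<open>c (Suc k)\<close>,
  transposing the boundary gives the coboundary of \<open>\<Phi> k\<close>, and \<open>neg\<close>
  can be moved from one factor to the other. The value is 1 for \<open>k = 0\<close> and 0 for
  \<open>k = Suc d\<close>.\<close>

lemma no_antipodal_cochains:
  assumes e: "2 * d < e" and negV: "\<And>x. x \<in> V \<Longrightarrow> neg x \<in> V" and v: "v \<in> V"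
    and neg_R: "\<And>x y. R x y \<Longrightarrow> R (neg x) (neg y)"
    and cob: "\<And>k \<sigma>. k \<le> d \<Longrightarrow> \<sigma> \<in> cliques R V \<Longrightarrow> card \<sigma> = k + 2 \<Longrightarrow>
      (\<Sum>x\<in>\<sigma>. \<Phi> k (\<sigma> - {x})) = \<Phi> (Suc k) \<sigma> + \<Phi> (Suc k) (neg ` \<sigma>)"
    and init: "\<And>x. x \<in> V \<Longrightarrow> \<Phi> 0 {x} + \<Phi> 0 {neg x} = (1::bit)"
    and top: "\<And>\<sigma>. \<sigma> \<in> cliques R V \<Longrightarrow> card \<sigma> = d + 2 \<Longrightarrow> \<Phi> (Suc d) \<sigma> = 0"
  shows False
proof -
  obtain c where c0: "c 0 = (\<lambda>\<sigma>. of_bool (\<sigma> = {v}))"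
    and ch: "\<And>k. k \<le> Suc d \<Longrightarrow> chain_in (Suc k) (cliques R V) (c k)"
    and bdc: "\<And>k. k \<le> d \<Longrightarrow> bd V (c (Suc k)) = (\<lambda>\<sigma>. c k \<sigma> + c k (neg ` \<sigma>))"
    using antipodal_chains_exist[OF e v negV neg_R] by metis
  define pair where "pair k = (\<Sum>\<sigma>\<in>Pow V. \<Phi> k \<sigma> * (c k \<sigma> + c k (neg ` \<sigma>)))" for k
  have negI: "neg ` neg ` \<sigma> = \<sigma>" for \<sigma> by (simp add: image_image neg_neg)
  have pair_eq: "pair k = (\<Sum>\<sigma>\<in>Pow V. c k \<sigma> * (\<Phi> k \<sigma> + \<Phi> k (neg ` \<sigma>)))" for k
  proof -
    have "(\<Sum>\<sigma>\<in>Pow V. \<Phi> k \<sigma> * c k (neg ` \<sigma>)) = (\<Sum>\<sigma>\<in>Pow V. \<Phi> k (neg ` \<sigma>) * c k \<sigma>)"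
      by (rule sum.reindex_bij_witness[of _ "(`) neg" "(`) neg"]) (auto simp: negI negV)
    then show ?thesis by (simp add: pair_def sum.distrib algebra_simps)
  qed
  have finP: "finite (Pow V)" using fin by simp
  have "pair k = 1" if "k \<le> Suc d" for k
    using that
  proof (induction k)
    case 0
    have "pair 0 = (\<Sum>\<sigma>\<in>Pow V. if \<sigma> = {v} then \<Phi> 0 {v} + \<Phi> 0 {neg v} else 0)"
      unfolding pair_eq c0 by (intro sum.cong) auto
    also have "\<dots> = 1" using v finP init[OF v] by simp
    finally show ?case .
  next
    case (Suc k)
    have "pair (Suc k) = (\<Sum>\<sigma>\<in>Pow V. \<Sum>x\<in>\<sigma>. c (Suc k) \<sigma> * \<Phi> k (\<sigma> - {x}))"
      unfolding pair_eq
    proof (intro sum.cong refl)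
      fix \<sigma>
      show "c (Suc k) \<sigma> * (\<Phi> (Suc k) \<sigma> + \<Phi> (Suc k) (neg ` \<sigma>)) = (\<Sum>x\<in>\<sigma>. c (Suc k) \<sigma> * \<Phi> k (\<sigma> - {x}))"
      proof (cases "c (Suc k) \<sigma> = 1")
        case True
        from chain_inD[OF ch[OF Suc.prems] this] cob[of k \<sigma>] Suc.prems True show ?thesis by simp
      next
        case False
        then have "c (Suc k) \<sigma> = 0" by simp
        then show ?thesis by simp
      qed
    qed
    \<comment> \<open>Here the boundary is transposed: pairs \<open>(\<sigma>, x)\<close> with
      \<open>x \<in> \<sigma>\<close> become pairs \<open>(\<tau>, x)\<close> with
      \<open>x \<notin> \<tau>\<close>.\<close>
    also have "\<dots> = (\<Sum>p\<in>(SIGMA \<sigma>:Pow V. \<sigma>). c (Suc k) (fst p) * \<Phi> k (fst p - {snd p}))"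
      by (subst sum.Sigma) (use fin finite_subset in \<open>auto simp: case_prod_beta\<close>)
    also have "\<dots> = (\<Sum>p\<in>(SIGMA \<tau>:Pow V. V - \<tau>). c (Suc k) (insert (snd p) (fst p)) * \<Phi> k (fst p))"
      by (rule sum.reindex_bij_witness[of _ "\<lambda>p. (insert (snd p) (fst p), snd p)" "\<lambda>p. (fst p - {snd p}, snd p)"])
        (auto simp: insert_absorb)
    also have "\<dots> = (\<Sum>\<tau>\<in>Pow V. \<Sum>x\<in>V - \<tau>. c (Suc k) (insert x \<tau>) * \<Phi> k \<tau>)"
      by (subst sum.Sigma) (use fin in \<open>auto simp: case_prod_beta\<close>)
    also have "\<dots> = (\<Sum>\<tau>\<in>Pow V. \<Phi> k \<tau> * bd V (c (Suc k)) \<tau>)"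
      unfolding bd_def by (simp add: sum_distrib_left mult.commute)
    also have "\<dots> = pair k" using bdc[of k] Suc.prems by (simp add: pair_def)
    finally show ?case using Suc by simp
  qed
  then have "pair (Suc d) = 1" by simp
  moreover have "pair (Suc d) = 0"
    unfolding pair_eq
  proof (intro sum.neutral ballI)
    fix \<sigma>
    show "c (Suc d) \<sigma> * (\<Phi> (Suc d) \<sigma> + \<Phi> (Suc d) (neg ` \<sigma>)) = 0"
    proof (cases "c (Suc d) \<sigma> = 1")
      case True
      note * = chain_inD[OF ch[of "Suc d"] True]
      have cl: "neg ` \<sigma> \<in> cliques R V"
        using *(1) negV neg_R unfolding cliques_def by fastforce
      have "card (neg ` \<sigma>) = card \<sigma>" using neg_neg by (intro card_image inj_onI) metis
      then show ?thesis using top[of \<sigma>] top[OF cl] * by simp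
    next
      case False
      then have "c (Suc d) \<sigma> = 0" by simp
      then show ?thesis by simp
    qed
  qed
  ultimately show False by simp
qed

end

section \<open>Counting alternating label sequences\<close>

definition del_nth :: "nat \<Rightarrow> 'a list \<Rightarrow> 'a list" where
  "del_nth k xs = take k xs @ drop (Suc k) xs"

lemma del_simps [simp]:
  "del_nth 0 (x # xs) = xs" "del_nth (Suc k) (x # xs) = x # del_nth k xs"
  by (simp_all add: del_nth_def)

lemma map_del: "map f (del_nth k xs) = del_nth k (map f xs)"
  by (simp add: del_nth_def take_map drop_map)

lemma length_del: "k < length xs \<Longrightarrow> length (del_nth k xs) = length xs - 1"
  by (simp add: del_nth_def)

lemma nth_del: "k < length xs \<Longrightarrow> j < length xs - 1 \<Longrightarrow> del_nth k xs ! j = xs ! (if j < k then j else Suc j)"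
  by (auto simp: del_nth_def nth_append min_def)

lemma remove1_nth_eq_del:
  "distinct xs \<Longrightarrow> k < length xs \<Longrightarrow> remove1 (xs ! k) xs = del_nth k xs"
proof (induction xs arbitrary: k)
  case (Cons x xs) then show ?case by (cases k) auto
qed simp

lemma set_del: "distinct xs \<Longrightarrow> k < length xs \<Longrightarrow> set (del_nth k xs) = set xs - {xs ! k}"
  by (simp flip: remove1_nth_eq_del add: set_remove1_eq)

abbreviation alternates :: "bool list \<Rightarrow> bool" where
  "alternates \<equiv> successively (\<noteq>)"

text \<open>The successful deletions come in pairs: the two ends if \<open>xs\<close> alternates,
  the two members if exactly one adjacent pair agrees, none otherwise. The induction peels off
  leading entries instead of making this distinction.\<close>

lemma sum_alternates_del:
  "2 \<le> length xs \<Longrightarrow> (\<Sum>k<length xs. of_bool (alternates (del_nth k xs)) :: bit) = 0"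
proof (induction xs)
  case (Cons x xs)
  obtain y zs where xs: "xs = y # zs" using Cons.prems by (cases xs) auto
  let ?S = "\<lambda>ws. (\<Sum>k<length zs. of_bool (alternates (ws @ del_nth k zs)) :: bit)"
  \<comment> \<open>Deletions beyond the second entry keep the prefix \<open>x, y\<close>, so the
    condition splits into \<open>x \<noteq> y\<close> and a condition free of
    \<open>x\<close>.\<close>
  have split: "?S [x, y] = of_bool (x \<noteq> y) * ?S [y]"
    by (subst sum_distrib_left) (intro sum.cong; simp)
  have total: "(\<Sum>k<length (x # xs). of_bool (alternates (del_nth k (x # xs))) :: bit)
      = of_bool (alternates (y # zs)) + (of_bool (alternates (x # zs)) + ?S [x, y])"
    by (simp add: xs sum.lessThan_Suc_shift del: sum.lessThan_Suc sum_of_bool_eq)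
  show ?case
  proof (cases zs)
    case Nil
    then show ?thesis using total by simp
  next
    case (Cons z ws)
    then have "(\<Sum>k<length xs. of_bool (alternates (del_nth k xs)) :: bit) = 0"
      using Cons.IH xs by auto
    then have "of_bool (alternates zs) + ?S [y] = 0"
      by (simp add: xs sum.lessThan_Suc_shift del: sum.lessThan_Suc sum_of_bool_eq)
    then have "?S [y] = of_bool (alternates zs)"
      by (simp add: bit_add_eq_0)
    then have *: "?S [x, y] = of_bool (x \<noteq> y) * of_bool (alternates zs)" using split by metis
    show ?thesis unfolding total *
      by (cases x; cases y; cases z) (auto simp: Cons of_bool_def)
  qed
qed simp

text \<open>If \<open>xs\<close> alternates, exactly one of the two end deletions starts with
  \<open>True\<close>; if a single adjacent pair agrees, its two deletions give the same list and
  cancel.\<close>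

lemma sum_alternates_del_positive:
  "2 \<le> length xs \<Longrightarrow>
    (\<Sum>k<length xs. of_bool (hd (del_nth k xs) \<and> alternates (del_nth k xs)) :: bit) = of_bool (alternates xs)"
proof (cases xs)
  case (Cons x ys)
  assume len: "2 \<le> length xs"
  then obtain y zs where ys: "ys = y # zs" using Cons by (cases ys) auto
  have "of_bool (alternates ys) + (\<Sum>k<length ys. of_bool (alternates (x # del_nth k ys)) :: bit) = 0"
    using sum_alternates_del[OF len] unfolding Cons
    by (simp add: sum.lessThan_Suc_shift del: sum.lessThan_Suc sum_of_bool_eq)
  then have *: "(\<Sum>k<length ys. of_bool (alternates (x # del_nth k ys)) :: bit) = of_bool (alternates ys)"
    by (simp add: bit_add_eq_0)
  have "(\<Sum>k<length xs. of_bool (hd (del_nth k xs) \<and> alternates (del_nth k xs)) :: bit)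
     = of_bool (hd ys \<and> alternates ys) + (\<Sum>k<length ys. of_bool x * of_bool (alternates (x # del_nth k ys)))"
    unfolding Cons by (simp add: sum.lessThan_Suc_shift del: sum.lessThan_Suc sum_of_bool_eq)
  also have "\<dots> = of_bool (hd ys \<and> alternates ys) + of_bool x * of_bool (alternates ys)"
    unfolding sum_distrib_left[symmetric] * by simp
  also have "\<dots> = of_bool (alternates xs)"
    by (cases x; cases y) (auto simp: Cons ys of_bool_def)
  finally show ?thesis .
qed simp

definition skip :: "nat \<Rightarrow> nat \<Rightarrow> nat" where
  "skip k i = (if i < k then i else Suc i)"

lemma skip_image: "k \<le> Suc p \<Longrightarrow> skip k ` {..p} = {..Suc p} - {k}"
proof
  show "{..Suc p} - {k} \<subseteq> skip k ` {..p}" if "k \<le> Suc p"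
  proof
    fix i assume i: "i \<in> {..Suc p} - {k}"
    show "i \<in> skip k ` {..p}"
    proof (cases "i < k")
      case True
      then show ?thesis using that i by (intro image_eqI[of _ _ i]) (auto simp: skip_def)
    next
      case False
      then show ?thesis using that i by (intro image_eqI[of _ _ "i - 1"]) (auto simp: skip_def)
    qed
  qed
qed (auto simp: skip_def)

lemma inj_skip: "inj_on (skip k) A"
  by (auto simp: inj_on_def skip_def split: if_splits)

text \<open>Fan's positively alternating simplices: \<open>J\<close> gives the index of each vertex,
  \<open>sg\<close> the sign belonging to an index, and the signs are read in the order of the
  indices, not of the vertices.\<close>

definition pos_alt :: "(nat \<Rightarrow> bool) \<Rightarrow> nat \<Rightarrow> (nat \<Rightarrow> nat) \<Rightarrow> bool" where
  "pos_alt sg p J \<longleftrightarrow> inj_on J {..p} \<and>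
     (let xs = map sg (sorted_list_of_set (J ` {..p})) in hd xs \<and> alternates xs)"

lemma alternates_map_Not: "alternates (map Not xs) = alternates xs"
  by (induction xs rule: induct_list012) auto

text \<open>For injective \<open>J\<close>, deleting a vertex deletes an entry of the sorted index
  list, and alternating lists split by their first sign. If \<open>J a = J b\<close>, only the
  facets opposite \<open>a\<close> and \<open>b\<close> can have distinct indices; these facets
  carry the same indices and cancel.\<close>

lemma pos_alt_facets:
  "(\<Sum>k\<le>Suc p. of_bool (pos_alt sg p (J \<circ> skip k)) :: bit)
    = of_bool (pos_alt sg (Suc p) J) + of_bool (pos_alt (Not \<circ> sg) (Suc p) J)"
proof (cases "inj_on J {..Suc p}")
  case True
  define xs where "xs = sorted_list_of_set (J ` {..Suc p})"
  have dist: "distinct xs" and set: "set xs = J ` {..Suc p}" by (auto simp: xs_def)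
  have len: "length xs = Suc (Suc p)" using True by (simp add: xs_def card_image)
  let ?g = "\<lambda>ys. of_bool (hd (map sg ys) \<and> alternates (map sg ys)) :: bit"
  have ne: "map sg xs \<noteq> []" using len by auto
  have facet: "of_bool (pos_alt sg p (J \<circ> skip k)) = ?g (remove1 (J k) xs)" if "k \<le> Suc p" for k
  proof -
    have "(J \<circ> skip k) ` {..p} = J ` ({..Suc p} - {k})"
      using skip_image[OF that] by (metis image_comp)
    also have "\<dots> = J ` {..Suc p} - {J k}"
      using True that by (auto simp: inj_on_def)
    finally have "sorted_list_of_set ((J \<circ> skip k) ` {..p}) = remove1 (J k) xs"
      by (simp add: xs_def sorted_list_of_set_remove)
    moreover have "inj_on (J \<circ> skip k) {..p}"
      using True skip_image[OF that] by (intro comp_inj_on inj_skip) (auto intro: inj_on_subset)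
    ultimately show ?thesis by (simp add: pos_alt_def Let_def)
  qed
  have "(\<Sum>k\<le>Suc p. of_bool (pos_alt sg p (J \<circ> skip k)) :: bit) = (\<Sum>k\<le>Suc p. ?g (remove1 (J k) xs))"
    by (intro sum.cong refl facet) simp
  also have "\<dots> = (\<Sum>m\<in>set xs. ?g (remove1 m xs))"
    unfolding set sum.reindex[OF True] by (simp add: o_def del: sum_of_bool_eq sum.atMost_Suc)
  also have "\<dots> = (\<Sum>k<length xs. ?g (remove1 (xs ! k) xs))"
    by (rule sum.reindex_bij_betw[symmetric]) (auto intro: bij_betw_nth dist)
  also have "\<dots> = (\<Sum>k<length xs. ?g (del_nth k xs))"
    by (intro sum.cong refl) (simp add: remove1_nth_eq_del dist)
  also have "\<dots> = of_bool (alternates (map sg xs))"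
    using sum_alternates_del_positive[of "map sg xs"] len by (simp add: map_del)
  also have "\<dots> = of_bool (pos_alt sg (Suc p) J) + of_bool (pos_alt (Not \<circ> sg) (Suc p) J)"
    using True ne alternates_map_Not[of "map sg xs"]
    by (auto simp: pos_alt_def Let_def xs_def[symmetric] hd_map)
  finally show ?thesis .
next
  case False
  then obtain a b where ab: "a < b" "b \<le> Suc p" "J a = J b"
    unfolding inj_on_def by (metis atMost_iff nat_neq_iff)
  have zero: "\<not> pos_alt sg p (J \<circ> skip k)" if "k \<le> Suc p" "k \<noteq> a" "k \<noteq> b" for k
  proof
    assume "pos_alt sg p (J \<circ> skip k)"
    then have "inj_on J (skip k ` {..p})" unfolding pos_alt_def by (meson inj_on_imageI)
    then show False using ab that unfolding skip_image[OF that(1)] inj_on_def by auto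
  qed
  have "(J \<circ> skip a) ` {..p} = (J \<circ> skip b) ` {..p}"
  proof -
    have "(J \<circ> skip c) ` {..p} = J ` ({..Suc p} - {c})" if "c \<le> Suc p" for c
      using skip_image[OF that] by (metis image_comp)
    moreover have "J ` ({..Suc p} - {a}) = J ` ({..Suc p} - {b})"
    proof -
      have "J ` ({..Suc p} - {c}) = J ` {..Suc p}" if "c \<le> Suc p" "c' \<le> Suc p" "c \<noteq> c'" "J c = J c'" for c c'
      proof -
        have "J ` {..Suc p} = insert (J c) (J ` ({..Suc p} - {c}))" using that by blast
        moreover have "J c \<in> J ` ({..Suc p} - {c})" using that by auto
        ultimately show ?thesis by auto
      qed
      from this[of a b] this[of b a] show ?thesis using ab by simp
    qed
    ultimately show ?thesis using ab by simp
  qed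
  moreover have "inj_on (J \<circ> skip a) {..p} \<longleftrightarrow> inj_on (J \<circ> skip b) {..p}"
    using calculation by (metis card_image eq_card_imp_inj_on finite_atMost)
  ultimately have eq: "pos_alt sg p (J \<circ> skip a) = pos_alt sg p (J \<circ> skip b)"
    by (simp add: pos_alt_def Let_def)
  have "(\<Sum>k\<le>Suc p. of_bool (pos_alt sg p (J \<circ> skip k)) :: bit)
      = (\<Sum>k\<in>{a, b}. of_bool (pos_alt sg p (J \<circ> skip k)))"
    using ab zero by (intro sum.mono_neutral_right) auto
  also have "\<dots> = 0" using ab eq by (simp del: sum_of_bool_eq)
  finally show ?thesis using False by (simp add: pos_alt_def)
qed

section \<open>Singular simplices in a geometric realization\<close>

text \<open>The singular chains of the homology library are integral; evaluation in
  \<open>bit\<close> reduces their coefficients modulo two.\<close>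

definition eval_cochain :: "('a \<Rightarrow> bit) \<Rightarrow> ('a \<Rightarrow>\<^sub>0 int) \<Rightarrow> bit" where
  "eval_cochain \<phi> c = (\<Sum>f\<in>Poly_Mapping.keys c. of_int (Poly_Mapping.lookup c f) * \<phi> f)"

lemma eval_cochain_superset:
  assumes "finite A" "Poly_Mapping.keys c \<subseteq> A"
  shows "eval_cochain \<phi> c = (\<Sum>f\<in>A. of_int (Poly_Mapping.lookup c f) * \<phi> f)"
  unfolding eval_cochain_def using assms by (intro sum.mono_neutral_left) (auto simp: in_keys_iff)

lemma eval_cochain_0 [simp]: "eval_cochain \<phi> 0 = 0"
  by (simp add: eval_cochain_def)

lemma eval_cochain_frag_of [simp]: "eval_cochain \<phi> (frag_of f) = \<phi> f"
  by (simp add: eval_cochain_def)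

lemma eval_cochain_diff: "eval_cochain \<phi> (a - b) = eval_cochain \<phi> a - eval_cochain \<phi> b"
proof -
  let ?A = "Poly_Mapping.keys a \<union> Poly_Mapping.keys b"
  have "eval_cochain \<phi> (a - b) = (\<Sum>f\<in>?A. of_int (Poly_Mapping.lookup (a - b) f) * \<phi> f)"
    using keys_diff[of a b] by (intro eval_cochain_superset) auto
  also have "\<dots> = (\<Sum>f\<in>?A. of_int (Poly_Mapping.lookup a f) * \<phi> f) - (\<Sum>f\<in>?A. of_int (Poly_Mapping.lookup b f) * \<phi> f)"
    by (simp add: lookup_minus left_diff_distrib sum_subtractf del: minus_bit_def)
  also have "\<dots> = eval_cochain \<phi> a - eval_cochain \<phi> b"
    by (simp add: eval_cochain_superset[of ?A a] eval_cochain_superset[of ?A b])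
  finally show ?thesis .
qed

text \<open>Meant for \<open>chain_boundary\<close>, whose alternating signs disappear because
  negation is trivial on bits.\<close>

lemma bit_valued_additive:
  fixes L :: "('a \<Rightarrow>\<^sub>0 int) \<Rightarrow> bit"
  assumes 0: "L 0 = 0" and diff: "\<And>a b. L (a - b) = L a - L b"
  shows "L (\<Sum>k\<le>(n::nat). frag_cmul ((-1) ^ k) (F k)) = (\<Sum>k\<le>n. L (F k))"
proof -
  have minus: "L (- a) = L a" for a using diff[of 0 a] 0 by simp
  have add: "L (a + b) = L a + L b" for a b using diff[of a "- b"] minus by simp
  have cm: "L (frag_cmul ((-1) ^ k) a) = L a" for k :: nat and a
    using minus by (cases "even k") auto
  have "L (\<Sum>k\<le>n. G k) = (\<Sum>k\<le>n. L (G k))" for G :: "nat \<Rightarrow> 'a \<Rightarrow>\<^sub>0 int"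
    by (induction n) (simp_all add: add)
  then show ?thesis by (simp only: cm)
qed

definition unit_vec :: "nat \<Rightarrow> nat \<Rightarrow> real" where
  "unit_vec i = (\<lambda>j. if j = i then 1 else 0)"

lemma unit_vec_in: "i \<le> p \<Longrightarrow> unit_vec i \<in> standard_simplex p"
  by (simp add: unit_vec_def)

lemma simplical_face_unit_vec: "simplical_face k (unit_vec i) = unit_vec (skip k i)"
  by (auto simp: simplical_face_def unit_vec_def skip_def fun_eq_iff)

lemma singular_face_unit_vec:
  "i \<le> p \<Longrightarrow> singular_face (Suc p) k h (unit_vec i) = h (unit_vec (skip k i))"
  by (simp add: singular_face_def unit_vec_in simplical_face_unit_vec)

lemma pos_alt_cong:
  assumes "\<And>i. i \<le> p \<Longrightarrow> J i = J' i" "\<And>i. i \<le> p \<Longrightarrow> sg (J i) = sg' (J i)"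
  shows "pos_alt sg p J = pos_alt sg' p J'"
proof -
  have im: "J ` {..p} = J' ` {..p}" using assms(1) by (intro image_cong) auto
  have inj: "inj_on J {..p} = inj_on J' {..p}" using assms(1) by (intro inj_on_cong) auto
  have "map sg (sorted_list_of_set (J ` {..p})) = map sg' (sorted_list_of_set (J ` {..p}))"
    using assms(2) by (intro map_cong) auto
  then show ?thesis unfolding pos_alt_def inj im by (simp only:)
qed

text \<open>The values are barycentric coordinate functions; the restriction makes the map
  extensional, as \<open>singular_simplex\<close> requires.\<close>

definition affine_simplex :: "'a list \<Rightarrow> (nat \<Rightarrow> real) \<Rightarrow> 'a \<Rightarrow> real" where
  "affine_simplex xs = (\<lambda>t\<in>standard_simplex (length xs - 1). \<lambda>v. \<Sum>j<length xs. if xs ! j = v then t j else 0)"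

lemma lin_in_geom_real:
  assumes V: "finite V" and down: "\<And>\<sigma> \<tau>. \<sigma> \<in> K \<Longrightarrow> \<tau> \<subseteq> \<sigma> \<Longrightarrow> \<tau> \<in> K"
    and xs: "set xs \<in> K" "set xs \<subseteq> V" "xs \<noteq> []" and t: "t \<in> standard_simplex (length xs - 1)"
  shows "affine_simplex xs t \<in> geom_real V K"
proof -
  have t0: "0 \<le> t i" for i using t by (auto simp: standard_simplex_def)
  have eq: "affine_simplex xs t v = (\<Sum>j<length xs. if xs ! j = v then t j else 0)" for v
    using t by (simp add: affine_simplex_def)
  have z: "affine_simplex xs t v = 0" if "v \<notin> set xs" for v
    unfolding eq using that by (intro sum.neutral) auto
  have "sum (affine_simplex xs t) V = (\<Sum>j<length xs. \<Sum>v\<in>V. if xs ! j = v then t j else 0)"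
    unfolding eq by (rule sum.swap)
  also have "\<dots> = (\<Sum>j<length xs. t j)"
    using xs V by (intro sum.cong refl) (auto simp: subset_iff)
  also have "\<dots> = (\<Sum>j\<le>length xs - 1. t j)"
    using xs(3) by (intro sum.cong) (auto simp: Suc_le_eq[symmetric] neq_Nil_conv)
  also have "\<dots> = 1" using t by (simp add: standard_simplex_def)
  finally have "sum (affine_simplex xs t) V = 1" .
  moreover have "{v. affine_simplex xs t v \<noteq> 0} \<in> K"
    by (rule down[OF xs(1)]) (use z in auto)
  moreover have "0 \<le> affine_simplex xs t v" for v unfolding eq using t0 by (intro sum_nonneg) auto
  ultimately show ?thesis using z xs(2) by (auto simp: geom_real_def)
qed

lemma singular_simplex_lin:
  assumes V: "finite V" and down: "\<And>\<sigma> \<tau>. \<sigma> \<in> K \<Longrightarrow> \<tau> \<subseteq> \<sigma> \<Longrightarrow> \<tau> \<in> K"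
    and xs: "set xs \<in> K" "set xs \<subseteq> V" "xs \<noteq> []"
  shows "singular_simplex (length xs - 1) (top_of_set (geom_real V K)) (affine_simplex xs)"
proof -
  let ?S = "standard_simplex (length xs - 1)"
  have "continuous_on ?S (\<lambda>t v. \<Sum>j<length xs. if xs ! j = v then t j else 0)"
  proof (intro continuous_on_coordinatewise_then_product continuous_on_sum)
    fix v j
    have "continuous_on ?S (\<lambda>t. t j)"
      by (rule continuous_on_subset[OF continuous_on_product_coordinates]) simp
    then show "continuous_on ?S (\<lambda>t. if xs ! j = v then t j else 0)"
      by (cases "xs ! j = v") auto
  qed
  then have "continuous_on ?S (affine_simplex xs)"
    by (rule continuous_on_eq) (simp add: affine_simplex_def)
  moreover have "affine_simplex xs ` ?S \<subseteq> geom_real V K"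
    using lin_in_geom_real[OF V down xs] by auto
  ultimately show ?thesis
    unfolding singular_simplex_def
    by (auto simp: euclidean_product_topology affine_simplex_def image_subset_iff)
qed

lemma singular_face_lin:
  assumes "length xs = Suc (Suc p)" "k \<le> Suc p"
  shows "singular_face (Suc p) k (affine_simplex xs) = affine_simplex (del_nth k xs)"
proof
  fix t
  have len: "length (del_nth k xs) = Suc p" using assms length_del[of k xs] by simp
  show "singular_face (Suc p) k (affine_simplex xs) t = affine_simplex (del_nth k xs) t"
  proof (cases "t \<in> standard_simplex p")
    case True
    have "simplical_face k t \<in> standard_simplex (Suc p)"
      using simplical_face_in_standard_simplex[of "Suc p" k t] True assms by simp
    moreover have "(\<Sum>j\<le>Suc p. if xs ! j = v then simplical_face k t j else 0)
       = (\<Sum>j\<le>p. if del_nth k xs ! j = v then t j else 0)" for v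
    proof -
      have "(\<Sum>j\<le>Suc p. if xs ! j = v then simplical_face k t j else 0)
          = (\<Sum>j\<in>{..Suc p} - {k}. if xs ! j = v then simplical_face k t j else 0)"
        by (intro sum.mono_neutral_right) (auto simp: simplical_face_def)
      also have "\<dots> = (\<Sum>j\<in>skip k ` {..p}. if xs ! j = v then simplical_face k t j else 0)"
        using skip_image[OF assms(2)] by simp
      also have "\<dots> = (\<Sum>j\<le>p. if xs ! skip k j = v then simplical_face k t (skip k j) else 0)"
        by (simp add: sum.reindex[OF inj_skip])
      also have "\<dots> = (\<Sum>j\<le>p. if del_nth k xs ! j = v then t j else 0)"
        using assms by (intro sum.cong refl) (auto simp: nth_del skip_def simplical_face_def)
      finally show ?thesis .
    qed
    ultimately show ?thesis
      using True assms len by (simp add: singular_face_def affine_simplex_def lessThan_Suc_atMost fun_eq_iff del: sum.atMost_Suc)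
  next
    case False
    then show ?thesis using len by (simp add: singular_face_def affine_simplex_def)
  qed
qed

section \<open>Signed vertices and an ordering compatible with the antipode\<close>

abbreviation antipode :: "nat \<times> int \<Rightarrow> nat \<times> int" where
  "antipode p \<equiv> (fst p, - snd p)"

lemma swap_inv_eq: "swap_inv x = x \<circ> antipode"
  by (auto simp: swap_inv_def fun_eq_iff)

lemma swap_inv_swap_inv [simp]: "swap_inv (swap_inv x) = x"
  by (auto simp: swap_inv_def fun_eq_iff)

lemma simplex_map_lin:
  assumes "xs \<noteq> []"
  shows "simplex_map (length xs - 1) swap_inv (affine_simplex xs) = affine_simplex (map antipode xs)"
proof -
  have "(xs ! j = (a, - b)) = (antipode (xs ! j) = (a, b))" for j a b
    by (cases "xs ! j") auto
  then show ?thesis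
    by (auto simp: simplex_map_def affine_simplex_def swap_inv_def fun_eq_iff restrict_def intro!: sum.cong)
qed

definition vsign :: "(nat \<times> int) set \<Rightarrow> nat \<Rightarrow> int" where
  "vsign T x = (if (x, 1) \<in> T then 1 else - 1)"

text \<open>Sorting by the unsigned vertex makes the ordering commute both with the antipode and
  with the removal of a vertex. Affine simplices can then be indexed by faces as sets, and their
  singular faces and antipodal images are again of this form.\<close>

definition listing :: "(nat \<times> int) set \<Rightarrow> (nat \<times> int) list" where
  "listing T = map (\<lambda>x. (x, vsign T x)) (sorted_list_of_set (fst ` T))"

context
  fixes T :: "(nat \<times> int) set"
  assumes fin: "finite T" and sgn: "T \<subseteq> UNIV \<times> {-1, 1}" and inj: "inj_on fst T"
begin

lemma vsign_eq: "(x, s) \<in> T \<Longrightarrow> vsign T x = s"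
  using sgn inj_onD[OF inj, of "(x, s)" "(x, 1)"] by (auto simp: vsign_def)

lemma set_listing: "set (listing T) = T"
  using fin vsign_eq by (force simp: listing_def)

lemma distinct_listing: "distinct (listing T)"
  by (auto simp: listing_def distinct_map inj_on_def)

lemma length_listing: "length (listing T) = card T"
  using card_image[OF inj] by (simp add: listing_def)

lemma listing_remove:
  assumes k: "k < card T"
  shows "listing (T - {listing T ! k}) = del_nth k (listing T)"
proof -
  let ?xs = "sorted_list_of_set (fst ` T)"
  have len: "length ?xs = card T" using card_image[OF inj] by simp
  obtain v where v: "v = listing T ! k" by simp
  have vT: "v \<in> T" using set_listing k length_listing v by (metis nth_mem)
  have fv: "fst v = ?xs ! k" using k len by (simp add: v listing_def)
  have "fst ` (T - {v}) = fst ` T - {fst v}" using inj vT by (auto simp: inj_on_def)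
  then have "sorted_list_of_set (fst ` (T - {v})) = remove1 (?xs ! k) ?xs"
    using fin by (simp add: sorted_list_of_set_remove fv)
  also have "\<dots> = del_nth k ?xs" using k len by (intro remove1_nth_eq_del) auto
  finally have *: "sorted_list_of_set (fst ` (T - {v})) = del_nth k ?xs" .
  have set: "set (del_nth k ?xs) = fst ` T - {fst v}"
    using k len fin set_del[of ?xs k] by (simp add: fv)
  have "vsign (T - {v}) x = vsign T x" if "x \<noteq> fst v" for x
  proof -
    have "(x, 1) \<noteq> v" using that by auto
    then show ?thesis by (simp add: vsign_def)
  qed
  then have "map (\<lambda>x. (x, vsign (T - {v}) x)) (del_nth k ?xs) = map (\<lambda>x. (x, vsign T x)) (del_nth k ?xs)"
    by (simp add: set)
  then have "listing (T - {v}) = del_nth k (listing T)"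
    unfolding listing_def * map_del[symmetric] .
  then show ?thesis by (simp add: v)
qed

lemma listing_antipode: "listing (antipode ` T) = map antipode (listing T)"
proof -
  have f: "fst ` antipode ` T = fst ` T" by (simp add: image_image)
  have eq: "vsign (antipode ` T) x = - vsign T x" if x: "x \<in> fst ` T" for x
  proof -
    obtain s where s: "(x, s) \<in> T" using x by force
    have iff: "(x, 1) \<in> antipode ` T \<longleftrightarrow> (x, -1) \<in> T" by (force simp: image_iff)
    have uniq: "s' = s" if "(x, s') \<in> T" for s' using inj_onD[OF inj, of "(x, s')" "(x, s)"] that s by simp
    have "s = 1 \<or> s = -1" using s sgn by auto
    then show ?thesis
    proof
      assume "s = 1"
      then show ?thesis using s uniq[of "-1"] iff by (auto simp: vsign_def)
    next
      assume "s = -1"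
      then show ?thesis using s uniq[of 1] iff by (auto simp: vsign_def)
    qed
  qed
  have "map (\<lambda>x. (x, vsign (antipode ` T) x)) (sorted_list_of_set (fst ` T))
      = map (\<lambda>x. (x, - vsign T x)) (sorted_list_of_set (fst ` T))"
    using fin by (intro map_cong refl) (simp add: eq)
  then show ?thesis unfolding listing_def f by (simp add: o_def)
qed

end

section \<open>Subdivision and the cochain of alternating labels\<close>

lemma iterated_subdivision_natural:
  assumes "singular_chain p X c"
  shows "(singular_subdivision p ^^ N) (chain_map p g c) = chain_map p g ((singular_subdivision p ^^ N) c)"
    and "singular_chain p X ((singular_subdivision p ^^ N) c)"
proof (induction N)
  case (Suc N)
  case 1 show ?case using Suc assms naturality_singular_subdivision[OF Suc(2), of g] by simp
  case 2 show ?case using singular_chain_singular_subdivision[OF Suc(2)] by simp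
qed (use assms in auto)

lemma chain_boundary_iterated_subdivision:
  assumes "singular_chain p X c"
  shows "chain_boundary p ((singular_subdivision p ^^ N) c)
    = (singular_subdivision (p - Suc 0) ^^ N) (chain_boundary p c)"
proof (induction N)
  case (Suc N)
  show ?case
    using chain_boundary_singular_subdivision[OF iterated_subdivision_natural(2)[OF assms, of N]] Suc
    by simp
qed simp

lemma iterated_subdivision_zero:
  assumes "singular_chain 0 X c"
  shows "(singular_subdivision 0 ^^ N) c = c"
  using assms by (induction N) (auto simp: singular_subdivision_zero)

text \<open>The sign of an index is read off from any vertex carrying it; on
  \<open>compatible\<close> simplices this is unambiguous.\<close>

definition alt_cochain :: "('a \<Rightarrow> nat) \<Rightarrow> ('a \<Rightarrow> bool) \<Rightarrow> nat \<Rightarrow> ((nat \<Rightarrow> real) \<Rightarrow> 'a) \<Rightarrow> bit" where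
  "alt_cochain idx pos p h = of_bool
     (pos_alt (\<lambda>m. \<exists>i\<le>p. idx (h (unit_vec i)) = m \<and> pos (h (unit_vec i))) p (\<lambda>i. idx (h (unit_vec i))))"

text \<open>The absence of complementary edges in Fan's lemma.\<close>

definition compatible :: "('a \<Rightarrow> nat) \<Rightarrow> ('a \<Rightarrow> bool) \<Rightarrow> nat \<Rightarrow> ((nat \<Rightarrow> real) \<Rightarrow> 'a) \<Rightarrow> bool" where
  "compatible idx pos p h \<longleftrightarrow> (\<forall>i\<le>p. \<forall>j\<le>p. idx (h (unit_vec i)) = idx (h (unit_vec j)) \<longrightarrow>
     pos (h (unit_vec i)) = pos (h (unit_vec j)))"

lemma alt_cochain_eq:
  assumes "\<And>i. i \<le> p \<Longrightarrow> idx (h (unit_vec i)) = J i" "\<And>i. i \<le> p \<Longrightarrow> pos (h (unit_vec i)) = sg (J i)"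
  shows "alt_cochain idx pos p h = of_bool (pos_alt sg p J)"
proof -
  have "pos_alt (\<lambda>m. \<exists>i\<le>p. idx (h (unit_vec i)) = m \<and> pos (h (unit_vec i))) p (\<lambda>i. idx (h (unit_vec i)))
      = pos_alt sg p J"
    using assms by (intro pos_alt_cong) auto
  then show ?thesis by (simp add: alt_cochain_def)
qed

text \<open>This is \<open>pos_alt_facets\<close> for the vertex labels: \<open>\<iota>\<close>
  keeps indices and flips signs, so lists with a negative first sign are the ones counted on the
  antipodal simplex.\<close>

lemma alt_cochain_coboundary:
  assumes comp: "compatible idx pos (Suc p) h"
    and \<iota>: "\<And>i. i \<le> Suc p \<Longrightarrow> idx (\<iota> (h (unit_vec i))) = idx (h (unit_vec i)) \<and>
        pos (\<iota> (h (unit_vec i))) = (\<not> pos (h (unit_vec i)))"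
  shows "(\<Sum>k\<le>Suc p. alt_cochain idx pos p (singular_face (Suc p) k h))
    = alt_cochain idx pos (Suc p) h + alt_cochain idx pos (Suc p) (simplex_map (Suc p) \<iota> h)"
proof -
  define J where "J i = idx (h (unit_vec i))" for i
  define sg where "sg m \<longleftrightarrow> (\<exists>i\<le>Suc p. J i = m \<and> pos (h (unit_vec i)))" for m
  have sg: "pos (h (unit_vec i)) = sg (J i)" if "i \<le> Suc p" for i
    using comp that unfolding compatible_def sg_def J_def by metis
  have face: "alt_cochain idx pos p (singular_face (Suc p) k h) = of_bool (pos_alt sg p (J \<circ> skip k))"
    if "k \<le> Suc p" for k
  proof (rule alt_cochain_eq)
    fix i assume i: "i \<le> p"
    then have "skip k i \<le> Suc p" by (simp add: skip_def)
    then show "pos (singular_face (Suc p) k h (unit_vec i)) = sg ((J \<circ> skip k) i)"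
      using i sg by (simp add: singular_face_unit_vec)
    show "idx (singular_face (Suc p) k h (unit_vec i)) = (J \<circ> skip k) i"
      using i by (simp add: singular_face_unit_vec J_def)
  qed
  have 1: "alt_cochain idx pos (Suc p) h = of_bool (pos_alt sg (Suc p) J)"
    by (rule alt_cochain_eq) (use sg J_def in auto)
  have 2: "alt_cochain idx pos (Suc p) (simplex_map (Suc p) \<iota> h) = of_bool (pos_alt (Not \<circ> sg) (Suc p) J)"
    by (rule alt_cochain_eq) (use sg \<iota> unit_vec_in in \<open>auto simp: simplex_map_def J_def\<close>)
  have "(\<Sum>k\<le>Suc p. alt_cochain idx pos p (singular_face (Suc p) k h))
      = (\<Sum>k\<le>Suc p. of_bool (pos_alt sg p (J \<circ> skip k)))"
    by (intro sum.cong refl face) simp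
  also have "\<dots> = of_bool (pos_alt sg (Suc p) J) + of_bool (pos_alt (Not \<circ> sg) (Suc p) J)"
    by (rule pos_alt_facets)
  finally show ?thesis unfolding 1 2 .
qed

lemma eval_cochain_alt_cochain_boundary:
  assumes "\<And>x. x \<in> topspace X \<Longrightarrow> idx (\<iota> x) = idx x \<and> pos (\<iota> x) = (\<not> pos x)"
    and "Poly_Mapping.keys c \<subseteq> {h. singular_simplex (Suc p) X h \<and> compatible idx pos (Suc p) h}"
  shows "eval_cochain (alt_cochain idx pos p) (chain_boundary (Suc p) c)
    = eval_cochain (alt_cochain idx pos (Suc p)) c + eval_cochain (alt_cochain idx pos (Suc p)) (chain_map (Suc p) \<iota> c)"
  using assms(2)
proof (induction rule: frag_induction)
  case (one h)
  then have h: "singular_simplex (Suc p) X h" "compatible idx pos (Suc p) h" by auto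
  have top: "h (unit_vec i) \<in> topspace X" if "i \<le> Suc p" for i
    using h(1) unit_vec_in[OF that] by (auto simp: singular_simplex_def continuous_map_def)
  have "eval_cochain (alt_cochain idx pos p) (chain_boundary (Suc p) (frag_of h))
      = (\<Sum>k\<le>Suc p. alt_cochain idx pos p (singular_face (Suc p) k h))"
    unfolding chain_boundary_of using bit_valued_additive[of "eval_cochain (alt_cochain idx pos p)"]
    by (simp add: eval_cochain_diff del: sum.atMost_Suc)
  then show ?case
    using alt_cochain_coboundary[OF h(2), of \<iota>] top assms(1) by (simp del: sum.atMost_Suc)
next
  case (diff a b)
  then show ?case by (simp add: chain_boundary_diff chain_map_diff eval_cochain_diff ac_simps)
qed simp

text \<open>Let \<open>M\<close> be the largest absolute coordinate of \<open>g x\<close>. At each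
  vertex the largest one still exceeds \<open>3 / 4 * M\<close>, while a given coordinate differs by
  less than \<open>M / 2\<close> between two vertices; so it cannot have opposite signs at a common
  index.\<close>

lemma compatible_small:
  fixes g :: "'a \<Rightarrow> 'b::euclidean_space"
  assumes bs: "set bs = Basis" "length bs = Suc d"
    and idx: "\<And>x. idx x \<le> d" "\<And>x i. i \<le> d \<Longrightarrow> \<bar>g x \<bullet> bs ! i\<bar> \<le> \<bar>g x \<bullet> bs ! idx x\<bar>"
    and pos: "\<And>x. pos x \<longleftrightarrow> g x \<bullet> bs ! idx x > 0"
    and h: "\<And>i. i \<le> p \<Longrightarrow> norm (g (h (unit_vec i)) - g x) < \<bar>g x \<bullet> bs ! idx x\<bar> / 4"
  shows "compatible idx pos p h"
  unfolding compatible_def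
proof (intro allI impI)
  fix i j assume ij: "i \<le> p" "j \<le> p" and eq: "idx (h (unit_vec i)) = idx (h (unit_vec j))"
  define M where "M = \<bar>g x \<bullet> bs ! idx x\<bar>"
  define y z where "y = h (unit_vec i)" and "z = h (unit_vec j)"
  have close: "\<bar>g u \<bullet> bs ! m - g x \<bullet> bs ! m\<bar> < M / 4" if "u \<in> {y, z}" "m \<le> d" for u m
  proof -
    have "bs ! m \<in> Basis" using bs that(2) by (metis less_Suc_eq_le nth_mem)
    then have "\<bar>(g u - g x) \<bullet> bs ! m\<bar> \<le> norm (g u - g x)" by (rule Basis_le_norm)
    also have "\<dots> < M / 4" using that(1) h ij by (auto simp: y_def z_def M_def)
    finally show ?thesis by (simp add: inner_diff_left)
  qed
  have big: "\<bar>g u \<bullet> bs ! idx u\<bar> > 3 / 4 * M" if "u \<in> {y, z}" for u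
    using close[OF that, of "idx x"] idx(1)[of x] idx(2)[of "idx x" u] unfolding M_def by linarith
  have "idx y = idx z" using eq by (simp add: y_def z_def)
  then show "pos (h (unit_vec i)) = pos (h (unit_vec j))"
    using big[of y] big[of z] close[of y "idx y"] close[of z "idx y"] idx(1)[of y]
    unfolding pos y_def[symmetric] z_def[symmetric] by (auto simp: abs_if split: if_splits)
qed

text \<open>\<open>\<Phi> k \<sigma>\<close> counts modulo two the positively alternating simplices
  in an iterated subdivision of \<open>\<sigma>\<close>. Subdivision commutes with boundaries and
  with the involution, so the coboundary formula for small singular simplices passes to the faces of
  the complex.\<close>

theorem antipodal_cochains_exist:
  fixes f :: "(nat \<times> int \<Rightarrow> real) \<Rightarrow> 'b::euclidean_space"
  assumes dim: "DIM('b) = Suc d" and V: "finite V" "V \<subseteq> UNIV \<times> {-1, 1}" "\<And>v. v \<in> V \<Longrightarrow> antipode v \<in> V"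
    and K: "K \<subseteq> Pow V" "\<And>\<sigma> \<tau>. \<sigma> \<in> K \<Longrightarrow> \<tau> \<subseteq> \<sigma> \<Longrightarrow> \<tau> \<in> K"
      "\<And>\<sigma>. \<sigma> \<in> K \<Longrightarrow> antipode ` \<sigma> \<in> K" "\<And>\<sigma>. \<sigma> \<in> K \<Longrightarrow> inj_on fst \<sigma>"
    and f: "continuous_on (geom_real V K) f" "\<And>x. x \<in> geom_real V K \<Longrightarrow> f x \<noteq> f (swap_inv x)"
  shows "\<exists>\<Phi> :: nat \<Rightarrow> (nat \<times> int) set \<Rightarrow> bit.
    (\<forall>k. \<forall>\<sigma>\<in>K. card \<sigma> = k + 2 \<longrightarrow> (\<Sum>v\<in>\<sigma>. \<Phi> k (\<sigma> - {v})) = \<Phi> (Suc k) \<sigma> + \<Phi> (Suc k) (antipode ` \<sigma>)) \<and>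
    (\<forall>v. {v} \<in> K \<longrightarrow> \<Phi> 0 {v} + \<Phi> 0 {antipode v} = 1) \<and>
    (\<forall>\<sigma>\<in>K. card \<sigma> = d + 2 \<longrightarrow> \<Phi> (Suc d) \<sigma> = 0)"
proof -
  define X where "X = geom_real V K"
  define g where "g x = f x - f (swap_inv x)" for x
  have swapX: "swap_inv x \<in> X" if x: "x \<in> X" for x
  proof -
    have "sum (x \<circ> antipode) V = sum x V"
      by (rule sum.reindex_bij_witness[of _ antipode antipode]) (use V(3) in auto)
    moreover have "{v. (x \<circ> antipode) v \<noteq> 0} = antipode ` {v. x v \<noteq> 0}"
      by (force simp: image_iff)
    moreover have "v \<notin> V \<Longrightarrow> antipode v \<notin> V" for v using V(3)[of "antipode v"] by auto
    ultimately show ?thesis using x K(3) unfolding X_def geom_real_def swap_inv_eq by auto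
  qed
  have cont_swap: "continuous_on X swap_inv"
    unfolding swap_inv_def case_prod_beta
    by (intro continuous_on_coordinatewise_then_product continuous_on_subset[OF continuous_on_product_coordinates]) simp
  have contg: "continuous_on X g"
    unfolding g_def using f(1) swapX cont_swap
    by (intro continuous_on_diff continuous_on_compose2[OF f(1) cont_swap]) (auto simp: X_def)
  have g_swap: "g (swap_inv x) = - g x" for x by (simp add: g_def)
  have g_nz: "g x \<noteq> 0" if "x \<in> X" for x using f(2) that by (simp add: g_def X_def)
  obtain bs where bs: "distinct bs" "set bs = (Basis :: 'b set)"
    using finite_distinct_list[OF finite_Basis] by blast
  have len: "length bs = Suc d" using bs dim by (metis distinct_card)
  \<comment> \<open>Only absolute values enter and \<open>LEAST\<close> resolves ties, so
    \<open>x\<close> and \<open>swap_inv x\<close> receive the same index.\<close>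
  define idx where "idx x = (LEAST i. i \<le> d \<and> (\<forall>j\<le>d. \<bar>g x \<bullet> bs ! j\<bar> \<le> \<bar>g x \<bullet> bs ! i\<bar>))" for x
  define pos where "pos x \<longleftrightarrow> g x \<bullet> bs ! idx x > 0" for x
  have "idx x \<le> d \<and> (\<forall>j\<le>d. \<bar>g x \<bullet> bs ! j\<bar> \<le> \<bar>g x \<bullet> bs ! idx x\<bar>)" for x
  proof -
    have "\<exists>i. i \<in> {..d} \<and> (\<forall>j\<in>{..d}. \<bar>g x \<bullet> bs ! j\<bar> \<le> \<bar>g x \<bullet> bs ! i\<bar>)"
    proof -
      let ?F = "(\<lambda>i. \<bar>g x \<bullet> bs ! i\<bar>) ` {..d}"
      have "Max ?F \<in> ?F" by (rule Max_in) auto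
      then obtain i where "Max ?F = \<bar>g x \<bullet> bs ! i\<bar>" "i \<in> {..d}" by (rule imageE)
      moreover have "\<bar>g x \<bullet> bs ! j\<bar> \<le> Max ?F" if "j \<in> {..d}" for j
        using that by (intro Max_ge) auto
      ultimately show ?thesis by auto
    qed
    then have "\<exists>i. i \<le> d \<and> (\<forall>j\<le>d. \<bar>g x \<bullet> bs ! j\<bar> \<le> \<bar>g x \<bullet> bs ! i\<bar>)" by (simp add: atMost_def)
    from LeastI_ex[OF this] show ?thesis unfolding idx_def .
  qed
  then have idx: "\<And>x. idx x \<le> d" "\<And>x i. i \<le> d \<Longrightarrow> \<bar>g x \<bullet> bs ! i\<bar> \<le> \<bar>g x \<bullet> bs ! idx x\<bar>" by auto
  have M_pos: "\<bar>g x \<bullet> bs ! idx x\<bar> > 0" if "x \<in> X" for x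
  proof (rule ccontr)
    assume "\<not> 0 < \<bar>g x \<bullet> bs ! idx x\<bar>"
    then have z: "g x \<bullet> bs ! i = 0" if "i \<le> d" for i using idx(2)[OF that, of x] by simp
    have "g x \<bullet> b = 0" if "b \<in> Basis" for b
      using that z bs(2) len by (metis in_set_conv_nth less_Suc_eq_le)
    then show False using g_nz[OF that] using euclidean_all_zero_iff[of "g x"] by blast
  qed
  have flip: "idx (swap_inv x) = idx x \<and> pos (swap_inv x) = (\<not> pos x)" if "x \<in> X" for x
  proof -
    have i: "idx (swap_inv x) = idx x" by (simp add: idx_def g_swap)
    show ?thesis using M_pos[OF that] by (auto simp: pos_def i g_swap)
  qed
  \<comment> \<open>Near \<open>x\<close> the function \<open>g\<close> may vary by a quarter of its
    largest coordinate there, the tolerance of \<open>compatible_small\<close>.\<close>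
  define \<C> where "\<C> = (\<lambda>x. {y \<in> X. norm (g y - g x) < \<bar>g x \<bullet> bs ! idx x\<bar> / 4}) ` X"
  let ?T = "top_of_set X"
  have open\<C>: "openin ?T U" if U: "U \<in> \<C>" for U
  proof -
    obtain x where x: "U = {y \<in> X. norm (g y - g x) < \<bar>g x \<bullet> bs ! idx x\<bar> / 4}"
      using U unfolding \<C>_def by blast
    have "U = X \<inter> g -` ball (g x) (\<bar>g x \<bullet> bs ! idx x\<bar> / 4)"
      unfolding x by (auto simp: dist_norm norm_minus_commute)
    then show ?thesis using continuous_openin_preimage_gen[OF contg open_ball] by simp
  qed
  have cover: "topspace ?T \<subseteq> \<Union>\<C>"
    using M_pos by (auto simp: \<C>_def)
  have finK: "finite K" using K(1) V(1) finite_subset by blast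
  have T: "finite \<sigma>" "\<sigma> \<subseteq> UNIV \<times> {-1, 1}" "inj_on fst \<sigma>" "\<sigma> \<subseteq> V" if "\<sigma> \<in> K" for \<sigma>
    using that K(1,4) V(1,2) finite_subset by blast+
  have sing: "singular_simplex (card \<sigma> - 1) ?T (affine_simplex (listing \<sigma>))" if \<sigma>: "\<sigma> \<in> K" "\<sigma> \<noteq> {}" for \<sigma>
  proof -
    note T = T[OF \<sigma>(1)]
    have "listing \<sigma> \<noteq> []" using set_listing[OF T(1-3)] \<sigma>(2) by auto
    then have "singular_simplex (length (listing \<sigma>) - 1) (top_of_set (geom_real V K)) (affine_simplex (listing \<sigma>))"
    proof (rule singular_simplex_lin[OF V(1), rotated -1])
      show "\<And>\<sigma> \<tau>. \<sigma> \<in> K \<Longrightarrow> \<tau> \<subseteq> \<sigma> \<Longrightarrow> \<tau> \<in> K" by (rule K(2))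
    qed (use set_listing[OF T(1-3)] T(4) \<sigma> in simp_all)
    then show ?thesis using length_listing[OF T(1-3)] by (simp add: X_def)
  qed
  let ?sub = "\<lambda>\<sigma> m. (singular_subdivision (card \<sigma> - 1) ^^ m) (frag_of (affine_simplex (listing \<sigma>)))"
  have "\<forall>\<sigma>\<in>K - {{}}. \<exists>n. \<forall>m h. n \<le> m \<longrightarrow> h \<in> Poly_Mapping.keys (?sub \<sigma> m) \<longrightarrow>
      (\<exists>U\<in>\<C>. h \<in> standard_simplex (card \<sigma> - 1) \<rightarrow> U)"
  proof
    fix \<sigma> assume "\<sigma> \<in> K - {{}}"
    then have "singular_chain (card \<sigma> - 1) ?T (frag_of (affine_simplex (listing \<sigma>)))"
      using sing[of \<sigma>] by (simp add: singular_chain_of)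
    from sufficient_iterated_singular_subdivision_exists[OF open\<C> cover this]
    obtain n where "\<And>m h. n \<le> m \<Longrightarrow> h \<in> Poly_Mapping.keys (?sub \<sigma> m) \<Longrightarrow>
        \<exists>U\<in>\<C>. h \<in> standard_simplex (card \<sigma> - 1) \<rightarrow> U" by blast
    then show "\<exists>n. \<forall>m h. n \<le> m \<longrightarrow> h \<in> Poly_Mapping.keys (?sub \<sigma> m) \<longrightarrow>
        (\<exists>U\<in>\<C>. h \<in> standard_simplex (card \<sigma> - 1) \<rightarrow> U)" by blast
  qed
  from bchoice[OF this] obtain n where n: "\<And>\<sigma> m h. \<sigma> \<in> K - {{}} \<Longrightarrow> n \<sigma> \<le> m \<Longrightarrow>
      h \<in> Poly_Mapping.keys (?sub \<sigma> m) \<Longrightarrow> \<exists>U\<in>\<C>. h \<in> standard_simplex (card \<sigma> - 1) \<rightarrow> U"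
    by blast
  \<comment> \<open>One depth for all faces, so that the subdivided boundary of a simplex consists
    of its subdivided facets; the inserted \<open>0\<close> keeps \<open>Max\<close>
    defined.\<close>
  define N where "N = Max (insert 0 (n ` K))"
  have nN: "n \<sigma> \<le> N" if "\<sigma> \<in> K" for \<sigma> using that finK by (auto simp: N_def intro: Max_ge)
  let ?\<alpha> = "alt_cochain idx pos"
  define sub where "sub p c = (singular_subdivision p ^^ N) c" for p and c :: "(nat \<times> int \<Rightarrow> real) chain"
  define \<Phi> where "\<Phi> p \<sigma> = eval_cochain (?\<alpha> p) (sub p (frag_of (affine_simplex (listing \<sigma>))))" for p \<sigma>
  have comp: "compatible idx pos (card \<sigma> - 1) h"
    if \<sigma>: "\<sigma> \<in> K" "\<sigma> \<noteq> {}" "h \<in> Poly_Mapping.keys (sub (card \<sigma> - 1) (frag_of (affine_simplex (listing \<sigma>))))" for \<sigma> h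
  proof -
    obtain x where x: "x \<in> X" "\<And>t. t \<in> standard_simplex (card \<sigma> - 1) \<Longrightarrow> norm (g (h t) - g x) < \<bar>g x \<bullet> bs ! idx x\<bar> / 4"
    proof -
      obtain U where "U \<in> \<C>" "h \<in> standard_simplex (card \<sigma> - 1) \<rightarrow> U"
        using n[of \<sigma> N h] nN \<sigma> by (auto simp: sub_def)
      then show thesis using that unfolding \<C>_def by blast
    qed
    show ?thesis
      by (rule compatible_small[where x = x, OF bs(2) len idx pos_def]) (use x unit_vec_in in auto)
  qed
  have anti_lst: "simplex_map (card \<sigma> - 1) swap_inv (affine_simplex (listing \<sigma>)) = affine_simplex (listing (antipode ` \<sigma>))"
    if "\<sigma> \<in> K" "\<sigma> \<noteq> {}" for \<sigma>
  proof -
    note T = T[OF that(1)]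
    have "listing \<sigma> \<noteq> []" using set_listing[OF T(1-3)] that(2) by auto
    then show ?thesis
      using simplex_map_lin[of "listing \<sigma>"] length_listing[OF T(1-3)] listing_antipode[OF T(1-3)] by simp
  qed
  have coboundary: "(\<Sum>v\<in>\<sigma>. \<Phi> k (\<sigma> - {v})) = \<Phi> (Suc k) \<sigma> + \<Phi> (Suc k) (antipode ` \<sigma>)"
    if \<sigma>: "\<sigma> \<in> K" "card \<sigma> = k + 2" for \<sigma> k
  proof -
    note T = T[OF \<sigma>(1)]
    have ne: "\<sigma> \<noteq> {}" using \<sigma>(2) by auto
    let ?xs = "listing \<sigma>"
    let ?c = "frag_of (affine_simplex ?xs)"
    have lxs: "length ?xs = Suc (Suc k)" using length_listing[OF T(1-3)] \<sigma>(2) by simp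
    have sc: "singular_chain (Suc k) ?T ?c" using sing[OF \<sigma>(1) ne] \<sigma>(2) by (simp add: singular_chain_of)
    have keys: "Poly_Mapping.keys (sub (Suc k) ?c) \<subseteq> {h. singular_simplex (Suc k) ?T h \<and> compatible idx pos (Suc k) h}"
      using comp[OF \<sigma>(1) ne] \<sigma>(2) iterated_subdivision_natural(2)[OF sc, of N]
      by (auto simp: singular_chain_def sub_def)
    have "(\<Sum>v\<in>\<sigma>. \<Phi> k (\<sigma> - {v})) = (\<Sum>v\<in>set ?xs. \<Phi> k (\<sigma> - {v}))"
      using set_listing[OF T(1-3)] by simp
    also have "\<dots> = (\<Sum>j<length ?xs. \<Phi> k (\<sigma> - {?xs ! j}))"
      by (rule sum.reindex_bij_betw[symmetric]) (rule bij_betw_nth[OF distinct_listing[OF T(1-3)]]; simp)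
    also have "\<dots> = (\<Sum>j\<le>Suc k. eval_cochain (?\<alpha> k) (sub k (frag_of (singular_face (Suc k) j (affine_simplex ?xs)))))"
    proof (rule sum.cong)
      fix j assume "j \<in> {..Suc k}"
      then show "\<Phi> k (\<sigma> - {?xs ! j}) = eval_cochain (?\<alpha> k) (sub k (frag_of (singular_face (Suc k) j (affine_simplex ?xs))))"
        using listing_remove[OF T(1-3), of j] singular_face_lin[OF lxs, of j] \<sigma>(2) by (simp add: \<Phi>_def)
    qed (use lxs in auto)
    also have "\<dots> = eval_cochain (?\<alpha> k) (sub k (chain_boundary (Suc k) ?c))"
      unfolding chain_boundary_of
      using bit_valued_additive[of "\<lambda>c. eval_cochain (?\<alpha> k) (sub k c)"]
      by (simp add: sub_def singular_subdivision_power_diff eval_cochain_diff del: sum.atMost_Suc)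
    also have "\<dots> = eval_cochain (?\<alpha> k) (chain_boundary (Suc k) (sub (Suc k) ?c))"
      using chain_boundary_iterated_subdivision[OF sc, of N] by (simp add: sub_def)
    also have "\<dots> = eval_cochain (?\<alpha> (Suc k)) (sub (Suc k) ?c) + eval_cochain (?\<alpha> (Suc k)) (chain_map (Suc k) swap_inv (sub (Suc k) ?c))"
      using flip by (intro eval_cochain_alt_cochain_boundary[OF _ keys]) auto
    also have "chain_map (Suc k) swap_inv (sub (Suc k) ?c) = sub (Suc k) (frag_of (affine_simplex (listing (antipode ` \<sigma>))))"
      using iterated_subdivision_natural(1)[OF sc, of N swap_inv] anti_lst[OF \<sigma>(1) ne] \<sigma>(2) by (simp add: sub_def)
    finally show ?thesis by (simp add: \<Phi>_def)
  qed
  have init: "\<Phi> 0 {v} + \<Phi> 0 {antipode v} = 1" if v: "{v} \<in> K" for v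
  proof -
    \<comment> \<open>In dimension zero subdivision is the identity and a single label always
      alternates, so only its sign is left.\<close>
    have *: "\<Phi> 0 \<sigma> = of_bool (pos (affine_simplex (listing \<sigma>) (unit_vec 0)))" if "\<sigma> \<in> K" "card \<sigma> = 1" for \<sigma>
    proof -
      have "singular_simplex 0 ?T (affine_simplex (listing \<sigma>))" using sing[OF that(1)] that(2) by force
      then have "sub 0 (frag_of (affine_simplex (listing \<sigma>))) = frag_of (affine_simplex (listing \<sigma>))"
        unfolding sub_def by (intro iterated_subdivision_zero) (simp add: singular_chain_of)
      then show ?thesis by (simp add: \<Phi>_def alt_cochain_def pos_alt_def)
    qed
    have a: "{antipode v} \<in> K" using K(3)[OF v] by simp
    have s: "singular_simplex 0 ?T (affine_simplex (listing {v}))" using sing[OF v] by simp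
    then have "affine_simplex (listing {v}) (unit_vec 0) \<in> X"
      using unit_vec_in[of 0 0] by (auto simp: singular_simplex_def continuous_map_def)
    moreover have "affine_simplex (listing {antipode v}) (unit_vec 0) = swap_inv (affine_simplex (listing {v}) (unit_vec 0))"
      using fun_cong[OF anti_lst[OF v], of "unit_vec 0"] unit_vec_in[of 0 0] by (simp add: simplex_map_def)
    ultimately show ?thesis using *[OF v] *[OF a] flip by simp
  qed
  \<comment> \<open>Indices in \<open>{..d}\<close> cannot be distinct on \<open>d + 2\<close>
    vertices, so \<open>pos_alt\<close> fails for every singular simplex.\<close>
  have top: "\<Phi> (Suc d) \<sigma> = 0" for \<sigma>
  proof -
    have "?\<alpha> (Suc d) h = 0" for h
    proof -
      have "\<not> inj_on (\<lambda>i. idx (h (unit_vec i))) {..Suc d}"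
      proof
        assume "inj_on (\<lambda>i. idx (h (unit_vec i))) {..Suc d}"
        then have "card {..Suc d} \<le> card {..d}"
          by (rule card_inj_on_le) (use idx(1) in auto)
        then show False by simp
      qed
      then show ?thesis by (simp add: alt_cochain_def pos_alt_def)
    qed
    then show ?thesis by (simp add: \<Phi>_def eval_cochain_def)
  qed
  show ?thesis using coboundary init top by blast
qed

section \<open>The separated deleted join as a flag complex\<close>

definition witnesses :: "nat \<Rightarrow> nat set set \<Rightarrow> nat set \<Rightarrow> nat set \<Rightarrow> nat set" where
  "witnesses n E A B = {w. w < n \<and> w \<notin> A \<union> B \<and> (\<forall>a\<in>A. {w, a} \<in> E) \<and> (\<forall>b\<in>B. {w, b} \<notin> E)}"

text \<open>For \<open>\<alpha> < 1 / d\<close>, vertices joined to \<open>d\<close> prescribed ones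
  are still plentiful. The bound \<open>2 * d + 2\<close> leaves room for the opposite layer of a
  signed set and up to two further vertices to avoid.\<close>

definition extension_property :: "nat \<Rightarrow> nat \<Rightarrow> nat set set \<Rightarrow> bool" where
  "extension_property d n E \<longleftrightarrow> (\<forall>A B. A \<subseteq> {..<n} \<longrightarrow> B \<subseteq> {..<n} \<longrightarrow> A \<inter> B = {} \<longrightarrow>
     card A \<le> d \<longrightarrow> card B \<le> 2 * d + 2 \<longrightarrow> witnesses n E A B \<noteq> {})"

definition connected_in :: "nat set set \<Rightarrow> nat set \<Rightarrow> bool" where
  "connected_in E W \<longleftrightarrow> (\<forall>T\<subseteq>W. T \<noteq> {} \<longrightarrow> T \<noteq> W \<longrightarrow> (\<exists>x\<in>T. \<exists>y\<in>W - T. {x, y} \<in> E))"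

definition connectivity_property :: "nat \<Rightarrow> nat \<Rightarrow> nat set set \<Rightarrow> bool" where
  "connectivity_property d n E \<longleftrightarrow> (\<forall>A B. A \<subseteq> {..<n} \<longrightarrow> B \<subseteq> {..<n} \<longrightarrow> A \<inter> B = {} \<longrightarrow>
     card A < d \<longrightarrow> card B \<le> 2 * d + 2 \<longrightarrow> connected_in E (witnesses n E A B))"

definition signed_adj :: "nat \<Rightarrow> nat set set \<Rightarrow> nat \<times> int \<Rightarrow> nat \<times> int \<Rightarrow> bool" where
  "signed_adj n E p q \<longleftrightarrow> p \<in> {0..<n} \<times> {-1, 1} \<and> q \<in> {0..<n} \<times> {-1, 1} \<and> fst p \<noteq> fst q \<and>
     (({fst p, fst q} \<in> E) = (snd p = snd q))"

lemma signed_adj_sym: "signed_adj n E p q \<Longrightarrow> signed_adj n E q p"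
  by (auto simp: signed_adj_def insert_commute)

text \<open>The join forbids two-element faces between the layers; for distinct vertices below
  \<open>n\<close> these are exactly the edges, so the condition is one on pairs, as in a clique
  complex.\<close>

lemma cliques_signed_adj:
  "cliques (signed_adj n E) ({0..<n} \<times> {-1, 1}) = sep_deleted_join (flag_complex n E)" (is "?L = ?R")
proof
  show "?L \<subseteq> ?R"
  proof
    fix \<rho> assume \<rho>: "\<rho> \<in> ?L"
    define \<sigma> \<tau> where "\<sigma> = {x. (x, -1) \<in> \<rho>}" and "\<tau> = {x. (x, 1) \<in> \<rho>}"
    have sub: "\<rho> \<subseteq> {0..<n} \<times> {-1, 1}" and adj: "\<And>p q. p \<in> \<rho> \<Longrightarrow> q \<in> \<rho> \<Longrightarrow> p \<noteq> q \<Longrightarrow> signed_adj n E p q"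
      using \<rho> by (auto simp: cliques_def)
    have "\<rho> = (\<sigma> \<times> {-1}) \<union> (\<tau> \<times> {1})" using sub by (auto simp: \<sigma>_def \<tau>_def)
    moreover have fl: "\<sigma> \<in> flag_complex n E" "\<tau> \<in> flag_complex n E"
      using sub adj[of "(_, -1)" "(_, -1)"] adj[of "(_, 1)" "(_, 1)"]
      by (auto simp: flag_complex_def \<sigma>_def \<tau>_def signed_adj_def)
    have cross: "x \<noteq> y \<and> {x, y} \<notin> E" if "x \<in> \<sigma>" "y \<in> \<tau>" for x y
      using adj[of "(x, -1)" "(y, 1)"] that by (auto simp: \<sigma>_def \<tau>_def signed_adj_def)
    have "{x, y} \<in> E" if "{x, y} \<in> flag_complex n E" "x \<noteq> y" for x y
      using that by (auto simp: flag_complex_def)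
    then have "\<not> (\<exists>u\<in>\<sigma>. \<exists>v\<in>\<tau>. u \<noteq> v \<and> {u, v} \<in> flag_complex n E)" using cross by blast
    moreover have "\<sigma> \<inter> \<tau> = {}" using cross by blast
    ultimately show "\<rho> \<in> ?R" using fl
      unfolding sep_deleted_join_def mem_Collect_eq by (intro exI[of _ \<sigma>] exI[of _ \<tau>] conjI)
  qed
  show "?R \<subseteq> ?L"
  proof
    fix \<rho> assume "\<rho> \<in> ?R"
    then obtain \<sigma> \<tau> where \<rho>: "\<rho> = (\<sigma> \<times> {-1}) \<union> (\<tau> \<times> {1})" and fl: "\<sigma> \<in> flag_complex n E" "\<tau> \<in> flag_complex n E"
      and disj: "\<sigma> \<inter> \<tau> = {}" and "\<not> (\<exists>u\<in>\<sigma>. \<exists>v\<in>\<tau>. u \<noteq> v \<and> {u, v} \<in> flag_complex n E)"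
      unfolding sep_deleted_join_def mem_Collect_eq by (elim exE conjE)
    then have sep: "\<And>u v. u \<in> \<sigma> \<Longrightarrow> v \<in> \<tau> \<Longrightarrow> u \<noteq> v \<Longrightarrow> {u, v} \<notin> flag_complex n E"
      by blast
    have lt: "x < n" if "x \<in> \<sigma> \<union> \<tau>" for x using fl that by (auto simp: flag_complex_def)
    have same: "{x, y} \<in> E" if "x \<in> \<sigma> \<and> y \<in> \<sigma> \<or> x \<in> \<tau> \<and> y \<in> \<tau>" "x \<noteq> y" for x y
      using fl that by (auto simp: flag_complex_def)
    have cross: "x \<noteq> y \<and> {x, y} \<notin> E \<and> {y, x} \<notin> E" if "x \<in> \<sigma>" "y \<in> \<tau>" for x y
    proof -
      have "x \<noteq> y" using that disj by auto
      moreover have "{x, y} \<notin> E"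
      proof
        assume "{x, y} \<in> E"
        then have "{x, y} \<in> flag_complex n E" using lt that by (auto simp: flag_complex_def insert_commute)
        then show False using sep that calculation by blast
      qed
      ultimately show ?thesis by (simp add: insert_commute)
    qed
    have "signed_adj n E p q" if "p \<in> \<rho>" "q \<in> \<rho>" "p \<noteq> q" for p q
      using that lt same cross disj unfolding \<rho> signed_adj_def by auto
    then show "\<rho> \<in> ?L" using lt unfolding cliques_def \<rho> by auto
  qed
qed

lemma Z_real_eq:
  "Ztilde_real n E = geom_real ({0..<n} \<times> {-1, 1}) (cliques (signed_adj n E) ({0..<n} \<times> {-1, 1}))"
  by (simp add: Ztilde_real_def cliques_signed_adj)

definition layer :: "(nat \<times> int) set \<Rightarrow> int \<Rightarrow> nat set" where
  "layer S s = {x. (x, s) \<in> S}"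

text \<open>Translates signed common neighbourhoods into adjacency patterns of the random graph:
  edges to the layer of the same sign, non-edges to the other layer.\<close>

lemma common_nbrs_signed_adj:
  assumes S: "S \<subseteq> {0..<n} \<times> {-1, 1}" and s: "s \<in> {-1, 1}"
  shows "(w, s) \<in> common_nbrs ({0..<n} \<times> {-1, 1}) (signed_adj n E) S \<longleftrightarrow>
    w \<in> witnesses n E (layer S s) (layer S (- s))"
proof -
  have "(\<forall>q\<in>S. P q) \<longleftrightarrow> (\<forall>a\<in>layer S s. P (a, s)) \<and> (\<forall>b\<in>layer S (- s). P (b, - s))" for P
  proof (intro iffI conjI ballI)
    fix q assume all: "(\<forall>a\<in>layer S s. P (a, s)) \<and> (\<forall>b\<in>layer S (- s). P (b, - s))" and q: "q \<in> S"
    obtain x t where xt: "q = (x, t)" by (cases q)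
    then have "t = s \<or> t = - s" using S s q by auto
    then show "P q" using all q xt by (auto simp: layer_def)
  qed (auto simp: layer_def)
  note * = this[of "signed_adj n E (w, s)"]
  have "\<And>x t. (x, t) \<in> S \<Longrightarrow> x < n" using S by auto
  then show ?thesis
    unfolding common_nbrs_def mem_Collect_eq * using s
    by (auto simp: witnesses_def signed_adj_def layer_def)
qed

text \<open>For connectedness, every point of sign \<open>- s\<close> has a neighbour of sign
  \<open>s\<close> (\<open>other\<close>), so it suffices that the points of one sign lie on one
  side of the cut (\<open>spread\<close>). With at most \<open>2 * d\<close> vertices in
  \<open>S\<close>, either a layer has fewer than \<open>d\<close> and the graph itself connects its
  witnesses, or both have exactly \<open>d\<close> and any two points of sign 1 share a neighbour of
  sign -1.\<close>

lemma dominated_signed_graph: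
  assumes ext: "extension_property d n E" and con: "connectivity_property d n E"
  shows "dominated_graph ({0..<n} \<times> {-1, 1}) antipode (signed_adj n E) (2 * d + 1)"
proof
  let ?V = "{0..<n} \<times> {-1, 1 :: int}" and ?R = "signed_adj n E"
  show "finite ?V" by simp
  show "antipode (antipode x) = x" for x by simp
  show "antipode x \<noteq> x" if "x \<in> ?V" for x using that by auto
  show "antipodal_graph ?V antipode ?R"
    using signed_adj_sym by (auto simp: antipodal_graph_def signed_adj_def insert_commute)
  fix S :: "(nat \<times> int) set"
  assume S: "S \<subseteq> ?V" "antipode_free antipode S"
  let ?N = "common_nbrs ?V ?R S" and ?A = "layer S"
  note N = common_nbrs_signed_adj[OF S(1)]
  have fin: "finite S" using S(1) finite_subset by fastforce
  have sub: "?A s \<subseteq> {..<n}" for s using S(1) by (auto simp: layer_def)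
  then have finA: "finite (?A s)" for s using finite_subset by blast
  have disj: "?A s \<inter> ?A (- s) = {}" for s
    using S(2) by (force simp: layer_def antipode_free_def)
  have "S = (\<lambda>x. (x, -1)) ` ?A (-1) \<union> (\<lambda>x. (x, 1)) ` ?A 1"
    using S(1) by (force simp: layer_def)
  then have "card S = card ((\<lambda>x. (x, -1 :: int)) ` ?A (-1) \<union> (\<lambda>x. (x, 1)) ` ?A 1)" by simp
  also have "\<dots> = card (?A (-1)) + card (?A 1)"
    by (subst card_Un_disjoint) (auto simp: finA card_image inj_on_def)
  finally have card: "card S = card (?A s) + card (?A (- s))" if "s \<in> {-1, 1}" for s using that by auto
  \<comment> \<open>Counting \<open>C\<close> among the vertices to avoid gives a point
    \<open>(u, s)\<close> that is signed-adjacent to \<open>(w, - s)\<close> for every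
    \<open>w \<in> C\<close>.\<close>
  have ex: "\<exists>u. (u, s) \<in> ?N \<and> (\<forall>w\<in>C. u \<noteq> w \<and> {u, w} \<notin> E)"
    if s: "s \<in> {-1, 1}" "card (?A s) \<le> d" "card (?A (- s)) + card C \<le> 2 * d + 2" "C \<subseteq> {..<n}" "C \<inter> ?A s = {}" for s C
  proof -
    have "card (?A (- s) \<union> C) \<le> 2 * d + 2" using card_Un_le[of "?A (- s)" C] s(3) by linarith
    moreover have "?A s \<inter> (?A (- s) \<union> C) = {}" "?A (- s) \<union> C \<subseteq> {..<n}"
      using disj[of s] s(4,5) sub[of "- s"] by auto
    ultimately have "witnesses n E (?A s) (?A (- s) \<union> C) \<noteq> {}"
      using ext sub[of s] s(2) unfolding extension_property_def by blast
    then obtain u where "u \<in> witnesses n E (?A s) (?A (- s) \<union> C)" by blast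
    then have "u \<in> witnesses n E (?A s) (?A (- s))" "\<forall>w\<in>C. u \<noteq> w \<and> {u, w} \<notin> E"
      by (auto simp: witnesses_def)
    then show ?thesis using N[OF s(1)] by blast
  qed
  {
    assume S': "card S \<le> 2 * d + 1"
    obtain s where s: "s \<in> {-1, 1 :: int}" "card (?A s) \<le> d" "card (?A (- s)) \<le> 2 * d + 1"
    proof (cases "card (?A 1) \<le> d")
      case True
      show thesis by (rule that[of 1]) (use True S' card[of 1] in simp_all)
    next
      case False
      show thesis by (rule that[of "-1"]) (use False S' card[of 1] in simp_all)
    qed
    then show "?N \<noteq> {}" using ex[of s "{}"] by auto
  }
  fix T assume cS: "card S < 2 * d + 1" and T: "T \<subseteq> ?N" "T \<noteq> {}" "T \<noteq> ?N"
  show "\<exists>x\<in>T. \<exists>y\<in>?N - T. ?R x y"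
  proof (rule ccontr)
    assume no: "\<not> ?thesis"
    have NV: "?N \<subseteq> ?V" by (auto simp: common_nbrs_def)
    have closed: "x \<in> T \<longleftrightarrow> y \<in> T" if "x \<in> ?N" "y \<in> ?N" "?R x y" for x y
      using no that signed_adj_sym by blast
    have cross: "?R (u, s) (w, - s)" if "(u, s) \<in> ?N" "(w, - s) \<in> ?N" "u \<noteq> w" "{u, w} \<notin> E" for u w s
      using that NV by (auto simp: signed_adj_def)
    have NA: "w \<notin> ?A s" "w \<notin> ?A (- s)" "w < n" if "(w, s) \<in> ?N" "s \<in> {-1, 1}" for w s
      using that N by (auto simp: witnesses_def)
    have other: "\<exists>u. (u, s) \<in> ?N \<and> ?R (u, s) (w, - s)"
      if s: "s \<in> {-1, 1}" "card (?A s) \<le> d" and w: "(w, - s) \<in> ?N" for s w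
    proof -
      have "card (?A (- s)) + card {w} \<le> 2 * d + 2" using card[OF s(1)] cS by simp
      moreover have "{w} \<subseteq> {..<n}" "{w} \<inter> ?A s = {}" using NA[OF w] s(1) by auto
      ultimately obtain u where "(u, s) \<in> ?N" "u \<noteq> w" "{u, w} \<notin> E" using ex[of s "{w}"] s by blast
      then show ?thesis using cross w by blast
    qed
    have spread: False if s: "s \<in> {-1, 1}" "card (?A s) \<le> d"
      and all: "\<And>u w. (u, s) \<in> ?N \<Longrightarrow> (w, s) \<in> ?N \<Longrightarrow> (u, s) \<in> T \<Longrightarrow> (w, s) \<in> T" for s
    proof -
      have sign: "t = s \<or> t = - s" if "(w, t) \<in> ?N" for w t using that NV s(1) by auto
      obtain p where p: "p \<in> T" using T(2) by blast
      then obtain w t where wt: "p = (w, t)" by (cases p)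
      have "\<exists>u. (u, s) \<in> T"
      proof (cases "t = s")
        case False
        then have t: "t = - s" using sign p wt T(1) by blast
        then obtain u where "(u, s) \<in> ?N" "?R (u, s) (w, - s)" using other[OF s, of w] p wt T(1) by blast
        then show ?thesis using closed[of "(u, s)" "(w, - s)"] p wt t T(1) by blast
      qed (use p wt in blast)
      then obtain u where u: "(u, s) \<in> T" by blast
      have "q \<in> T" if q: "q \<in> ?N" for q
      proof -
        obtain w t where wt: "q = (w, t)" by (cases q)
        show ?thesis
        proof (cases "t = s")
          case True
          then show ?thesis using all[of u w] u q wt T(1) by blast
        next
          case False
          then have t: "t = - s" using sign q wt by blast
          then obtain v where v: "(v, s) \<in> ?N" "?R (v, s) (w, - s)" using other[OF s, of w] q wt by blast
          then have "(v, s) \<in> T" using all[of u v] u T(1) by blast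
          then show ?thesis using closed[OF v(1) _ v(2)] q wt t by blast
        qed
      qed
      then show False using T(1,3) by blast
    qed
    show False
    proof (cases "\<exists>s\<in>{-1, 1}. card (?A s) < d")
      case True
      then obtain s where s: "s \<in> {-1, 1}" "card (?A s) < d" by blast
      let ?W = "witnesses n E (?A s) (?A (- s))"
      have conW: "connected_in E ?W"
        using con sub disj[of s] s card[OF s(1)] cS unfolding connectivity_property_def by auto
      show False
      proof (rule spread[OF s(1)])
        fix u w assume uw: "(u, s) \<in> ?N" "(w, s) \<in> ?N" "(u, s) \<in> T"
        show "(w, s) \<in> T"
        proof (rule ccontr)
          assume w: "(w, s) \<notin> T"
          let ?T = "{x \<in> ?W. (x, s) \<in> T}"
          have "?T \<noteq> {}" "?T \<noteq> ?W" using uw w N[OF s(1)] by blast+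
          moreover have "?T \<subseteq> ?W" by blast
          ultimately have "\<exists>x\<in>?T. \<exists>y\<in>?W - ?T. {x, y} \<in> E"
            using conW unfolding connected_in_def by presburger
          then obtain x y where xy: "x \<in> ?W" "(x, s) \<in> T" "y \<in> ?W" "(y, s) \<notin> T" "{x, y} \<in> E"
            by blast
          have "x \<noteq> y" using xy(2,4) by blast
          then have "?R (x, s) (y, s)"
            using xy s(1) by (auto simp: signed_adj_def witnesses_def)
          then show False using closed[of "(x, s)" "(y, s)"] xy N[OF s(1)] by blast
        qed
      qed (use s in simp)
    next
      case False
      then have d: "card (?A 1) = d" "card (?A (-1)) = d" using card[of 1] cS by auto
      show False
      proof (rule spread[of 1])
        fix u w assume uw: "(u, 1) \<in> ?N" "(w, 1) \<in> ?N" "(u, 1) \<in> T"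
        have "{u, w} \<subseteq> {..<n}" "{u, w} \<inter> ?A (-1) = {}" using NA[OF uw(1)] NA[OF uw(2)] by auto
        \<comment> \<open>The layer to avoid has \<open>d\<close> vertices, so together with
          \<open>u\<close> and \<open>w\<close> it stays within \<open>2 * d + 2\<close>.\<close>
        moreover have "card {u, w} \<le> 2" by (simp add: card_insert_if)
        ultimately obtain v where v: "(v, -1) \<in> ?N" "v \<noteq> u" "v \<noteq> w" "{v, u} \<notin> E" "{v, w} \<notin> E"
          using ex[of "-1" "{u, w}"] d by auto
        then have "?R (v, -1) (u, 1)" "?R (v, -1) (w, 1)"
          using cross[of v "-1"] uw by auto
        then show "(w, 1) \<in> T" using closed v(1) uw by blast
      qed (use d in simp_all)
    qed
  qed
qed

theorem good_graph_coincidence: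
  fixes f :: "(nat \<times> int \<Rightarrow> real) \<Rightarrow> 'b::euclidean_space"
  assumes dim: "DIM('b) = d + 1"
    and good: "extension_property d n E" "connectivity_property d n E"
    and f: "continuous_on (Ztilde_real n E) f"
  shows "\<exists>x\<in>Ztilde_real n E. f x = f (swap_inv x)"
proof (rule ccontr)
  assume no: "\<not> ?thesis"
  let ?V = "{0..<n} \<times> {-1, 1 :: int}" and ?R = "signed_adj n E"
  let ?K = "cliques ?R ?V"
  interpret dominated_graph ?V antipode ?R "2 * d + 1"
    by (rule dominated_signed_graph[OF good])
  have anti_R: "?R (antipode x) (antipode y)" if "?R x y" for x y
    using that by (auto simp: signed_adj_def)
  have anti_V: "antipode v \<in> ?V" if "v \<in> ?V" for v using that by auto
  have "\<exists>\<Phi> :: nat \<Rightarrow> (nat \<times> int) set \<Rightarrow> bit.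
    (\<forall>k. \<forall>\<sigma>\<in>?K. card \<sigma> = k + 2 \<longrightarrow> (\<Sum>v\<in>\<sigma>. \<Phi> k (\<sigma> - {v})) = \<Phi> (Suc k) \<sigma> + \<Phi> (Suc k) (antipode ` \<sigma>)) \<and>
    (\<forall>v. {v} \<in> ?K \<longrightarrow> \<Phi> 0 {v} + \<Phi> 0 {antipode v} = 1) \<and>
    (\<forall>\<sigma>\<in>?K. card \<sigma> = d + 2 \<longrightarrow> \<Phi> (Suc d) \<sigma> = 0)"
  proof (rule antipodal_cochains_exist)
    show "antipode ` \<sigma> \<in> ?K" if "\<sigma> \<in> ?K" for \<sigma>
    proof -
      have \<sigma>: "\<sigma> \<subseteq> ?V" "\<And>x y. x \<in> \<sigma> \<Longrightarrow> y \<in> \<sigma> \<Longrightarrow> x \<noteq> y \<Longrightarrow> ?R x y"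
        using that unfolding cliques_def by blast+
      have "?R p q" if pq: "p \<in> antipode ` \<sigma>" "q \<in> antipode ` \<sigma>" "p \<noteq> q" for p q
      proof -
        obtain x y where xy: "x \<in> \<sigma>" "p = antipode x" "y \<in> \<sigma>" "q = antipode y" using pq(1,2) by blast
        then have "x \<noteq> y" using pq(3) by blast
        then show ?thesis using anti_R[OF \<sigma>(2)] xy by blast
      qed
      moreover have "antipode ` \<sigma> \<subseteq> ?V" using \<sigma>(1) anti_V by blast
      ultimately show ?thesis unfolding cliques_def by blast
    qed
    show "inj_on fst \<sigma>" if "\<sigma> \<in> ?K" for \<sigma>
    proof (rule inj_onI, rule ccontr)
      fix x y assume xy: "x \<in> \<sigma>" "y \<in> \<sigma>" "fst x = fst y" "x \<noteq> y"
      then have "?R x y" using that unfolding cliques_def by blast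
      then show False using xy(3) by (simp add: signed_adj_def)
    qed
    show "\<tau> \<in> ?K" if "\<sigma> \<in> ?K" "\<tau> \<subseteq> \<sigma>" for \<sigma> \<tau>
      using that by (rule cliques_subset)
    show "?K \<subseteq> Pow ?V" by (auto simp: cliques_def)
    show "continuous_on (geom_real ?V ?K) f" using f by (simp add: Z_real_eq)
    show "f x \<noteq> f (swap_inv x)" if "x \<in> geom_real ?V ?K" for x using no that by (auto simp: Z_real_eq)
  qed (use dim anti_V in auto)
  then obtain \<Phi> :: "nat \<Rightarrow> (nat \<times> int) set \<Rightarrow> bit" where
    cob: "\<And>k \<sigma>. \<sigma> \<in> ?K \<Longrightarrow> card \<sigma> = k + 2 \<Longrightarrow> (\<Sum>v\<in>\<sigma>. \<Phi> k (\<sigma> - {v})) = \<Phi> (Suc k) \<sigma> + \<Phi> (Suc k) (antipode ` \<sigma>)"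
    and init: "\<And>v. {v} \<in> ?K \<Longrightarrow> \<Phi> 0 {v} + \<Phi> 0 {antipode v} = 1"
    and top: "\<And>\<sigma>. \<sigma> \<in> ?K \<Longrightarrow> card \<sigma> = d + 2 \<Longrightarrow> \<Phi> (Suc d) \<sigma> = 0"
    by blast
  \<comment> \<open>Domination of the empty set provides the vertex from which the chains
    start.\<close>
  have "common_nbrs ?V ?R {} \<noteq> {}" by (rule dominated) (auto simp: antipode_free_def)
  then obtain v where "v \<in> common_nbrs ?V ?R {}" by blast
  then have v: "v \<in> ?V" unfolding common_nbrs_def by blast
  have init': "\<Phi> 0 {x} + \<Phi> 0 {antipode x} = 1" if "x \<in> ?V" for x
    using that by (intro init) (simp add: cliques_def)
  have "2 * d < 2 * d + 1" by simp
  from no_antipodal_cochains[OF this anti_V v anti_R cob init' top] show False .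
qed

section \<open>Random graphs\<close>

text \<open>\<open>gnp_prob\<close> for an arbitrary ground set, so that the weight can be factored
  over disjoint sets of edges.\<close>

definition subset_prob :: "'a set \<Rightarrow> real \<Rightarrow> ('a set \<Rightarrow> bool) \<Rightarrow> real" where
  "subset_prob X p P = (\<Sum>E\<in>Pow X. if P E then p ^ card E * (1 - p) ^ (card X - card E) else 0)"

lemma gnp_prob_eq: "gnp_prob n p P = subset_prob (edge_slots n) p P"
  by (simp add: gnp_prob_def subset_prob_def)

lemma subset_prob_cong:
  "(\<And>E. E \<subseteq> X \<Longrightarrow> P E = Q E) \<Longrightarrow> subset_prob X p P = subset_prob X p Q"
  unfolding subset_prob_def by (intro sum.cong) auto

lemma subset_prob_mono:
  assumes "0 \<le> p" "p \<le> 1" "\<And>E. E \<subseteq> X \<Longrightarrow> P E \<Longrightarrow> Q E"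
  shows "subset_prob X p P \<le> subset_prob X p Q"
  unfolding subset_prob_def using assms by (intro sum_mono) auto

text \<open>Independence: on disjoint ground sets the cardinalities in the exponents add, so the
  weights multiply.\<close>

lemma subset_prob_Un:
  assumes fin: "finite Y" "finite Z" and disj: "Y \<inter> Z = {}"
  shows "subset_prob (Y \<union> Z) p (\<lambda>E. P (E \<inter> Y) \<and> Q (E \<inter> Z)) = subset_prob Y p P * subset_prob Z p Q"
proof -
  let ?w = "\<lambda>X E. p ^ card E * (1 - p) ^ (card X - card E)"
  have "subset_prob Y p P * subset_prob Z p Q
      = (\<Sum>(F, G)\<in>Pow Y \<times> Pow Z. (if P F then ?w Y F else 0) * (if Q G then ?w Z G else 0))"
    unfolding subset_prob_def sum_product sum.cartesian_product by simp
  also have "\<dots> = (\<Sum>(F, G)\<in>Pow Y \<times> Pow Z. if P F \<and> Q G then ?w (Y \<union> Z) (F \<union> G) else 0)"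
  proof (intro sum.cong refl, clarsimp)
    fix F G assume FG: "F \<subseteq> Y" "G \<subseteq> Z"
    have f: "finite F" "finite G" using FG fin finite_subset by auto
    have "card (F \<union> G) = card F + card G" "card (Y \<union> Z) = card Y + card Z"
      using FG disj f fin by (auto intro!: card_Un_disjoint)
    moreover have "card F \<le> card Y" "card G \<le> card Z" using FG fin by (auto intro: card_mono)
    ultimately show "p ^ card F * (1 - p) ^ (card Y - card F) * (p ^ card G * (1 - p) ^ (card Z - card G))
        = p ^ card (F \<union> G) * (1 - p) ^ (card (Y \<union> Z) - card (F \<union> G))"
      by (simp add: power_add[symmetric] mult.assoc mult.left_commute[of "(1 - p) ^ _" "p ^ _"])
  qed
  also have "\<dots> = subset_prob (Y \<union> Z) p (\<lambda>E. P (E \<inter> Y) \<and> Q (E \<inter> Z))"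
    unfolding subset_prob_def
  proof (rule sum.reindex_bij_witness[of _ "\<lambda>E. (E \<inter> Y, E \<inter> Z)" "\<lambda>(F, G). F \<union> G"])
    fix a assume "a \<in> Pow Y \<times> Pow Z"
    then obtain F G where a: "a = (F, G)" "F \<subseteq> Y" "G \<subseteq> Z" by auto
    then have *: "(F \<union> G) \<inter> Y = F" "(F \<union> G) \<inter> Z = G" using disj by auto
    show "(case a of (F, G) \<Rightarrow> F \<union> G) \<in> Pow (Y \<union> Z)" using a by auto
    show "((case a of (F, G) \<Rightarrow> F \<union> G) \<inter> Y, (case a of (F, G) \<Rightarrow> F \<union> G) \<inter> Z) = a" using a * by simp
    show "(if P ((case a of (F, G) \<Rightarrow> F \<union> G) \<inter> Y) \<and> Q ((case a of (F, G) \<Rightarrow> F \<union> G) \<inter> Z)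
       then ?w (Y \<union> Z) (case a of (F, G) \<Rightarrow> F \<union> G) else 0)
       = (case a of (F, G) \<Rightarrow> if P F \<and> Q G then ?w (Y \<union> Z) (F \<union> G) else 0)" using a * by simp
  next
    fix E assume "E \<in> Pow (Y \<union> Z)"
    then show "(case (E \<inter> Y, E \<inter> Z) of (F, G) \<Rightarrow> F \<union> G) = E" "(E \<inter> Y, E \<inter> Z) \<in> Pow Y \<times> Pow Z" by auto
  qed
  finally show ?thesis by simp
qed

lemma subset_prob_exact:
  assumes "finite A" "finite B" "A \<inter> B = {}"
  shows "subset_prob (A \<union> B) p (\<lambda>E. A \<subseteq> E \<and> B \<inter> E = {}) = p ^ card A * (1 - p) ^ card B"
proof -
  have "subset_prob (A \<union> B) p (\<lambda>E. A \<subseteq> E \<and> B \<inter> E = {})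
      = (\<Sum>E\<in>Pow (A \<union> B). if E = A then p ^ card E * (1 - p) ^ (card (A \<union> B) - card E) else 0)"
    unfolding subset_prob_def using assms(3) by (intro sum.cong if_cong) auto
  also have "\<dots> = p ^ card A * (1 - p) ^ (card (A \<union> B) - card A)"
    using assms by (subst sum.delta) auto
  also have "card (A \<union> B) - card A = card B" using assms by (simp add: card_Un_disjoint)
  finally show ?thesis .
qed

lemma subset_prob_True: "finite X \<Longrightarrow> subset_prob X p (\<lambda>_. True) = 1"
proof (induction X rule: finite_induct)
  case empty
  then show ?case by (simp add: subset_prob_def)
next
  case (insert x X)
  have "Pow {x} = {{}, {x}}" by auto
  then have "subset_prob {x} p (\<lambda>_. True) = 1" by (simp add: subset_prob_def)
  then show ?case
    using subset_prob_Un[of "{x}" X p "\<lambda>_. True" "\<lambda>_. True"] insert by simp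
qed

lemma subset_prob_restrict:
  assumes "finite X" "Y \<subseteq> X"
  shows "subset_prob X p (\<lambda>E. P (E \<inter> Y)) = subset_prob Y p P"
proof -
  have "finite Y" "finite (X - Y)" "Y \<union> (X - Y) = X" using assms finite_subset by auto
  then show ?thesis
    using subset_prob_Un[of Y "X - Y" p P "\<lambda>_. True"] subset_prob_True[of "X - Y" p] by simp
qed

lemma subset_prob_not:
  assumes "finite X"
  shows "subset_prob X p (\<lambda>E. \<not> P E) = 1 - subset_prob X p P"
proof -
  have "subset_prob X p (\<lambda>E. \<not> P E) + subset_prob X p P = subset_prob X p (\<lambda>_. True)"
    unfolding subset_prob_def sum.distrib[symmetric] by (intro sum.cong) auto
  then show ?thesis using subset_prob_True[OF assms, of p] by simp
qed

lemma subset_prob_le_1: "finite X \<Longrightarrow> 0 \<le> p \<Longrightarrow> p \<le> 1 \<Longrightarrow> subset_prob X p P \<le> 1"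
  using subset_prob_mono[of p X P "\<lambda>_. True"] subset_prob_True[of X p] by simp

lemma subset_prob_disj:
  assumes "0 \<le> p" "p \<le> 1"
  shows "subset_prob X p (\<lambda>E. P E \<or> Q E) \<le> subset_prob X p P + subset_prob X p Q"
  unfolding subset_prob_def sum.distrib[symmetric] using assms by (intro sum_mono) auto

lemma subset_prob_union_bound:
  assumes "finite I" "0 \<le> p" "p \<le> 1"
  shows "subset_prob X p (\<lambda>E. \<exists>i\<in>I. P i E) \<le> (\<Sum>i\<in>I. subset_prob X p (P i))"
  using assms(1)
proof (induction I rule: finite_induct)
  case empty
  then show ?case by (simp add: subset_prob_def)
next
  case (insert i I)
  have "subset_prob X p (\<lambda>E. \<exists>j\<in>insert i I. P j E) = subset_prob X p (\<lambda>E. P i E \<or> (\<exists>j\<in>I. P j E))"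
    by simp
  also have "\<dots> \<le> subset_prob X p (P i) + subset_prob X p (\<lambda>E. \<exists>j\<in>I. P j E)"
    by (rule subset_prob_disj[OF assms(2,3)])
  finally show ?case using insert by simp
qed

lemma subset_prob_prod:
  assumes "finite I" "finite X" "\<And>i. i \<in> I \<Longrightarrow> Y i \<subseteq> X"
    and "\<And>i j. i \<in> I \<Longrightarrow> j \<in> I \<Longrightarrow> i \<noteq> j \<Longrightarrow> Y i \<inter> Y j = {}"
  shows "subset_prob X p (\<lambda>E. \<forall>i\<in>I. P i (E \<inter> Y i)) = (\<Prod>i\<in>I. subset_prob (Y i) p (P i))"
  using assms(1,3,4) assms(2)
proof (induction I arbitrary: X rule: finite_induct)
  case empty
  then show ?case by (simp add: subset_prob_True)
next
  case (insert i I)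
  let ?Z = "X - Y i"
  have Z: "Y j \<subseteq> ?Z" if "j \<in> I" for j
    using insert.prems(1)[of j] insert.prems(2)[of i j] insert.hyps(2) that by auto
  have X: "Y i \<union> ?Z = X" "finite (Y i)" "finite ?Z"
    using insert.prems(1)[of i] insert.prems(3) by (auto intro: finite_subset)
  have "subset_prob X p (\<lambda>E. \<forall>j\<in>insert i I. P j (E \<inter> Y j))
      = subset_prob (Y i \<union> ?Z) p (\<lambda>E. P i (E \<inter> Y i) \<and> (\<forall>j\<in>I. P j (E \<inter> ?Z \<inter> Y j)))"
  proof -
    have "E \<inter> ?Z \<inter> Y j = E \<inter> Y j" if "j \<in> I" for E j using Z[OF that] by auto
    then show ?thesis unfolding X by simp
  qed
  also have "\<dots> = subset_prob (Y i) p (P i) * subset_prob ?Z p (\<lambda>E. \<forall>j\<in>I. P j (E \<inter> Y j))"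
    using subset_prob_Un[OF X(2,3), of p "P i" "\<lambda>E. \<forall>j\<in>I. P j (E \<inter> Y j)"] by (simp add: Diff_disjoint)
  also have "subset_prob ?Z p (\<lambda>E. \<forall>j\<in>I. P j (E \<inter> Y j)) = (\<Prod>j\<in>I. subset_prob (Y j) p (P j))"
    by (rule insert.IH) (use insert.prems Z X in auto)
  finally show ?case using insert.hyps by simp
qed

section \<open>Events determined by the edges into a fixed vertex set\<close>

lemma finite_edge_slots: "finite (edge_slots n)"
proof (rule finite_subset)
  show "edge_slots n \<subseteq> Pow {..<n}" by (auto simp: edge_slots_def)
qed simp

definition star :: "nat \<Rightarrow> nat set \<Rightarrow> nat set set" where
  "star v U = (\<lambda>u. {v, u}) ` U"

lemma card_star: "finite U \<Longrightarrow> v \<notin> U \<Longrightarrow> card (star v U) = card U"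
  unfolding star_def by (rule card_image) (auto simp: inj_on_def doubleton_eq_iff)

lemma star_disjoint: "v \<notin> U \<Longrightarrow> v \<notin> U' \<Longrightarrow> U \<inter> U' = {} \<Longrightarrow> star v U \<inter> star v U' = {}"
  by (auto simp: star_def doubleton_eq_iff)

lemma star_Un: "star v (U \<union> U') = star v U \<union> star v U'"
  by (auto simp: star_def)

lemma star_subset_iff: "A \<subseteq> U \<Longrightarrow> star v A \<subseteq> E \<inter> star v U \<longleftrightarrow> (\<forall>a\<in>A. {v, a} \<in> E)"
  unfolding star_def by blast

lemma star_disjoint_iff: "B \<subseteq> U \<Longrightarrow> star v B \<inter> (E \<inter> star v U) = {} \<longleftrightarrow> (\<forall>b\<in>B. {v, b} \<notin> E)"
  unfolding star_def by blast

text \<open>The stars from different outside vertices into a fixed \<open>U\<close> share no edge,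
  so the conditions on them are independent.\<close>

lemma prob_rows:
  assumes U: "U \<subseteq> {..<n}"
    and row: "\<And>v. v < n \<Longrightarrow> v \<notin> U \<Longrightarrow> subset_prob (star v U) p (P v) = q"
  shows "subset_prob (edge_slots n) p (\<lambda>E. \<forall>v\<in>{..<n} - U. P v (E \<inter> star v U)) = q ^ (n - card U)"
proof -
  have "subset_prob (edge_slots n) p (\<lambda>E. \<forall>v\<in>{..<n} - U. P v (E \<inter> star v U))
      = (\<Prod>v\<in>{..<n} - U. subset_prob (star v U) p (P v))"
  proof (rule subset_prob_prod)
    show "star v U \<subseteq> edge_slots n" if "v \<in> {..<n} - U" for v
      using that U by (fastforce simp: star_def edge_slots_def)
    show "star v U \<inter> star w U = {}" if "v \<in> {..<n} - U" "w \<in> {..<n} - U" "v \<noteq> w" for v w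
      using that by (auto simp: star_def doubleton_eq_iff)
  qed (auto simp: finite_edge_slots)
  also have "\<dots> = (\<Prod>v\<in>{..<n} - U. q)" by (intro prod.cong) (auto simp: row)
  also have "\<dots> = q ^ (n - card U)" using U by (simp add: card_Diff_subset finite_subset)
  finally show ?thesis .
qed

lemma prob_no_witness:
  assumes "A \<subseteq> {..<n}" "B \<subseteq> {..<n}" "A \<inter> B = {}"
  shows "subset_prob (edge_slots n) p (\<lambda>E. witnesses n E A B = {})
    = (1 - p ^ card A * (1 - p) ^ card B) ^ (n - (card A + card B))"
proof -
  have fin: "finite A" "finite B" using assms by (auto intro: finite_subset[OF _ finite_lessThan])
  let ?P = "\<lambda>v E. \<not> (star v A \<subseteq> E \<and> star v B \<inter> E = {})"
  have "subset_prob (edge_slots n) p (\<lambda>E. witnesses n E A B = {})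
     = subset_prob (edge_slots n) p (\<lambda>E. \<forall>v\<in>{..<n} - (A \<union> B). ?P v (E \<inter> star v (A \<union> B)))"
    using star_subset_iff[of A "A \<union> B"] star_disjoint_iff[of B "A \<union> B"]
    by (intro subset_prob_cong) (auto simp: witnesses_def)
  also have "\<dots> = (1 - p ^ card A * (1 - p) ^ card B) ^ (n - card (A \<union> B))"
  proof (rule prob_rows)
    fix v assume v: "v \<notin> A \<union> B"
    have f: "finite (star v A)" "finite (star v B)" using fin by (auto simp: star_def)
    have "star v A \<inter> star v B = {}" using v assms(3) by (intro star_disjoint) auto
    then show "subset_prob (star v (A \<union> B)) p (?P v) = 1 - p ^ card A * (1 - p) ^ card B"
      using v fin f subset_prob_exact[OF f, of p]
        subset_prob_not[of "star v A \<union> star v B" p "\<lambda>E. star v A \<subseteq> E \<and> star v B \<inter> E = {}"]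
      unfolding star_Un by (simp add: card_star)
  qed (use assms in auto)
  finally show ?thesis using assms fin by (simp add: card_Un_disjoint)
qed

text \<open>A vertex outside \<open>A \<union> B \<union> S\<close> violates the event when it is a
  witness with an edge to \<open>S\<close>; the probability of this is that of a witness minus that
  of a witness without an edge to \<open>S\<close>.\<close>

lemma prob_isolated:
  assumes "A \<subseteq> {..<n}" "B \<subseteq> {..<n}" "S \<subseteq> {..<n}" "A \<inter> B = {}" "(A \<union> B) \<inter> S = {}"
  shows "subset_prob (edge_slots n) p (\<lambda>E. \<forall>v\<in>witnesses n E A B - S. \<forall>s\<in>S. {v, s} \<notin> E)
    = (1 - p ^ card A * (1 - p) ^ card B * (1 - (1 - p) ^ card S)) ^ (n - (card A + card B + card S))"
proof -
  have fin: "finite A" "finite B" "finite S" using assms by (auto intro: finite_subset[OF _ finite_lessThan])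
  let ?U = "A \<union> (B \<union> S)"
  let ?P = "\<lambda>v E. \<not> (star v A \<subseteq> E \<and> star v B \<inter> E = {} \<and> star v S \<inter> E \<noteq> {})"
  have "subset_prob (edge_slots n) p (\<lambda>E. \<forall>v\<in>witnesses n E A B - S. \<forall>s\<in>S. {v, s} \<notin> E)
     = subset_prob (edge_slots n) p (\<lambda>E. \<forall>v\<in>{..<n} - ?U. ?P v (E \<inter> star v ?U))"
  proof (rule subset_prob_cong)
    fix E
    have eq: "?P v (E \<inter> star v ?U) \<longleftrightarrow> \<not> ((\<forall>a\<in>A. {v, a} \<in> E) \<and> (\<forall>b\<in>B. {v, b} \<notin> E) \<and> (\<exists>s\<in>S. {v, s} \<in> E))" for v
    proof -
      have sub: "A \<subseteq> ?U" "B \<subseteq> ?U" "S \<subseteq> ?U" by auto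
      show ?thesis unfolding star_subset_iff[OF sub(1)] star_disjoint_iff[OF sub(2)] star_disjoint_iff[OF sub(3)]
        by blast
    qed
    show "(\<forall>v\<in>witnesses n E A B - S. \<forall>s\<in>S. {v, s} \<notin> E) = (\<forall>v\<in>{..<n} - ?U. ?P v (E \<inter> star v ?U))"
      unfolding eq witnesses_def by blast
  qed
  also have "\<dots> = (1 - p ^ card A * (1 - p) ^ card B * (1 - (1 - p) ^ card S)) ^ (n - card ?U)"
  proof (rule prob_rows)
    fix v assume v: "v \<notin> ?U"
    let ?A = "star v A" and ?B = "star v B" and ?S = "star v S"
    have "A \<inter> S = {}" "B \<inter> S = {}" using assms(5) by auto
    then have d: "?A \<inter> (?B \<union> ?S) = {}" "?A \<inter> ?B = {}" "?B \<inter> ?S = {}"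
      using v assms star_disjoint[of v A B] star_disjoint[of v A S] star_disjoint[of v B S] by auto
    have f: "finite ?A" "finite ?B" "finite ?S" using fin by (auto simp: star_def)
    have U: "star v ?U = ?A \<union> (?B \<union> ?S)" by (simp add: star_Un)
    have c: "card ?A = card A" "card ?B = card B" "card ?S = card S" using v fin by (auto simp: card_star)
    have 1: "subset_prob (star v ?U) p (\<lambda>E. ?A \<subseteq> E \<and> ?B \<inter> E = {}) = p ^ card A * (1 - p) ^ card B"
    proof -
      have "subset_prob (star v ?U) p (\<lambda>E. ?A \<subseteq> E \<and> ?B \<inter> E = {})
          = subset_prob (star v ?U) p (\<lambda>E. ?A \<subseteq> E \<inter> (?A \<union> ?B) \<and> ?B \<inter> (E \<inter> (?A \<union> ?B)) = {})"
        by (rule subset_prob_cong) auto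
      also have "\<dots> = subset_prob (?A \<union> ?B) p (\<lambda>E. ?A \<subseteq> E \<and> ?B \<inter> E = {})"
        by (rule subset_prob_restrict[where P = "\<lambda>E. ?A \<subseteq> E \<and> ?B \<inter> E = {}"]) (use f U in auto)
      finally show ?thesis using subset_prob_exact[OF f(1,2) d(2)] c by simp
    qed
    have 2: "subset_prob (star v ?U) p (\<lambda>E. ?A \<subseteq> E \<and> (?B \<union> ?S) \<inter> E = {}) = p ^ card A * (1 - p) ^ (card B + card S)"
      unfolding U using subset_prob_exact[OF f(1) _ d(1), of p] f c d(3) by (simp add: card_Un_disjoint)
    have "subset_prob (star v ?U) p (\<lambda>E. ?A \<subseteq> E \<and> ?B \<inter> E = {})
        = subset_prob (star v ?U) p (\<lambda>E. ?A \<subseteq> E \<and> ?B \<inter> E = {} \<and> ?S \<inter> E \<noteq> {})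
        + subset_prob (star v ?U) p (\<lambda>E. ?A \<subseteq> E \<and> (?B \<union> ?S) \<inter> E = {})"
      unfolding subset_prob_def sum.distrib[symmetric] by (intro sum.cong refl) (auto simp: Int_Un_distrib2)
    then have "subset_prob (star v ?U) p (\<lambda>E. ?A \<subseteq> E \<and> ?B \<inter> E = {} \<and> ?S \<inter> E \<noteq> {})
        = p ^ card A * (1 - p) ^ card B * (1 - (1 - p) ^ card S)"
      unfolding 1 2 by (simp add: power_add right_diff_distrib mult.assoc)
    then show "subset_prob (star v ?U) p (?P v) = 1 - p ^ card A * (1 - p) ^ card B * (1 - (1 - p) ^ card S)"
      using subset_prob_not[of "star v ?U" p "\<lambda>E. ?A \<subseteq> E \<and> ?B \<inter> E = {} \<and> ?S \<inter> E \<noteq> {}"] f U by simp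
  qed (use assms in auto)
  also have "card ?U = card A + card B + card S"
    using assms fin by (subst card_Un_disjoint; (subst card_Un_disjoint)?) auto
  finally show ?thesis .
qed

lemma prob_no_edges_between:
  assumes "S \<subseteq> {..<n}" "T \<subseteq> {..<n}" "S \<inter> T = {}"
  shows "subset_prob (edge_slots n) p (\<lambda>E. \<forall>s\<in>S. \<forall>t\<in>T. {s, t} \<notin> E) = (1 - p) ^ (card S * card T)"
proof -
  have fin: "finite S" "finite T" using assms by (auto intro: finite_subset[OF _ finite_lessThan])
  let ?Y = "(\<lambda>(s, t). {s, t}) ` (S \<times> T)"
  have "inj_on (\<lambda>(s, t). {s, t}) (S \<times> T)"
    using assms(3) by (auto simp: inj_on_def doubleton_eq_iff)
  then have card: "card ?Y = card S * card T" by (simp add: card_image card_cartesian_product)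
  have "subset_prob (edge_slots n) p (\<lambda>E. \<forall>s\<in>S. \<forall>t\<in>T. {s, t} \<notin> E)
      = subset_prob (edge_slots n) p (\<lambda>E. ?Y \<inter> (E \<inter> ?Y) = {})"
    by (rule subset_prob_cong) auto
  also have "\<dots> = subset_prob ?Y p (\<lambda>E. ?Y \<inter> E = {})"
  proof (rule subset_prob_restrict[where P = "\<lambda>E. ?Y \<inter> E = {}"])
    show "?Y \<subseteq> edge_slots n"
    proof
      fix e assume "e \<in> ?Y"
      then obtain s t where "s \<in> S" "t \<in> T" "e = {s, t}" by auto
      moreover have "s \<noteq> t" "s < n" "t < n" using calculation assms by auto
      ultimately show "e \<in> edge_slots n" unfolding edge_slots_def by blast
    qed
  qed (rule finite_edge_slots)
  also have "\<dots> = (1 - p) ^ card ?Y"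
    using subset_prob_exact[of "{}" ?Y p] fin by simp
  finally show ?thesis by (simp add: card)
qed

section \<open>Counting and exponential estimates\<close>

lemma card_small_subsets: "card {A. A \<subseteq> {..<n} \<and> card A \<le> k} \<le> (n + 1) ^ k"
proof -
  \<comment> \<open>Sets of size at most \<open>k\<close> are images of functions on
    \<open>{..<k}\<close>; the value \<open>n\<close> serves as a blank and is removed from the
    image.\<close>
  let ?F = "{..<k} \<rightarrow>\<^sub>E {..n}"
  have "{A. A \<subseteq> {..<n} \<and> card A \<le> k} \<subseteq> (\<lambda>f. f ` {..<k} - {n}) ` ?F"
  proof
    fix A assume "A \<in> {A. A \<subseteq> {..<n} \<and> card A \<le> k}"
    then have A: "A \<subseteq> {..<n}" "card A \<le> k" by auto
    then have "finite A" using finite_subset by blast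
    then obtain g where g: "bij_betw g {..<card A} A"
      using ex_bij_betw_nat_finite[of A] by (auto simp: atLeast0LessThan)
    let ?f = "\<lambda>i\<in>{..<k}. if i < card A then g i else n"
    have "g ` {..<card A} = A" using g by (simp add: bij_betw_def)
    then have gA: "x \<in> A \<longleftrightarrow> (\<exists>i<card A. x = g i)" for x by auto
    have "?f ` {..<k} - {n} = A"
    proof
      show "?f ` {..<k} - {n} \<subseteq> A" using gA by auto
      show "A \<subseteq> ?f ` {..<k} - {n}"
      proof
        fix x assume x: "x \<in> A"
        then obtain i where "i < card A" "x = g i" using gA by blast
        then have "x = ?f i" "i \<in> {..<k}" using A(2) by auto
        moreover have "x \<noteq> n" using x A(1) by auto
        ultimately show "x \<in> ?f ` {..<k} - {n}" by blast
      qed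
    qed
    moreover have "g i \<le> n" if "i < card A" for i using gA[of "g i"] that A(1) by auto
    then have "?f \<in> ?F" by auto
    ultimately show "A \<in> (\<lambda>f. f ` {..<k} - {n}) ` ?F" by blast
  qed
  then have "card {A. A \<subseteq> {..<n} \<and> card A \<le> k} \<le> card ?F"
    by (intro surj_card_le) (auto intro: finite_PiE)
  also have "\<dots> = (n + 1) ^ k" by (simp add: card_PiE)
  finally show ?thesis .
qed

lemma power_one_minus_le_exp:
  fixes q q' :: real
  assumes "0 \<le> q'" "q' \<le> q" "q \<le> 1" "N' \<le> N"
  shows "(1 - q) ^ N \<le> exp (- (q' * real N'))"
proof -
  have "(1 - q) ^ N \<le> exp (- q) ^ N"
    using assms exp_ge_add_one_self[of "- q"] by (intro power_mono) auto
  also have "\<dots> = exp (- (q * real N))" by (simp add: exp_of_nat_mult[symmetric] mult.commute)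
  also have "\<dots> \<le> exp (- (q' * real N'))" using assms by (simp add: mult_mono)
  finally show ?thesis .
qed

text \<open>Bernoulli gives \<open>1 + s * p \<le> (1 + p) ^ s\<close>, and
  \<open>(1 - p) ^ s * (1 + p) ^ s \<le> 1\<close>. A numerator linear in \<open>s\<close> is what
  makes the bound in \<open>prob_isolated_sets\<close> decay geometrically in
  \<open>card S\<close>.\<close>

lemma one_minus_power_ge:
  fixes p :: real
  assumes "0 \<le> p" "p \<le> 1"
  shows "real s * p / (1 + real s * p) \<le> 1 - (1 - p) ^ s"
proof -
  have pos: "1 + real s * p > 0" using assms by (simp add: add_pos_nonneg)
  have "(1 - p) ^ s * (1 + real s * p) \<le> (1 - p) ^ s * (1 + p) ^ s"
    using assms Bernoulli_inequality[of p s] by (intro mult_left_mono) auto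
  also have "\<dots> = (1 - p\<^sup>2) ^ s"
    by (simp add: power_mult_distrib[symmetric] power2_eq_square algebra_simps)
  also have "\<dots> \<le> 1" using assms by (intro power_le_one) (auto simp: power_le_one)
  finally have "(1 - p) ^ s \<le> 1 / (1 + real s * p)" using pos by (simp add: field_simps)
  moreover have "1 - 1 / (1 + real s * p) = real s * p / (1 + real s * p)"
    using pos by (simp add: field_simps)
  ultimately show ?thesis by linarith
qed

section \<open>Union bounds for the failure events\<close>

abbreviation small_sets :: "nat \<Rightarrow> nat \<Rightarrow> nat set set" where
  "small_sets n k \<equiv> {A. A \<subseteq> {..<n} \<and> card A \<le> k}"

lemma finite_small_sets: "finite (small_sets n k)"
  by (rule finite_subset[of _ "Pow {..<n}"]) auto

lemma prob_union_small_sets: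
  assumes p: "0 \<le> p" "p \<le> 1" and C: "0 \<le> C"
    and le: "\<And>A B. A \<subseteq> {..<n} \<Longrightarrow> card A \<le> k \<Longrightarrow> B \<subseteq> {..<n} \<Longrightarrow> card B \<le> m \<Longrightarrow>
      subset_prob X p (P A B) \<le> C"
  shows "subset_prob X p (\<lambda>E. \<exists>A B. A \<subseteq> {..<n} \<and> card A \<le> k \<and> B \<subseteq> {..<n} \<and> card B \<le> m \<and> P A B E)
    \<le> (real n + 1) ^ (k + m) * C"
proof -
  let ?I = "small_sets n k \<times> small_sets n m"
  have "subset_prob X p (\<lambda>E. \<exists>A B. A \<subseteq> {..<n} \<and> card A \<le> k \<and> B \<subseteq> {..<n} \<and> card B \<le> m \<and> P A B E)
      = subset_prob X p (\<lambda>E. \<exists>i\<in>?I. P (fst i) (snd i) E)"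
    by (rule subset_prob_cong) auto
  also have "\<dots> \<le> (\<Sum>i\<in>?I. subset_prob X p (P (fst i) (snd i)))"
    by (intro subset_prob_union_bound p finite_cartesian_product finite_small_sets)
  also have "\<dots> \<le> (\<Sum>i\<in>?I. C)" using le by (intro sum_mono) auto
  also have "\<dots> = real (card (small_sets n k)) * real (card (small_sets n m)) * C"
    by (simp add: card_cartesian_product)
  also have "\<dots> \<le> real ((n + 1) ^ k) * real ((n + 1) ^ m) * C"
    using card_small_subsets[of n k] card_small_subsets[of n m] C
    by (intro mult_mono mult_right_mono of_nat_mono) auto
  finally show ?thesis by (simp add: power_add add.commute)
qed

text \<open>Union bound over \<open>A\<close> and \<open>B\<close>: as \<open>p \<le> 1 / 2\<close>,
  the non-edges cost at most the factor \<open>1 / 2 ^ (2 * d + 2)\<close>, and at least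
  \<open>n - (3 * d + 2)\<close> vertices remain as independent candidates.\<close>

lemma prob_not_extension:
  assumes p: "0 < p" "p \<le> 1 / 2"
  shows "subset_prob (edge_slots n) p (\<lambda>E. \<not> extension_property d n E)
    \<le> (real n + 1) ^ (d + (2 * d + 2)) * exp (- (p ^ d / 2 ^ (2 * d + 2) * real (n - (3 * d + 2))))"
proof -
  define m where "m = 2 * d + 2"
  let ?C = "exp (- (p ^ d / 2 ^ m * real (n - (3 * d + 2))))"
  have "subset_prob (edge_slots n) p (\<lambda>E. \<not> extension_property d n E)
     \<le> subset_prob (edge_slots n) p (\<lambda>E. \<exists>A B. A \<subseteq> {..<n} \<and> card A \<le> d \<and> B \<subseteq> {..<n} \<and> card B \<le> m \<and>
          (A \<inter> B = {} \<and> witnesses n E A B = {}))"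
    using p unfolding extension_property_def m_def by (intro subset_prob_mono) auto
  also have "\<dots> \<le> (real n + 1) ^ (d + m) * ?C"
  proof (rule prob_union_small_sets)
    fix A B :: "nat set"
    assume AB: "A \<subseteq> {..<n}" "card A \<le> d" "B \<subseteq> {..<n}" "card B \<le> m"
    show "subset_prob (edge_slots n) p (\<lambda>E. A \<inter> B = {} \<and> witnesses n E A B = {}) \<le> ?C"
    proof (cases "A \<inter> B = {}")
      case True
      have "p ^ d \<le> p ^ card A" using p AB by (intro power_decreasing) auto
      moreover have "(1 / 2) ^ m \<le> (1 - p) ^ card B"
      proof -
        have "(1 / 2) ^ m \<le> (1 / 2 :: real) ^ card B" using AB by (intro power_decreasing) auto
        also have "\<dots> \<le> (1 - p) ^ card B" using p by (intro power_mono) auto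
        finally show ?thesis .
      qed
      ultimately have "p ^ d * (1 / 2) ^ m \<le> p ^ card A * (1 - p) ^ card B"
        using p by (intro mult_mono) auto
      moreover have "p ^ card A * (1 - p) ^ card B \<le> 1"
        using p by (intro mult_le_one power_le_one) auto
      ultimately show ?thesis
        using True prob_no_witness[OF AB(1,3) True, of p] p AB(2,4)
          power_one_minus_le_exp[of "p ^ d * (1 / 2) ^ m" _ "n - (3 * d + 2)" "n - (card A + card B)"]
        by (simp add: power_one_over m_def)
    qed (simp add: subset_prob_def)
  qed (use p in auto)
  finally show ?thesis by (simp add: m_def)
qed

text \<open>A fixed \<open>S\<close> is isolated with probability at most
  \<open>exp (- \<beta>) ^ card S\<close>, against at most \<open>(n + 1) ^ card S\<close> choices.
  As \<open>(n + 1) * exp (- \<beta>) \<le> 1\<close>, each of the \<open>t\<close> possible sizes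
  contributes at most \<open>(n + 1) * exp (- \<beta>)\<close>.\<close>

lemma prob_isolated_sets:
  assumes p: "0 < p" "p \<le> 1 / 2" and d: "1 \<le> d"
    and \<beta>: "\<beta> = p ^ d / 2 ^ (2 * d + 2) * real (n - (3 * d + 2 + t)) / (1 + real t * p)"
      "(real n + 1) * exp (- \<beta>) \<le> 1"
  shows "subset_prob (edge_slots n) p (\<lambda>E. \<exists>A B. A \<subseteq> {..<n} \<and> card A \<le> d - 1 \<and> B \<subseteq> {..<n} \<and> card B \<le> 2 * d + 2 \<and>
       (A \<inter> B = {} \<and> (\<exists>S. S \<subseteq> {..<n} - (A \<union> B) \<and> S \<noteq> {} \<and> card S \<le> t \<and>
          (\<forall>v\<in>witnesses n E A B - S. \<forall>s\<in>S. {v, s} \<notin> E))))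
    \<le> (real n + 1) ^ (3 * d + 2) * (real t * exp (- \<beta>))"
proof -
  define m where "m = 2 * d + 2"
  let ?X = "edge_slots n"
  have "subset_prob ?X p (\<lambda>E. \<exists>A B. A \<subseteq> {..<n} \<and> card A \<le> d - 1 \<and> B \<subseteq> {..<n} \<and> card B \<le> m \<and>
       (A \<inter> B = {} \<and> (\<exists>S. S \<subseteq> {..<n} - (A \<union> B) \<and> S \<noteq> {} \<and> card S \<le> t \<and>
          (\<forall>v\<in>witnesses n E A B - S. \<forall>s\<in>S. {v, s} \<notin> E))))
    \<le> (real n + 1) ^ (d - 1 + m) * (real t * ((real n + 1) * exp (- \<beta>)))"
  proof (rule prob_union_small_sets)
    fix A B :: "nat set"
    assume AB: "A \<subseteq> {..<n}" "card A \<le> d - 1" "B \<subseteq> {..<n}" "card B \<le> m"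
    let ?Q = "\<lambda>S E. \<forall>v\<in>witnesses n E A B - S. \<forall>s\<in>S. {v, s} \<notin> E"
    let ?I = "{S. S \<subseteq> {..<n} - (A \<union> B) \<and> S \<noteq> {} \<and> card S \<le> t}"
    show "subset_prob ?X p (\<lambda>E. A \<inter> B = {} \<and> (\<exists>S. S \<subseteq> {..<n} - (A \<union> B) \<and> S \<noteq> {} \<and> card S \<le> t \<and> ?Q S E))
        \<le> real t * ((real n + 1) * exp (- \<beta>))"
    proof (cases "A \<inter> B = {}")
      case True
      have single: "subset_prob ?X p (?Q S) \<le> exp (- \<beta>) ^ card S" if S: "S \<in> ?I" for S
      proof -
        have S': "S \<subseteq> {..<n}" "(A \<union> B) \<inter> S = {}" "card S \<le> t" using S by auto
        have "p ^ (d - 1) \<le> p ^ card A" using p AB by (intro power_decreasing) auto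
        moreover have "(1 / 2) ^ m \<le> (1 - p) ^ card B"
        proof -
          have "(1 / 2) ^ m \<le> (1 / 2 :: real) ^ card B" using AB by (intro power_decreasing) auto
          also have "\<dots> \<le> (1 - p) ^ card B" using p by (intro power_mono) auto
          finally show ?thesis .
        qed
        ultimately have 1: "p ^ (d - 1) * (1 / 2) ^ m \<le> p ^ card A * (1 - p) ^ card B"
          using p by (intro mult_mono) auto
        have "real (card S) * p / (1 + real t * p) \<le> real (card S) * p / (1 + real (card S) * p)"
          using p S'(3) by (intro divide_left_mono add_left_mono mult_right_mono) (auto intro!: mult_pos_pos add_pos_nonneg)
        also have "\<dots> \<le> 1 - (1 - p) ^ card S" using p by (intro one_minus_power_ge) auto
        finally have 2: "real (card S) * p / (1 + real t * p) \<le> 1 - (1 - p) ^ card S" .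
        let ?q = "p ^ card A * (1 - p) ^ card B * (1 - (1 - p) ^ card S)"
        let ?q' = "p ^ (d - 1) * (1 / 2) ^ m * (real (card S) * p / (1 + real t * p))"
        have "0 \<le> p ^ card A * (1 - p) ^ card B" "0 \<le> real (card S) * p / (1 + real t * p)" using p by auto
        then have "?q' \<le> ?q" using mult_mono[OF 1 2] by simp
        moreover have "?q \<le> 1" using p by (intro mult_le_one power_le_one) (auto simp: power_le_one)
        moreover have "0 \<le> ?q'" using p by (auto intro!: divide_nonneg_nonneg)
        ultimately have "subset_prob ?X p (?Q S) \<le> exp (- (?q' * real (n - (3 * d + 2 + t))))"
          using prob_isolated[OF AB(1,3) S'(1) True S'(2), of p] AB(2,4) S'(3) d
            power_one_minus_le_exp[of ?q' ?q "n - (3 * d + 2 + t)" "n - (card A + card B + card S)"]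
          by (simp add: m_def)
        also have "?q' * real (n - (3 * d + 2 + t)) = real (card S) * \<beta>"
        proof -
          \<comment> \<open>Since \<open>card A \<le> d - 1\<close>, the last factor
            \<open>p\<close> is available for an edge into \<open>S\<close>.\<close>
          have "p ^ d = p ^ (d - 1) * p" using d by (metis Suc_diff_1 less_le_trans power_Suc2 zero_less_one)
          then show ?thesis unfolding \<beta>(1) by (simp add: m_def power_one_over field_simps)
        qed
        also have "exp (- (real (card S) * \<beta>)) = exp (- \<beta>) ^ card S"
          by (simp add: exp_of_nat_mult[symmetric])
        finally show ?thesis .
      qed
      have finI: "finite ?I" by (rule finite_subset[of _ "Pow {..<n}"]) auto
      have "subset_prob ?X p (\<lambda>E. A \<inter> B = {} \<and> (\<exists>S. S \<subseteq> {..<n} - (A \<union> B) \<and> S \<noteq> {} \<and> card S \<le> t \<and> ?Q S E))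
          = subset_prob ?X p (\<lambda>E. \<exists>S\<in>?I. ?Q S E)"
        by (rule subset_prob_cong) (use True in blast)
      also have "\<dots> \<le> (\<Sum>S\<in>?I. subset_prob ?X p (?Q S))"
        using p by (intro subset_prob_union_bound finI) auto
      also have "\<dots> \<le> (\<Sum>S\<in>?I. exp (- \<beta>) ^ card S)" by (intro sum_mono single)
      also have "\<dots> = (\<Sum>s\<in>{1..t}. \<Sum>S\<in>{S \<in> ?I. card S = s}. exp (- \<beta>) ^ card S)"
      proof (rule sum.group[symmetric])
        show "card ` ?I \<subseteq> {1..t}"
        proof (rule image_subsetI)
          fix S assume S: "S \<in> ?I"
          then have "finite S" by (intro finite_subset[of S "{..<n} - (A \<union> B)"]) simp_all
          then have "card S \<noteq> 0" using S by simp
          then show "card S \<in> {1..t}" using S by simp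
        qed
      qed (use finI in simp_all)
      also have "\<dots> \<le> (\<Sum>s\<in>{1..t}. (real n + 1) * exp (- \<beta>))"
      proof (rule sum_mono)
        fix s assume s: "s \<in> {1..t}"
        have "(\<Sum>S\<in>{S \<in> ?I. card S = s}. exp (- \<beta>) ^ card S) = real (card {S \<in> ?I. card S = s}) * exp (- \<beta>) ^ s"
          by (subst sum.cong[OF refl, of _ _ "\<lambda>_. exp (- \<beta>) ^ s"]) simp_all
        also have "\<dots> \<le> real ((n + 1) ^ s) * exp (- \<beta>) ^ s"
        proof (intro mult_right_mono of_nat_mono)
          have "card {S \<in> ?I. card S = s} \<le> card (small_sets n s)"
            by (intro card_mono finite_small_sets) auto
          also have "\<dots> \<le> (n + 1) ^ s" by (rule card_small_subsets)
          finally show "card {S \<in> ?I. card S = s} \<le> (n + 1) ^ s" .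
        qed simp
        also have "\<dots> = ((real n + 1) * exp (- \<beta>)) ^ s" by (simp add: power_mult_distrib add.commute)
        also have "\<dots> \<le> ((real n + 1) * exp (- \<beta>)) ^ 1"
          using s \<beta>(2) by (intro power_decreasing) auto
        finally show "(\<Sum>S\<in>{S \<in> ?I. card S = s}. exp (- \<beta>) ^ card S) \<le> (real n + 1) * exp (- \<beta>)" by simp
      qed
      also have "\<dots> = real t * ((real n + 1) * exp (- \<beta>))" by simp
      finally show ?thesis .
    qed (simp add: subset_prob_def)
  qed (use p in auto)
  also have "(real n + 1) ^ (d - 1 + m) * (real t * ((real n + 1) * exp (- \<beta>)))
      = (real n + 1) ^ (3 * d + 2) * (real t * exp (- \<beta>))"
  proof -
    have "3 * d + 2 = Suc (d - 1 + m)" using d by (simp add: m_def)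
    then show ?thesis by simp
  qed
  finally show ?thesis unfolding m_def .
qed

text \<open>At most \<open>(n + 1) ^ (2 * t)\<close> choices compete with \<open>t * t\<close>
  absent edges, so the bound is useful once \<open>p * t\<close> exceeds
  \<open>2 * ln (n + 1)\<close>.\<close>

lemma prob_separated_large_sets:
  assumes p: "0 \<le> p" "p \<le> 1"
  shows "subset_prob (edge_slots n) p (\<lambda>E. \<exists>S T. S \<subseteq> {..<n} \<and> card S \<le> t \<and> T \<subseteq> {..<n} \<and> card T \<le> t \<and>
      (card S = t \<and> card T = t \<and> S \<inter> T = {} \<and> (\<forall>s\<in>S. \<forall>t\<in>T. {s, t} \<notin> E)))
    \<le> exp (2 * real t * ln (real n + 1) - p * real t * real t)"
proof -
  have "subset_prob (edge_slots n) p (\<lambda>E. \<exists>S T. S \<subseteq> {..<n} \<and> card S \<le> t \<and> T \<subseteq> {..<n} \<and> card T \<le> t \<and>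
      (card S = t \<and> card T = t \<and> S \<inter> T = {} \<and> (\<forall>s\<in>S. \<forall>t\<in>T. {s, t} \<notin> E)))
    \<le> (real n + 1) ^ (t + t) * exp (- (p * real (t * t)))"
  proof (rule prob_union_small_sets[OF p])
    fix S T :: "nat set"
    assume ST: "S \<subseteq> {..<n}" "T \<subseteq> {..<n}"
    show "subset_prob (edge_slots n) p (\<lambda>E. card S = t \<and> card T = t \<and> S \<inter> T = {} \<and> (\<forall>s\<in>S. \<forall>t\<in>T. {s, t} \<notin> E))
        \<le> exp (- (p * real (t * t)))"
    proof (cases "card S = t \<and> card T = t \<and> S \<inter> T = {}")
      case True
      then show ?thesis
        using prob_no_edges_between[OF ST, of p] power_one_minus_le_exp[of p p "t * t" "t * t"] p by simp
    next
      case False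
      then have "subset_prob (edge_slots n) p (\<lambda>E. card S = t \<and> card T = t \<and> S \<inter> T = {} \<and> (\<forall>s\<in>S. \<forall>t\<in>T. {s, t} \<notin> E)) = 0"
        unfolding subset_prob_def by (intro sum.neutral) auto
      then show ?thesis by simp
    qed
  qed simp
  also have "(real n + 1) ^ (t + t) = exp (2 * real t * ln (real n + 1))"
  proof -
    have "exp (2 * real t * ln (real n + 1)) = exp (real (t + t) * ln (real n + 1))" by (simp add: algebra_simps)
    also have "\<dots> = exp (ln (real n + 1)) ^ (t + t)" by (rule exp_of_nat_mult)
    finally show ?thesis by simp
  qed
  also have "exp (2 * real t * ln (real n + 1)) * exp (- (p * real (t * t)))
      = exp (2 * real t * ln (real n + 1) - p * real t * real t)"
    by (simp add: exp_add[symmetric] mult.assoc)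
  finally show ?thesis .
qed

text \<open>A cut of the witness set has a side with at most \<open>t\<close> vertices, isolated
  from the other witnesses, or \<open>t\<close> vertices can be picked on both sides. The second
  alternative does not mention \<open>A\<close> and \<open>B\<close>, so only \<open>S\<close> and
  \<open>T\<close> enter its union bound.\<close>

lemma not_connectivity_cases:
  assumes "\<not> connectivity_property d n E" "1 \<le> t" "1 \<le> d"
  shows "(\<exists>A B. A \<subseteq> {..<n} \<and> card A \<le> d - 1 \<and> B \<subseteq> {..<n} \<and> card B \<le> 2 * d + 2 \<and>
       (A \<inter> B = {} \<and> (\<exists>S. S \<subseteq> {..<n} - (A \<union> B) \<and> S \<noteq> {} \<and> card S \<le> t \<and>
          (\<forall>v\<in>witnesses n E A B - S. \<forall>s\<in>S. {v, s} \<notin> E)))) \<or>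
     (\<exists>S T. S \<subseteq> {..<n} \<and> card S \<le> t \<and> T \<subseteq> {..<n} \<and> card T \<le> t \<and>
      (card S = t \<and> card T = t \<and> S \<inter> T = {} \<and> (\<forall>s\<in>S. \<forall>t\<in>T. {s, t} \<notin> E)))"
proof -
  obtain A B where AB: "A \<subseteq> {..<n}" "B \<subseteq> {..<n}" "A \<inter> B = {}" "card A < d" "card B \<le> 2 * d + 2"
    and nc: "\<not> connected_in E (witnesses n E A B)"
    using assms(1) unfolding connectivity_property_def by blast
  let ?W = "witnesses n E A B"
  obtain T where T: "T \<subseteq> ?W" "T \<noteq> {}" "T \<noteq> ?W" and no: "\<And>x y. x \<in> T \<Longrightarrow> y \<in> ?W - T \<Longrightarrow> {x, y} \<notin> E"
    using nc unfolding connected_in_def by blast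
  have no': "\<And>x y. x \<in> T \<Longrightarrow> y \<in> ?W - T \<Longrightarrow> {y, x} \<notin> E" using no by (simp add: insert_commute)
  have W: "?W \<subseteq> {..<n} - (A \<union> B)" by (auto simp: witnesses_def)
  have A': "card A \<le> d - 1" using AB(4) by simp
  consider "card T \<le> t" | "card (?W - T) \<le> t" | "t \<le> card T" "t \<le> card (?W - T)" by linarith
  then show ?thesis
  proof cases
    case 1
    have "T \<subseteq> {..<n} - (A \<union> B)" "\<forall>v\<in>?W - T. \<forall>s\<in>T. {v, s} \<notin> E" using T W no' by auto
    then show ?thesis using AB A' 1 T(2) by blast
  next
    case 2
    have "?W - T \<subseteq> {..<n} - (A \<union> B)" "?W - T \<noteq> {}" using T W by auto
    moreover have "\<forall>v\<in>?W - (?W - T). \<forall>s\<in>?W - T. {v, s} \<notin> E" using no by blast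
    ultimately show ?thesis using AB A' 2 by blast
  next
    case 3
    obtain S1 where S1: "S1 \<subseteq> T" "card S1 = t" using 3(1) by (meson obtain_subset_with_card_n)
    obtain S2 where S2: "S2 \<subseteq> ?W - T" "card S2 = t" using 3(2) by (meson obtain_subset_with_card_n)
    have "S1 \<subseteq> {..<n}" "S2 \<subseteq> {..<n}" "S1 \<inter> S2 = {}" using S1 S2 W T(1) by blast+
    moreover have "\<forall>s\<in>S1. \<forall>t\<in>S2. {s, t} \<notin> E" using S1 S2 no by blast
    ultimately show ?thesis using S1(2) S2(2) by (intro disjI2 exI[of _ S1] exI[of _ S2]) simp
  qed
qed

text \<open>The available gain is \<open>n * p ^ d = n powr (2 * \<delta>)\<close>. The threshold
  \<open>t\<close>, about \<open>n powr (\<delta> + \<alpha>)\<close>, splits it evenly: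
  \<open>p * t\<close> is about \<open>n powr \<delta>\<close>, which outweighs the choices of large
  sets, and \<open>\<beta>\<close> is still at least \<open>c * n powr \<delta>\<close>, which
  outweighs those of small ones.\<close>

lemma gnp_good_tendsto_1:
  fixes d :: nat and \<alpha> :: real
  assumes d: "d \<ge> 1" and \<alpha>: "0 < \<alpha>" "\<alpha> < 1 / real d"
  shows "(\<lambda>n. gnp_prob n (real n powr (- \<alpha>))
    (\<lambda>E. extension_property d n E \<and> connectivity_property d n E)) \<longlonglongrightarrow> 1"
proof -
  define \<delta> where "\<delta> = (1 - \<alpha> * real d) / 2"
  have \<delta>: "\<delta> > 0" using \<alpha> d by (simp add: \<delta>_def field_simps)
  have \<alpha>1: "\<alpha> < 1"
  proof -
    have "1 / real d \<le> 1" using d by simp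
    then show ?thesis using \<alpha>(2) by linarith
  qed
  have \<gamma>: "0 < \<delta> + \<alpha>" "\<delta> + \<alpha> < 1"
  proof -
    have "\<alpha> * 1 \<le> \<alpha> * real d" using d \<alpha>(1) by (intro mult_left_mono) auto
    then show "\<delta> + \<alpha> < 1" using \<alpha>1 by (simp add: \<delta>_def field_simps)
  qed (use \<delta> \<alpha> in simp)
  define C where "C = real (3 * d + 2)"
  \<comment> \<open>The 6 is a factor 2 from \<open>n - (3 * d + 2 + t) \<ge> n / 2\<close> and a
    factor 3 from \<open>1 + t * p \<le> 3 * n powr \<delta>\<close>.\<close>
  define c where "c = 1 / (6 * 2 ^ (2 * d + 2) :: real)"
  have c: "c > 0" by (simp add: c_def)
  \<comment> \<open>One more than the exponent \<open>3 * d + 2\<close> of the union bounds, to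
    absorb \<open>t \<le> n + 1\<close>.\<close>
  define K where "K = 3 * d + 3"
  define tau where "tau n = nat \<lceil>real n powr (\<delta> + \<alpha>)\<rceil>" for n :: nat
  let ?p = "\<lambda>n::nat. real n powr (- \<alpha>)"
  let ?bd = "\<lambda>x::real. (x + 1) powr real K * exp (- c * x powr \<delta>)"
  \<comment> \<open>All that is required of large \<open>n\<close>; the rest is an estimate at a
    single \<open>n\<close>.\<close>
  have "eventually (\<lambda>x. x powr (- \<alpha>) \<le> 1 / 2 \<and> x - C - (x powr (\<delta> + \<alpha>) + 1) \<ge> x / 2 \<and>
      x powr \<delta> - 2 * ln (x + 1) \<ge> 1 \<and> 1 + (x powr (\<delta> + \<alpha>) + 1) * x powr (- \<alpha>) \<le> 3 * x powr \<delta> \<and>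
      (x + 1) * exp (- c * x powr \<delta>) \<le> 1 \<and> x \<ge> 1 \<and> x powr (\<delta> + \<alpha>) + 1 \<le> x + 1) at_top"
    using \<alpha>(1) \<delta> c \<gamma>
    by (intro eventually_conj) real_asymp+
  then have "eventually (\<lambda>n. ?p n \<le> 1 / 2 \<and> real n - C - (real n powr (\<delta> + \<alpha>) + 1) \<ge> real n / 2 \<and>
      real n powr \<delta> - 2 * ln (real n + 1) \<ge> 1 \<and>
      1 + (real n powr (\<delta> + \<alpha>) + 1) * real n powr (- \<alpha>) \<le> 3 * real n powr \<delta> \<and>
      (real n + 1) * exp (- c * real n powr \<delta>) \<le> 1 \<and> real n \<ge> 1 \<and> real n powr (\<delta> + \<alpha>) + 1 \<le> real n + 1) sequentially"
    by (rule eventually_compose_filterlim[OF _ filterlim_real_sequentially])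
  then have lower: "eventually (\<lambda>n. 1 - (2 * ?bd (real n) + exp (- (real n powr \<delta>)))
      \<le> gnp_prob n (?p n) (\<lambda>E. extension_property d n E \<and> connectivity_property d n E)) sequentially"
  proof eventually_elim
    case (elim n)
    define x p t where "x = real n" and "p = ?p n" and "t = tau n"
    let ?X = "edge_slots n"
    have e: "p \<le> 1 / 2" "x / 2 \<le> x - C - (x powr (\<delta> + \<alpha>) + 1)" "1 \<le> x powr \<delta> - 2 * ln (x + 1)"
      "1 + (x powr (\<delta> + \<alpha>) + 1) * p \<le> 3 * x powr \<delta>" "(x + 1) * exp (- c * x powr \<delta>) \<le> 1"
      "x powr (\<delta> + \<alpha>) + 1 \<le> x + 1" and x: "1 \<le> x"
      using elim unfolding x_def p_def by blast+
    have p: "0 < p" "p \<le> 1 / 2" using x e(1) by (auto simp: p_def x_def)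
    have pd: "p ^ d = x powr (- \<alpha> * real d)"
      using x by (simp add: p_def x_def powr_realpow[symmetric] powr_powr)
    have t: "x powr (\<delta> + \<alpha>) \<le> real t" "real t \<le> x powr (\<delta> + \<alpha>) + 1"
      using real_nat_ceiling_ge[of "x powr (\<delta> + \<alpha>)"] by (simp_all add: t_def tau_def x_def)
    have t1: "1 \<le> t"
    proof -
      have "1 \<le> x powr (\<delta> + \<alpha>)" using x \<gamma> by (intro ge_one_powr_ge_zero) auto
      then show ?thesis using t(1) by linarith
    qed
    have nC: "x / 2 \<le> real (n - (3 * d + 2 + t))"
      using e(2) t(2) unfolding C_def x_def by (simp add: of_nat_diff)
    have scale: "p ^ d * x = x powr (2 * \<delta>)"
    proof -
      have "2 * \<delta> = - \<alpha> * real d + 1" by (simp add: \<delta>_def)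
      then show ?thesis unfolding pd using x powr_add[of x "- \<alpha> * real d" 1] by simp
    qed
    define \<beta> where "\<beta> = p ^ d / 2 ^ (2 * d + 2) * real (n - (3 * d + 2 + t)) / (1 + real t * p)"
    have tp: "1 + real t * p \<le> 3 * x powr \<delta>"
    proof -
      have "real t * p \<le> (x powr (\<delta> + \<alpha>) + 1) * p" using t(2) p by (intro mult_right_mono) auto
      then show ?thesis using e(4) by linarith
    qed
    have \<beta>: "c * x powr \<delta> \<le> \<beta>"
    proof -
      have tp0: "0 < 1 + real t * p" using p by (simp add: add_pos_nonneg)
      have "c * x powr \<delta> * (1 + real t * p) \<le> c * x powr \<delta> * (3 * x powr \<delta>)"
        using tp c by (intro mult_left_mono) auto
      also have "\<dots> = 3 * c * x powr (2 * \<delta>)" by (simp add: powr_add[symmetric] mult_ac)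
      also have "\<dots> = p ^ d / 2 ^ (2 * d + 2) * (x / 2)"
        by (simp add: scale[symmetric] c_def)
      also have "\<dots> \<le> p ^ d / 2 ^ (2 * d + 2) * real (n - (3 * d + 2 + t))"
        using nC p by (intro mult_left_mono) auto
      finally show ?thesis unfolding \<beta>_def pos_le_divide_eq[OF tp0] .
    qed
    have exp\<beta>: "exp (- \<beta>) \<le> exp (- c * x powr \<delta>)" using \<beta> by simp
    have K: "(x + 1) powr real K = (x + 1) ^ (3 * d + 2) * (x + 1)"
    proof -
      have "(x + 1) powr real K = (x + 1) ^ K" using x by (intro powr_realpow) simp
      also have "\<dots> = (x + 1) ^ Suc (3 * d + 2)" by (rule arg_cong[of K]) (simp add: K_def)
      finally show ?thesis by (simp only: power_Suc2)
    qed
    have b1: "subset_prob ?X p (\<lambda>E. \<not> extension_property d n E) \<le> ?bd x"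
    proof -
      have "c * x powr \<delta> \<le> c * x powr (2 * \<delta>)" using c x \<delta> by (intro mult_left_mono powr_mono) auto
      also have "\<dots> \<le> p ^ d / 2 ^ (2 * d + 2) * (x / 2)"
        unfolding scale[symmetric] c_def using p x by (simp add: field_simps)
      also have "\<dots> \<le> p ^ d / 2 ^ (2 * d + 2) * real (n - (3 * d + 2))"
        using nC p by (intro mult_left_mono) auto
      finally have le: "exp (- (p ^ d / 2 ^ (2 * d + 2) * real (n - (3 * d + 2)))) \<le> exp (- c * x powr \<delta>)" by simp
      have "subset_prob ?X p (\<lambda>E. \<not> extension_property d n E)
          \<le> (x + 1) ^ (d + (2 * d + 2)) * exp (- (p ^ d / 2 ^ (2 * d + 2) * real (n - (3 * d + 2))))"
        unfolding x_def by (rule prob_not_extension[OF p])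
      also have "d + (2 * d + 2) = 3 * d + 2" by simp
      also have "(x + 1) ^ (3 * d + 2) * exp (- (p ^ d / 2 ^ (2 * d + 2) * real (n - (3 * d + 2))))
          \<le> (x + 1) ^ (3 * d + 2) * exp (- c * x powr \<delta>)"
        using le x by (intro mult_left_mono) simp_all
      also have "\<dots> \<le> ?bd x"
        unfolding K using x by (intro mult_right_mono) auto
      finally show ?thesis .
    qed
    let ?F1 = "\<lambda>E. \<exists>A B. A \<subseteq> {..<n} \<and> card A \<le> d - 1 \<and> B \<subseteq> {..<n} \<and> card B \<le> 2 * d + 2 \<and>
       (A \<inter> B = {} \<and> (\<exists>S. S \<subseteq> {..<n} - (A \<union> B) \<and> S \<noteq> {} \<and> card S \<le> t \<and>
          (\<forall>v\<in>witnesses n E A B - S. \<forall>s\<in>S. {v, s} \<notin> E)))"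
    let ?F2 = "\<lambda>E. \<exists>S T. S \<subseteq> {..<n} \<and> card S \<le> t \<and> T \<subseteq> {..<n} \<and> card T \<le> t \<and>
      (card S = t \<and> card T = t \<and> S \<inter> T = {} \<and> (\<forall>s\<in>S. \<forall>t\<in>T. {s, t} \<notin> E))"
    have b2: "subset_prob ?X p ?F1 \<le> ?bd x"
    proof -
      have "(real n + 1) * exp (- \<beta>) \<le> (real n + 1) * exp (- c * x powr \<delta>)"
        using exp\<beta> by (intro mult_left_mono) auto
      then have "(real n + 1) * exp (- \<beta>) \<le> 1" using e(5) unfolding x_def by linarith
      then have "subset_prob ?X p ?F1 \<le> (x + 1) ^ (3 * d + 2) * (real t * exp (- \<beta>))"
        unfolding x_def by (rule prob_isolated_sets[OF p d \<beta>_def])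
      also have "\<dots> \<le> (x + 1) ^ (3 * d + 2) * ((x + 1) * exp (- c * x powr \<delta>))"
        using exp\<beta> x e(6) t(2) by (intro mult_left_mono mult_mono) auto
      finally show ?thesis by (simp add: K mult.assoc)
    qed
    have b3: "subset_prob ?X p ?F2 \<le> exp (- (x powr \<delta>))"
    proof -
      have "x powr (\<delta> + \<alpha>) * p = x powr \<delta>" using x by (simp add: p_def x_def powr_add[symmetric])
      then have "x powr \<delta> \<le> real t * p" using t(1) p by (metis less_imp_le mult_right_mono)
      then have *: "1 \<le> p * real t - 2 * ln (x + 1)" using e(3) by (simp add: mult.commute)
      have "x powr \<delta> \<le> real t"
      proof -
        have "x powr \<delta> \<le> x powr (\<delta> + \<alpha>)" using x \<alpha>(1) by (intro powr_mono) auto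
        then show ?thesis using t(1) by linarith
      qed
      also have "\<dots> \<le> real t * (p * real t - 2 * ln (x + 1))" using mult_left_mono[OF *, of "real t"] by simp
      finally have "2 * real t * ln (x + 1) - p * real t * real t \<le> - (x powr \<delta>)" by (simp add: algebra_simps)
      moreover have "subset_prob ?X p ?F2 \<le> exp (2 * real t * ln (x + 1) - p * real t * real t)"
        unfolding x_def by (rule prob_separated_large_sets) (use p in simp_all)
      ultimately show ?thesis by (meson exp_le_cancel_iff order_trans)
    qed
    have p01: "0 \<le> p" "p \<le> 1" using p by auto
    have "subset_prob ?X p (\<lambda>E. \<not> (extension_property d n E \<and> connectivity_property d n E))
        \<le> subset_prob ?X p (\<lambda>E. \<not> extension_property d n E \<or> (?F1 E \<or> ?F2 E))"
    proof (rule subset_prob_mono[OF p01])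
      fix E assume "\<not> (extension_property d n E \<and> connectivity_property d n E)"
      then consider "\<not> extension_property d n E" | "\<not> connectivity_property d n E" by blast
      then show "\<not> extension_property d n E \<or> (?F1 E \<or> ?F2 E)"
      proof cases
        case 1
        then show ?thesis by (rule disjI1)
      next
        case 2
        from not_connectivity_cases[OF 2 t1 d] show ?thesis by (rule disjI2)
      qed
    qed
    also have "\<dots> \<le> subset_prob ?X p (\<lambda>E. \<not> extension_property d n E) + subset_prob ?X p (\<lambda>E. ?F1 E \<or> ?F2 E)"
      by (rule subset_prob_disj[OF p01])
    also have "\<dots> \<le> subset_prob ?X p (\<lambda>E. \<not> extension_property d n E) + (subset_prob ?X p ?F1 + subset_prob ?X p ?F2)"
      by (intro add_left_mono subset_prob_disj[OF p01])
    also have "\<dots> \<le> 2 * ?bd x + exp (- (x powr \<delta>))" using b1 b2 b3 by linarith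
    finally show ?case
      using subset_prob_not[OF finite_edge_slots, of n p "\<lambda>E. extension_property d n E \<and> connectivity_property d n E"]
      unfolding gnp_prob_eq x_def p_def by linarith
  qed
  have upper: "eventually (\<lambda>n. gnp_prob n (?p n) (\<lambda>E. extension_property d n E \<and> connectivity_property d n E) \<le> 1) sequentially"
  proof (rule eventually_sequentiallyI[of 1])
    fix n :: nat assume "1 \<le> n"
    then have "real n powr (- \<alpha>) \<le> 1" using \<alpha>(1) by (simp add: powr_minus_divide ge_one_powr_ge_zero)
    then show "gnp_prob n (?p n) (\<lambda>E. extension_property d n E \<and> connectivity_property d n E) \<le> 1"
      unfolding gnp_prob_eq by (intro subset_prob_le_1 finite_edge_slots) auto
  qed
  have "((\<lambda>x. (x + 1) powr k * exp (- c * x powr \<delta>)) \<longlongrightarrow> 0) at_top" for k :: real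
    using \<delta> c by real_asymp
  moreover have "((\<lambda>x. exp (- (x powr \<delta>))) \<longlongrightarrow> 0) at_top" using \<delta> by real_asymp
  ultimately have "((\<lambda>x. 1 - (2 * ?bd x + exp (- (x powr \<delta>)))) \<longlongrightarrow> 1 - (2 * 0 + 0)) at_top"
    by (intro tendsto_intros)
  then have "((\<lambda>x. 1 - (2 * ?bd x + exp (- (x powr \<delta>)))) \<longlongrightarrow> 1) at_top" by simp
  then have "(\<lambda>n. 1 - (2 * ?bd (real n) + exp (- (real n powr \<delta>)))) \<longlonglongrightarrow> 1"
    by (rule filterlim_compose[OF _ filterlim_real_sequentially])
  from tendsto_sandwich[OF lower upper this tendsto_const] show ?thesis .
qed

text \<open>A good graph has the coincidence property for every map at once, so the events are
  compared graph by graph and the probability is squeezed between that of good graphs and 1.\<close>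

theorem theorem1p3:
  fixes d :: nat and \<alpha> :: real
  assumes "d \<ge> 1" and "1 / real (d + 1) < \<alpha>" and "\<alpha> < 1 / real d"
    and "DIM('b::euclidean_space) = d + 1"
  shows "(\<lambda>n. gnp_prob n (real n powr (- \<alpha>))
            (\<lambda>E. \<forall>f :: (nat \<times> int \<Rightarrow> real) \<Rightarrow> 'b.
                   continuous_on (Ztilde_real n E) f \<longrightarrow>
                   (\<exists>x\<in>Ztilde_real n E. f x = f (swap_inv x))))
         \<longlonglongrightarrow> 1"
proof -
  have "0 < 1 / real (d + 1)" by simp
  then have \<alpha>: "0 < \<alpha>" using assms(2) by linarith
  let ?P = "\<lambda>n E. \<forall>f :: (nat \<times> int \<Rightarrow> real) \<Rightarrow> 'b. continuous_on (Ztilde_real n E) f \<longrightarrow>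
      (\<exists>x\<in>Ztilde_real n E. f x = f (swap_inv x))"
  have p01: "0 \<le> real n powr (- \<alpha>)" "real n powr (- \<alpha>) \<le> 1" if "1 \<le> n" for n
    using \<alpha> that by (simp_all add: powr_minus_divide ge_one_powr_ge_zero)
  have lower: "eventually (\<lambda>n. gnp_prob n (real n powr (- \<alpha>))
      (\<lambda>E. extension_property d n E \<and> connectivity_property d n E) \<le> gnp_prob n (real n powr (- \<alpha>)) (?P n)) sequentially"
  proof (rule eventually_sequentiallyI[of 1])
    fix n :: nat assume n: "1 \<le> n"
    show "gnp_prob n (real n powr (- \<alpha>)) (\<lambda>E. extension_property d n E \<and> connectivity_property d n E)
        \<le> gnp_prob n (real n powr (- \<alpha>)) (?P n)"
      unfolding gnp_prob_eq using good_graph_coincidence[OF assms(4), of n]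
      by (intro subset_prob_mono p01[OF n]) blast
  qed
  have upper: "eventually (\<lambda>n. gnp_prob n (real n powr (- \<alpha>)) (?P n) \<le> 1) sequentially"
    unfolding gnp_prob_eq
    by (rule eventually_sequentiallyI[of 1]) (intro subset_prob_le_1 finite_edge_slots p01)
  from tendsto_sandwich[OF lower upper gnp_good_tendsto_1[OF assms(1) \<alpha> assms(3)] tendsto_const]
  show ?thesis .
qed

end
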